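(* Consider the two-group model described in the context, with parameters $\delta>0$ (fixed), deterministic vectors $H=H^{(m)}\in\{0,1\}^m$, and correlation matrices $\Gamma=\Gamma^{(m)}$. Assume that $m_0=\sum_{i=1}^m(1-H_i)$ satisfies $\sqrt m\,(m_0/m-\pi_0)\to0$ as $m\to\infty$, for some $\pi_0\in(0,1)$. Assume that $\Gamma^{(m)}$ satisfies either both (a) and (b), or both (c) and (d), where (as $m\to\infty$): (a) $\dfrac{r_m^2}{m^2}\sum_{i\ne j}(\Gamma_{i,j})^2\to0$; (b) there exists $\varepsilon_0>0$ such that $\dfrac{r_m^{4+\varepsilon_0}}{m^2}\sum_{i\ne j}(\Gamma_{i,j})^4\to0$; (c) there exists $\varepsilon_0>0$ such that $\dfrac{r_m^{2+\varepsilon_0}}{m^2}\sum_{i\ne j}(\Gamma_{i,j})^2\to0$; (d) there exists $\varepsilon_0>0$ such that $m\gamma_m^{1+\varepsilon_0}\to+\infty$. Assume moreover that the rates $r_m,r_{0,m},r_{1,m}$ grow proportionally to infinity, i.e. they all tend to infinity and $r_{0,m}/r_m$ and $r_{1,m}/r_m$ converge to constants in $(0,\infty)$. Let $\alpha\in(0,1)$, let $t^\star$ be the unique $t\in(0,1)$ such that $G(t)=t/\alpha$, and let $h(t^\star)=\big(\phi(\Phi^{-1}(t^\star))/t^\star\big)^2$. Then, as $m\to\infty$, $$\frac{\mathrm{FDP}_m-\pi_0\alpha}{\pi_0\alpha\left\{(1/t^\star-1)/m_0+h(t^\star)\,\gamma_{0,m}\right\}^{1/2}}\ \leadsto\ \mathcal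 N(0,1)$$ (convergence in distribution), where $\gamma_{0,m}=m_0^{-2}\sum_{i\ne j}(1-H_i)(1-H_j)\Gamma_{i,j}$.
   Context: For each $m\ge1$, $Y=Y^{(m)}\sim\mathcal N(0,\Gamma^{(m)})$ is an $m$-dimensional centered Gaussian vector whose covariance matrix $\Gamma=\Gamma^{(m)}$ has unit diagonal; $H=(H_i)_{1\le i\le m}\in\{0,1\}^m$ and $X_i=\delta H_i+Y_i$ for $1\le i\le m$ (two-group model). Sums over $i\neq j$ run over ordered pairs of distinct indices in $\{1,\dots,m\}$. $\Phi(z)=\mathbb P(Z\ge z)$, $Z\sim\mathcal N(0,1)$, is the UPPER tail function of the standard Gaussian distribution, $\phi$ the standard Gaussian density. $m_0=\sum_{i}(1-H_i)$, $m_1=\sum_i H_i=m-m_0$, $\pi_1=1-\pi_0$. For $t\in[0,1]$: $F_0(t)=t$, $F_1(t)=\Phi(\Phi^{-1}(t)-\delta)$, $G(t)=\pi_0F_0(t)+\pi_1F_1(t)$. $\gamma_m=m^{-2}\sum_{i\ne j}\Gamma_{i,j}$, $r_m=(m^{-1}+|\gamma_m|)^{-1/2}$, $$r_{0,m}=\Big(m_0^{-1}+\Big|m_0^{-2}\sum_{i\ne j}(1-H_i)(1-H_j)\Gamma_{i,j}\Big|\Big)^{-1/2},\qquad r_{1,m}=\Big(m_1^{-1}+\Big|m_1^{-2}\sum_{i\ne j}H_iH_j\Gamma_{i,j}\Big|\Big)^{-1/2}.$$ Condition (d) is understood to include $\gamma_m>0$ for $m$ large. False discovery proportion of the Benjamini–Hochberg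 procedure at level $\alpha$: let $\widehat{\mathbb G}_m(t)=m^{-1}\sum_{i=1}^m\mathbf 1\{\Phi(X_i)\le t\}$ and $\widehat T_m=\sup\{t\in[0,1]:\widehat{\mathbb G}_m(t)\ge t/\alpha\}$. Then $$\mathrm{FDP}_m=\frac{m^{-1}\sum_{i=1}^m(1-H_i)\mathbf 1\{\Phi(X_i)\le\widehat T_m\}}{\widehat{\mathbb G}_m(\widehat T_m)}=\alpha\,\frac{m^{-1}\sum_{i=1}^m(1-H_i)\mathbf 1\{\Phi(X_i)\le\widehat T_m\}}{\widehat T_m}\quad\text{(a.s.)},$$ with the convention $0/0=0$. *)

theory Defs
  imports "HOL-Probability.Probability"
begin

section \<open>Gaussian vectors\<close>

(* The law N(mu, sigma^2); sigma = 0 gives the point mass at mu, since a covariance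
   matrix may be singular. *)
definition normal_law :: "real \<Rightarrow> real \<Rightarrow> real measure" where
  "normal_law \<mu> \<sigma> =
     (if \<sigma> = 0 then return borel \<mu> else density lborel (normal_density \<mu> \<sigma>))"

(* Coordinates are indexed by 1, ..., m; values of Y outside this range are irrelevant. *)
definition gaussian_vector :: "'a measure \<Rightarrow> nat \<Rightarrow> (nat \<Rightarrow> 'a \<Rightarrow> real) \<Rightarrow> bool" where
  "gaussian_vector M m Y \<longleftrightarrow>
     (\<forall>i\<in>{1..m}. Y i \<in> borel_measurable M) \<and>
     (\<forall>a :: nat \<Rightarrow> real. \<exists>\<mu> \<sigma>. \<sigma> \<ge> 0 \<and>
        distr M borel (\<lambda>\<omega>. \<Sum>i=1..m. a i * Y i \<omega>) = normal_law \<mu> \<sigma>)"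

definition centered_gaussian_vector ::
    "'a measure \<Rightarrow> nat \<Rightarrow> (nat \<Rightarrow> 'a \<Rightarrow> real) \<Rightarrow> (nat \<Rightarrow> nat \<Rightarrow> real) \<Rightarrow> bool" where
  "centered_gaussian_vector M m Y \<Gamma> \<longleftrightarrow>
     gaussian_vector M m Y \<and>
     (\<forall>i\<in>{1..m}. (\<integral>\<omega>. Y i \<omega> \<partial>M) = 0) \<and>
     (\<forall>i\<in>{1..m}. \<forall>j\<in>{1..m}. (\<integral>\<omega>. Y i \<omega> * Y j \<omega> \<partial>M) = \<Gamma> i j)"

section \<open>The two-group model\<close>

(* Upper tail function P(Z >= z) of Z ~ N(0,1). *)
definition Phi :: "real \<Rightarrow> real" where
  "Phi z = measure std_normal_distribution {z..}"

definition Phi_inv :: "real \<Rightarrow> real" where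
  "Phi_inv = inv Phi"

definition F0 :: "real \<Rightarrow> real" where
  "F0 t = t"

(* The end points use the conventions Phi_inv 0 = infinity, Phi_inv 1 = -infinity. *)
definition F1 :: "real \<Rightarrow> real \<Rightarrow> real" where
  "F1 \<delta> t = (if t \<le> 0 then 0 else if t \<ge> 1 then 1 else Phi (Phi_inv t - \<delta>))"

definition G :: "real \<Rightarrow> real \<Rightarrow> real \<Rightarrow> real" where
  "G \<delta> \<pi>0 t = \<pi>0 * F0 t + (1 - \<pi>0) * F1 \<delta> t"

definition t_star :: "real \<Rightarrow> real \<Rightarrow> real \<Rightarrow> real" where
  "t_star \<delta> \<pi>0 \<alpha> = (THE t. 0 < t \<and> t < 1 \<and> G \<delta> \<pi>0 t = t / \<alpha>)"

definition h :: "real \<Rightarrow> real" where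
  "h t = (std_normal_density (Phi_inv t) / t)\<^sup>2"

definition m0 :: "nat \<Rightarrow> (nat \<Rightarrow> real) \<Rightarrow> real" where
  "m0 m H = (\<Sum>i=1..m. 1 - H i)"

definition m1 :: "nat \<Rightarrow> (nat \<Rightarrow> real) \<Rightarrow> real" where
  "m1 m H = (\<Sum>i=1..m. H i)"

(* Sum over ordered pairs of distinct indices in {1..m}. *)
definition off_diag_sum :: "nat \<Rightarrow> (nat \<Rightarrow> nat \<Rightarrow> real) \<Rightarrow> real" where
  "off_diag_sum m f = (\<Sum>i=1..m. \<Sum>j\<in>{1..m} - {i}. f i j)"

definition gam :: "nat \<Rightarrow> (nat \<Rightarrow> nat \<Rightarrow> real) \<Rightarrow> real" where
  "gam m \<Gamma> = off_diag_sum m \<Gamma> / (real m)\<^sup>2"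

definition gam0 :: "nat \<Rightarrow> (nat \<Rightarrow> real) \<Rightarrow> (nat \<Rightarrow> nat \<Rightarrow> real) \<Rightarrow> real" where
  "gam0 m H \<Gamma> = off_diag_sum m (\<lambda>i j. (1 - H i) * (1 - H j) * \<Gamma> i j) / (m0 m H)\<^sup>2"

definition gam1 :: "nat \<Rightarrow> (nat \<Rightarrow> real) \<Rightarrow> (nat \<Rightarrow> nat \<Rightarrow> real) \<Rightarrow> real" where
  "gam1 m H \<Gamma> = off_diag_sum m (\<lambda>i j. H i * H j * \<Gamma> i j) / (m1 m H)\<^sup>2"

definition rate :: "nat \<Rightarrow> (nat \<Rightarrow> nat \<Rightarrow> real) \<Rightarrow> real" where
  "rate m \<Gamma> = (1 / real m + \<bar>gam m \<Gamma>\<bar>) powr (- 1 / 2)"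

definition rate0 :: "nat \<Rightarrow> (nat \<Rightarrow> real) \<Rightarrow> (nat \<Rightarrow> nat \<Rightarrow> real) \<Rightarrow> real" where
  "rate0 m H \<Gamma> = (1 / m0 m H + \<bar>gam0 m H \<Gamma>\<bar>) powr (- 1 / 2)"

definition rate1 :: "nat \<Rightarrow> (nat \<Rightarrow> real) \<Rightarrow> (nat \<Rightarrow> nat \<Rightarrow> real) \<Rightarrow> real" where
  "rate1 m H \<Gamma> = (1 / m1 m H + \<bar>gam1 m H \<Gamma>\<bar>) powr (- 1 / 2)"

section \<open>The Benjamini-Hochberg procedure\<close>

(* In this section x = (x_1, ..., x_m) is one realisation of the observations, with
   p-values Phi (x i). *)
definition emp_cdf :: "nat \<Rightarrow> (nat \<Rightarrow> real) \<Rightarrow> real \<Rightarrow> real" where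
  "emp_cdf m x t = (\<Sum>i=1..m. of_bool (Phi (x i) \<le> t)) / real m"

definition BH_threshold :: "real \<Rightarrow> nat \<Rightarrow> (nat \<Rightarrow> real) \<Rightarrow> real" where
  "BH_threshold \<alpha> m x = Sup {t. 0 \<le> t \<and> t \<le> 1 \<and> emp_cdf m x t \<ge> t / \<alpha>}"

(* The convention 0 / 0 = 0 is that of division in HOL. *)
definition FDP :: "real \<Rightarrow> nat \<Rightarrow> (nat \<Rightarrow> real) \<Rightarrow> (nat \<Rightarrow> real) \<Rightarrow> real" where
  "FDP \<alpha> m H x =
     ((\<Sum>i=1..m. (1 - H i) * of_bool (Phi (x i) \<le> BH_threshold \<alpha> m x)) / real m)
       / emp_cdf m x (BH_threshold \<alpha> m x)"

section \<open>Existence and uniqueness of the crossing point\<close>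

lemma measure_std_normal:
  assumes [measurable]: "A \<in> sets borel"
  shows "measure std_normal_distribution A = integral A std_normal_density"
proof -
  interpret real_distribution std_normal_distribution by (rule real_dist_normal_dist)
  have int: "set_integrable lborel A std_normal_density"
    unfolding set_integrable_def
    by (rule integrable_mult_indicator) auto
  have "measure std_normal_distribution A = (\<integral>x. indicator A x \<partial>std_normal_distribution)"
    by simp
  also have "\<dots> = (\<integral>x. std_normal_density x *\<^sub>R indicator A x \<partial>lborel)"
    by (rule integral_density) auto
  also have "\<dots> = set_lebesgue_integral lborel A std_normal_density"
    by (simp add: set_lebesgue_integral_def mult.commute)
  also have "\<dots> = integral A std_normal_density"
    using int by (rule set_borel_integral_eq_integral(2))
  finally show ?thesis .
qed

lemma Phi_diff:
  assumes "a \<le> b" shows "Phi b = Phi a - integral {a..b} std_normal_density"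
proof -
  interpret real_distribution std_normal_distribution by (rule real_dist_normal_dist)
  have "{a..} - {b..} = {a..<b}" by auto
  then have "measure std_normal_distribution {a..<b} = Phi a - Phi b"
    unfolding Phi_def using finite_measure_Diff[of "{a..}" "{b..}"] assms by auto
  moreover have "integral {a..<b} std_normal_density = integral {a..b} std_normal_density"
    by (rule integral_subset_negligible) (auto intro: negligible_subset[of "{b}"])
  ultimately show ?thesis by (simp add: measure_std_normal)
qed

lemma continuous_std_normal_density: "continuous_on A std_normal_density"
  unfolding std_normal_density_def by (intro continuous_intros) auto

lemma Phi_deriv: "(Phi has_real_derivative - std_normal_density z) (at z)"
proof -
  have "((\<lambda>u. integral {z - 1..u} std_normal_density) has_real_derivative std_normal_density z)
          (at z within {z - 1..z + 1})"
    by (intro integral_has_real_derivative continuous_std_normal_density) auto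
  then have "((\<lambda>u. integral {z - 1..u} std_normal_density) has_real_derivative std_normal_density z) (at z)"
    by (simp add: at_within_Icc_at)
  then have "((\<lambda>u. Phi (z - 1) - integral {z - 1..u} std_normal_density) 
        has_real_derivative 0 - std_normal_density z) (at z)"
    by (intro DERIV_diff DERIV_const)
  then have *: "((\<lambda>u. Phi (z - 1) - integral {z - 1..u} std_normal_density) 
        has_real_derivative - std_normal_density z) (at z)" by simp
  show ?thesis
  proof (rule DERIV_cong_ev[THEN iffD1, OF refl _ refl *])
    have "\<forall>\<^sub>F u in nhds z. u > z - 1"
      by (intro order_tendstoD(1)[OF filterlim_ident]) auto
    then show "\<forall>\<^sub>F u in nhds z. Phi (z - 1) - integral {z - 1..u} std_normal_density = Phi u"
      by eventually_elim (rule Phi_diff[symmetric], simp)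
  qed
qed

lemma Phi_eq_cdf: "Phi z = 1 - cdf std_normal_distribution z"
proof -
  interpret real_distribution std_normal_distribution by (rule real_dist_normal_dist)
  have "UNIV - {..z} = {z<..}" by auto
  then have "measure std_normal_distribution {z<..} = 1 - cdf std_normal_distribution z"
    unfolding cdf_def using finite_measure_Diff[of UNIV "{..z}"] prob_space by auto
  moreover have "integral {z<..} std_normal_density = integral {z..} std_normal_density"
    by (rule integral_subset_negligible) (auto intro: negligible_subset[of "{z}"])
  ultimately show ?thesis by (simp add: Phi_def measure_std_normal)
qed

lemma Phi_tendsto_0: "(Phi \<longlongrightarrow> 0) at_top"
proof -
  interpret real_distribution std_normal_distribution by (rule real_dist_normal_dist)
  show ?thesis using tendsto_diff[OF tendsto_const[of 1] cdf_lim_at_top_prob]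
    by (simp add: Phi_eq_cdf[abs_def])
qed

lemma Phi_tendsto_1: "(Phi \<longlongrightarrow> 1) at_bot"
proof -
  interpret real_distribution std_normal_distribution by (rule real_dist_normal_dist)
  show ?thesis using tendsto_diff[OF tendsto_const[of 1] cdf_lim_at_bot]
    by (simp add: Phi_eq_cdf[abs_def])
qed

lemma std_normal_pos: "std_normal_density x > 0"
  by (simp add: normal_density_pos)

lemma Phi_strict_antimono: "a < b \<Longrightarrow> Phi b < Phi a"
  by (rule DERIV_neg_imp_decreasing) (use Phi_deriv std_normal_pos in fastforce)+

lemma Phi_gt_0: "Phi z > 0"
proof -
  have "Phi (z + 1) \<ge> 0" by (simp add: Phi_def)
  then show ?thesis using Phi_strict_antimono[of z "z + 1"] by simp
qed

lemma Phi_lt_1: "Phi z < 1"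
proof -
  interpret real_distribution std_normal_distribution by (rule real_dist_normal_dist)
  have "Phi (z - 1) \<le> 1" by (simp add: Phi_def)
  then show ?thesis using Phi_strict_antimono[of "z - 1" z] by simp
qed

lemma isCont_Phi: "isCont Phi z"
  using Phi_deriv by (rule DERIV_isCont)

lemma inj_Phi: "inj Phi"
  by (rule injI) (metis Phi_strict_antimono less_irrefl linorder_neqE)

lemma Phi_inv_Phi [simp]: "Phi_inv (Phi z) = z"
  unfolding Phi_inv_def by (rule inv_f_f[OF inj_Phi])

lemma Phi_surj:
  assumes "0 < t" "t < 1" shows "\<exists>z. Phi z = t"
proof -
  obtain a where a: "Phi a > t"
    using order_tendstoD(1)[OF Phi_tendsto_1 assms(2)] eventually_happens'[OF trivial_limit_at_bot_linorder] by blast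
  obtain b where b: "Phi b < t"
    using order_tendstoD(2)[OF Phi_tendsto_0 assms(1)] eventually_happens'[OF trivial_limit_at_top_linorder] by blast
  have "a < b" using a b Phi_strict_antimono by (metis less_trans linorder_neqE order_less_asym)
  then show ?thesis using IVT2[of Phi b t a] a b isCont_Phi by auto
qed

lemma Phi_Phi_inv: "0 < t \<Longrightarrow> t < 1 \<Longrightarrow> Phi (Phi_inv t) = t"
  using Phi_surj Phi_inv_Phi by metis

(* The likelihood ratio of N(delta,1) against N(0,1). *)
lemma std_normal_shift:
  "std_normal_density (x - \<delta>) = exp (\<delta> * x - \<delta>\<^sup>2 / 2) * std_normal_density x"
  by (simp add: std_normal_density_def field_simps power2_eq_square flip: exp_add)

lemma Phi_shift_deriv: "((\<lambda>z. Phi (z - \<delta>)) has_real_derivative - std_normal_density (z - \<delta>)) (at z)"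
  using DERIV_shift[of Phi "- std_normal_density (z - \<delta>)" z "- \<delta>"] Phi_deriv[of "z - \<delta>"] by simp

lemma Phi_shift_gt:
  assumes "\<delta> > 0" shows "Phi (z - \<delta>) > exp (\<delta> * z - \<delta>\<^sup>2 / 2) * Phi z"
proof -
  let ?L = "\<lambda>x. exp (\<delta> * x - \<delta>\<^sup>2 / 2)"
  let ?D = "\<lambda>x. Phi (x - \<delta>) - ?L z * Phi x"
  have d: "(?D has_real_derivative (?L z - ?L x) * std_normal_density x) (at x)" for x
    by (auto intro!: derivative_eq_intros Phi_deriv Phi_shift_deriv simp: std_normal_shift algebra_simps)
  have dec: "?D y < ?D x" if "z \<le> x" "x < y" for x y
  proof (rule DERIV_neg_imp_decreasing_open[OF that(2)])
    show "\<exists>d. (?D has_real_derivative d) (at u) \<and> d < 0" if "x < u" "u < y" for u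
      using d[of u] that \<open>z \<le> x\<close> assms std_normal_pos[of u]
      by (intro exI[of _ "(?L z - ?L u) * std_normal_density u"]) (auto intro!: mult_neg_pos)
    show "continuous_on {x..y} ?D"
      using d by (intro continuous_at_imp_continuous_on) (blast intro: DERIV_isCont)
  qed
  have "filterlim (\<lambda>x::real. x - \<delta>) at_top at_top"
    using filterlim_tendsto_add_at_top[OF tendsto_const[of "-\<delta>"] filterlim_ident] by simp
  then have "(?D \<longlongrightarrow> 0 - ?L z * 0) at_top"
    by (intro tendsto_intros Phi_tendsto_0 filterlim_compose[OF Phi_tendsto_0])
  moreover have "\<forall>\<^sub>F x in at_top. ?D x \<le> ?D (z + 1)"
    using eventually_ge_at_top[of "z + 1"]
  proof eventually_elim
    case (elim x)
    then show ?case using dec[of "z + 1" x] by (cases "x = z + 1") auto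
  qed
  ultimately have "0 \<le> ?D (z + 1)"
    by (intro tendsto_upperbound[of ?D 0 at_top]) auto
  also have "\<dots> < ?D z" using dec[of z "z + 1"] by simp
  finally show ?thesis by simp
qed

lemma Phi_ratio_strict_mono:
  assumes "\<delta> > 0" "a < b" shows "Phi (a - \<delta>) / Phi a < Phi (b - \<delta>) / Phi b"
proof (rule DERIV_pos_imp_increasing[OF assms(2)])
  fix x
  let ?N = "- std_normal_density (x - \<delta>) * Phi x + Phi (x - \<delta>) * std_normal_density x"
  have "((\<lambda>x. Phi (x - \<delta>) / Phi x) has_real_derivative ?N / (Phi x * Phi x)) (at x)"
    using Phi_gt_0[of x] by (auto intro!: derivative_eq_intros Phi_deriv Phi_shift_deriv)
  moreover have "exp (\<delta> * x - \<delta>\<^sup>2 / 2) * Phi x * std_normal_density x < Phi (x - \<delta>) * std_normal_density x"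
    using Phi_shift_gt[OF assms(1)] std_normal_pos by (rule mult_strict_right_mono)
  then have "?N > 0" by (simp add: std_normal_shift algebra_simps)
  then have "?N / (Phi x * Phi x) > 0" using Phi_gt_0[of x] by simp
  ultimately show "\<exists>y. ((\<lambda>x. Phi (x - \<delta>) / Phi x) has_real_derivative y) (at x) \<and> y > 0" by blast
qed

lemma t_star_ex1:
  assumes "\<delta> > 0" "0 < \<pi>0" "\<pi>0 < 1" "0 < \<alpha>" "\<alpha> < 1"
  shows "\<exists>!t. 0 < t \<and> t < 1 \<and> G \<delta> \<pi>0 t = t / \<alpha>"
proof -
  define R where "R z = Phi (z - \<delta>) / Phi z" for z
  define c where "c = (1 / \<alpha> - \<pi>0) / (1 - \<pi>0)"
  have c: "c > 1" using assms by (simp add: c_def field_simps)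
  have G: "G \<delta> \<pi>0 (Phi z) = Phi z / \<alpha> \<longleftrightarrow> R z = c" for z
    using assms Phi_gt_0[of z] Phi_lt_1[of z]
    by (auto simp: G_def F0_def F1_def R_def c_def field_simps)
  have mono: "R a < R b" if "a < b" for a b
    unfolding R_def using Phi_ratio_strict_mono[OF assms(1) that] .
  have "filterlim (\<lambda>x::real. x - \<delta>) at_bot at_bot"
    unfolding filterlim_at_bot eventually_at_bot_linorder
    by (metis add.commute le_diff_eq diff_le_eq)
  then have "(R \<longlongrightarrow> 1 / 1) at_bot"
    unfolding R_def by (intro tendsto_divide Phi_tendsto_1 filterlim_compose[OF Phi_tendsto_1]) auto
  then obtain a where a: "R a < c"
    using order_tendstoD(2)[of R 1 at_bot c] c eventually_happens'[OF trivial_limit_at_bot_linorder] by auto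
  define b where "b = (ln c + \<delta>\<^sup>2 / 2) / \<delta>"
  have "exp (\<delta> * b - \<delta>\<^sup>2 / 2) = c" using assms c by (simp add: b_def)
  then have b: "R b > c"
    using Phi_shift_gt[OF assms(1), of b] Phi_gt_0[of b] by (simp add: R_def field_simps)
  have "a < b" using a b mono by (metis less_trans linorder_neqE order_less_asym)
  moreover have "isCont R z" for z
    unfolding R_def using Phi_gt_0[of z] isCont_Phi
    by (intro continuous_intros DERIV_isCont[OF Phi_shift_deriv]) auto
  ultimately obtain z where z: "R z = c"
    using IVT[of R a c b] a b by auto
  show ?thesis
  proof (rule ex1I[of _ "Phi z"])
    show "0 < Phi z \<and> Phi z < 1 \<and> G \<delta> \<pi>0 (Phi z) = Phi z / \<alpha>"
      using z G Phi_gt_0 Phi_lt_1 by simp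
    fix t assume t: "0 < t \<and> t < 1 \<and> G \<delta> \<pi>0 t = t / \<alpha>"
    then obtain y where y: "t = Phi y" using Phi_surj by metis
    then have "R y = R z" using t G z by simp
    then show "t = Phi z" using mono y by (metis less_irrefl linorder_neqE)
  qed
qed

end

theory Submission
  imports Defs
begin

text \<open>The null statistics enter the false discovery proportion through counts, so the whole
theorem is about the centred count \<open>D J z\<close> of the coordinates \<open>i \<in> J\<close> with
\<open>Y i \<ge> z\<close>. Let \<open>\<tau> = 1 / rate\<close>, so that \<open>1 / m \<le> \<tau>\<^sup>2\<close>, let \<open>I0\<close> be the set of true
nulls, \<open>T\<close> the threshold, \<open>t\<^sup>\<star>\<close> the crossing point and \<open>z\<^sup>\<star> = Phi_inv t\<^sup>\<star>\<close>.

Reduction to one sum. The threshold solves \<open>emp_cdf T = T / \<alpha>\<close> exactly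
(\<open>BH_threshold_props\<close>), so that \<open>FDP = \<alpha> (card I0 T + D I0 (Phi_inv T)) / (m T)\<close>. The
deterministic part is \<open>\<alpha> card I0 / m\<close>, whatever \<open>T\<close> is: the fluctuation of \<open>T\<close> has no
effect of first order, and \<open>FDP - \<pi>0 \<alpha>\<close> is \<open>\<alpha> D I0 z\<^sup>\<star> / (m t\<^sup>\<star>)\<close> up to \<open>o(\<tau>)\<close> as soon as
\<open>T\<close> is within \<open>O(\<tau>)\<close> of \<open>t\<^sup>\<star>\<close> and \<open>D I0\<close> hardly varies over such a window. For the first
fact, the concave function \<open>G\<close> crosses \<open>t / \<alpha>\<close> with a definite slope (\<open>crossing_slope\<close>), and
Chebyshev's inequality is applied at one point below \<open>t\<^sup>\<star>\<close> and at the points of a grid of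
step \<open>O(\<tau>)\<close> above it; the deviation required at the \<open>j\<close>-th point is proportional to \<open>j\<close>,
so the failure probabilities have a convergent sum (\<open>threshold_localised\<close>). For the
second, a finite grid of step \<open>\<eta> \<tau>\<close> suffices because counts are monotone
(\<open>null_modulus\<close>).

Normality of the sum. Write \<open>1{x \<ge> z} = Phi z + \<phi> z x + resid z x\<close>, where the residual is
orthogonal to the affine functions in \<open>L\<^sup>2\<close> of the standard Gaussian law. The affine part
of \<open>D J z\<close> is Gaussian with variance \<open>\<phi>\<^sup>2 V J\<close>, \<open>V J\<close> being the sum of the covariances over
\<open>J\<close>, however strong they are. Residuals at two coordinates of correlation \<open>\<rho>\<close> have a
covariance \<open>O(\<rho>\<^sup>2)\<close> only (\<open>resid_covariance_bound\<close>), so that their sum sees the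
dependence only through the sum \<open>E2\<close> of the \<open>\<Gamma>\<^sub>i\<^sub>j\<^sup>2\<close>, \<open>i \<noteq> j\<close>, which is \<open>o((m \<tau>)\<^sup>2)\<close> in
both regimes of the theorem. To treat both parts jointly, put \<open>R = (1 + \<Gamma>)\<^sup>-\<^sup>1\<close> and
\<open>Z = 2 R Y + (1 - 2 R) \<xi>\<close> with \<open>\<xi>\<close> standard Gaussian and independent of \<open>Y\<close>. Then \<open>Z\<close> has
independent standard coordinates and is so close to \<open>Y\<close> that replacing \<open>resid z (Y i)\<close> by
\<open>resid z (Z i)\<close> changes the sum by an amount whose second moment is at most an arbitrarily small multiple of
\<open>m\<close> plus a constant times \<open>E2\<close> (\<open>gaussian_coupling\<close>, \<open>resid_increment_bound\<close>). The sum of the \<open>Y i\<close> is a linear combination of the \<open>Z k\<close> plus an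
independent Gaussian variable, so that the characteristic function factorises, and each
factor is expanded to third order (\<open>residual_factor_bound\<close>). The result is
\<open>D_char_bound\<close>: \<open>D J z\<close> is asymptotically centred Gaussian with variance
\<open>card J rvar z + \<phi>\<^sup>2 V J\<close>, where \<open>rvar z\<close> is the variance of the residual.

For \<open>J = I0\<close> and \<open>z = z\<^sup>\<star>\<close> this variance is \<open>(m\<^sub>0 t\<^sup>\<star> s)\<^sup>2\<close> with \<open>s\<close> the square root in
the theorem (\<open>null_variance\<close>), and it is of order \<open>(m \<tau>)\<^sup>2\<close> because
\<open>rvar z\<^sup>\<star> > 0\<close> and the rates are proportional (\<open>rate_le_variance\<close>). Levy's continuity
theorem concludes.\<close>

section \<open>The standard Gaussian law and the Hermite residual of an indicator\<close>

lemma std_normal_density_le_1: "std_normal_density x \<le> 1"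
proof -
  have "1 \<le> sqrt (2 * pi)" using pi_gt3 by (simp add: real_le_rsqrt)
  then have "1 / sqrt (2 * pi) \<le> 1" by simp
  moreover have "exp (- x\<^sup>2 / 2) \<le> 1" by simp
  ultimately show ?thesis unfolding std_normal_density_def
    by (intro mult_le_one) auto
qed

lemma std_normal_density_nonneg: "0 \<le> std_normal_density x"
  by (simp add: std_normal_density_def)

lemma Phi_abs_le: "\<bar>of_bool b - Phi z\<bar> \<le> 1"
  using Phi_gt_0[of z] Phi_lt_1[of z] by (cases b) auto

text \<open>The indicator minus its orthogonal projection onto the affine functions in
  \<open>L\<^sup>2\<close> of the standard Gaussian law: the indicator has mean \<open>Phi
  z\<close>, and its product with the identity has mean \<open>std_normal_density
  z\<close>. The Hermite expansion of \<open>resid z\<close> thus starts in degree two.\<close>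

definition resid :: "real \<Rightarrow> real \<Rightarrow> real" where
  "resid z x = of_bool (z \<le> x) - Phi z - std_normal_density z * x"

lemma resid_measurable [measurable]: "resid z \<in> borel_measurable borel"
  unfolding resid_def of_bool_def by measurable

lemma abs_resid_le: "\<bar>resid z x\<bar> \<le> 1 + \<bar>x\<bar>"
proof -
  have "\<bar>std_normal_density z * x\<bar> \<le> \<bar>x\<bar>"
    using std_normal_density_le_1[of z] std_normal_density_nonneg[of z]
    by (simp add: abs_mult mult_left_le_one_le)
  moreover have "\<bar>resid z x\<bar> \<le> \<bar>of_bool (z \<le> x) - Phi z\<bar> + \<bar>std_normal_density z * x\<bar>"
    unfolding resid_def by (rule abs_triangle_ineq4)
  ultimately show ?thesis using Phi_abs_le[of "z \<le> x" z] by linarith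
qed

lemma std_normal_prob_space: "prob_space std_normal_distribution"
  by (rule prob_space_normal_density) simp

lemma integrable_std_normal_abs_power: "integrable std_normal_distribution (\<lambda>x. (1 + \<bar>x\<bar>) ^ k)"
proof (rule Bochner_Integration.integrable_bound)
  show "integrable std_normal_distribution (\<lambda>x. 2 ^ k * (1 + x ^ (2 * k)) :: real)"
    by (intro integrable_mult_right Bochner_Integration.integrable_add integrable_std_normal_distribution_moment
        finite_measure.integrable_const prob_space.finite_measure std_normal_prob_space)
  have "(1 + \<bar>x\<bar>) ^ k \<le> 2 ^ k * (1 + x ^ (2 * k))" for x :: real
  proof -
    have "(1 + \<bar>x\<bar>) ^ k \<le> (2 * max 1 \<bar>x\<bar>) ^ k" by (intro power_mono) auto
    also have "\<dots> = 2 ^ k * max 1 \<bar>x\<bar> ^ k" by (simp add: power_mult_distrib)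
    also have "max 1 \<bar>x\<bar> ^ k \<le> max 1 \<bar>x\<bar> ^ (2 * k)" by (intro power_increasing) auto
    also have "\<dots> \<le> 1 + x ^ (2 * k)" by (auto simp: max_def power_even_abs)
    finally show ?thesis by simp
  qed
  then show "AE x in std_normal_distribution. norm ((1 + \<bar>x\<bar>) ^ k) \<le> norm (2 ^ k * (1 + x ^ (2 * k)))"
    by (intro AE_I2) (auto simp: zero_le_even_power)
qed auto

lemma integrable_std_normal_bound:
  fixes f :: "real \<Rightarrow> 'b :: {banach, second_countable_topology}"
  assumes [measurable]: "f \<in> borel_measurable borel" and "\<And>x. norm (f x) \<le> c * (1 + \<bar>x\<bar>) ^ k"
  shows "integrable std_normal_distribution f"
proof (rule Bochner_Integration.integrable_bound)
  show "integrable std_normal_distribution (\<lambda>x. c * (1 + \<bar>x\<bar>) ^ k)"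
    by (intro integrable_mult_right integrable_std_normal_abs_power)
  show "AE x in std_normal_distribution. norm (f x) \<le> norm (c * (1 + \<bar>x\<bar>) ^ k)"
    using assms(2) by (intro AE_I2) (metis abs_ge_self order_trans real_norm_def)
qed (use assms in auto)

lemma integral_std_normal_indicator: "(\<integral>x. of_bool (z \<le> x) \<partial>std_normal_distribution) = Phi z"
proof -
  have "(\<lambda>x. of_bool (z \<le> x) :: real) = indicator {z..}" by (auto simp: fun_eq_iff)
  then show ?thesis by (simp add: Phi_def)
qed

lemma integral_std_normal_id: "(\<integral>x. x \<partial>std_normal_distribution) = 0"
  using integral_std_normal_distribution_moment_odd[of 1] by simp

lemma integral_std_normal_square: "(\<integral>x. x\<^sup>2 \<partial>std_normal_distribution) = 1"
  using std_normal_distribution_even_moments(1)[of 1] by (simp add: numeral_2_eq_2)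

lemma std_normal_density_deriv:
  "(std_normal_density has_real_derivative - x * std_normal_density x) (at x)"
  unfolding std_normal_density_def[abs_def] by (auto intro!: derivative_eq_intros simp: field_simps)

lemma std_normal_density_tendsto_0: "(std_normal_density \<longlongrightarrow> 0) at_top"
proof -
  have "filterlim (\<lambda>x::real. - (x\<^sup>2 / 2)) at_bot at_top"
    by real_asymp
  then have "((\<lambda>x::real. exp (- (x\<^sup>2 / 2))) \<longlongrightarrow> 0) at_top"
    by (rule filterlim_compose[OF exp_at_bot])
  from tendsto_mult[OF tendsto_const[of "1 / sqrt (2 * pi)"] this]
  show ?thesis by (simp add: std_normal_density_def[abs_def])
qed

text \<open>The density is, up to sign, a primitive of \<open>x * std_normal_density x\<close>.\<close>

lemma integral_std_normal_indicator_id: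
  "(\<integral>x. of_bool (z \<le> x) * x \<partial>std_normal_distribution) = std_normal_density z"
proof -
  have int: "integrable lborel (\<lambda>x. x * std_normal_density x)"
    using integrable_std_normal_moment[of 1] by (simp add: mult.commute)
  have "(LBINT x=ereal z..\<infinity>. x * std_normal_density x) = 0 - (- std_normal_density z)"
  proof (rule interval_integral_FTC_integrable)
    show "((\<lambda>x. - std_normal_density x) has_vector_derivative x * std_normal_density x) (at x)" for x
      using DERIV_minus[OF std_normal_density_deriv[of x]]
      by (simp add: has_real_derivative_iff_has_vector_derivative)
    show "isCont (\<lambda>x. x * std_normal_density x) x" for x
      by (intro continuous_intros DERIV_isCont[OF std_normal_density_deriv])
    show "set_integrable lborel (einterval (ereal z) \<infinity>) (\<lambda>x. x * std_normal_density x)"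
      unfolding set_integrable_def using int by (intro integrable_mult_indicator) auto
    have "isCont (\<lambda>x. - std_normal_density x) z"
      by (intro continuous_intros DERIV_isCont[OF std_normal_density_deriv])
    then show "(((\<lambda>x. - std_normal_density x) \<circ> real_of_ereal) \<longlongrightarrow> - std_normal_density z) (at_right (ereal z))"
      by (simp add: ereal_tendsto_simps isCont_def filterlim_at_split)
    show "(((\<lambda>x. - std_normal_density x) \<circ> real_of_ereal) \<longlongrightarrow> 0) (at_left \<infinity>)"
      using tendsto_minus[OF std_normal_density_tendsto_0] by (simp add: ereal_tendsto_simps)
  qed simp
  then have "(\<integral>x. indicator {z<..} x *\<^sub>R (x * std_normal_density x) \<partial>lborel) = std_normal_density z"
    by (simp add: interval_lebesgue_integral_def set_lebesgue_integral_def)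
  moreover have "(\<integral>x. indicator {z<..} x *\<^sub>R (x * std_normal_density x) \<partial>lborel) =
      (\<integral>x. std_normal_density x *\<^sub>R (of_bool (z \<le> x) * x) \<partial>lborel)"
  proof (rule integral_cong_AE)
    have "AE x in lborel. x \<noteq> z" by (rule AE_lborel_singleton)
    then show "AE x in lborel. indicator {z<..} x *\<^sub>R (x * std_normal_density x) =
        std_normal_density x *\<^sub>R (of_bool (z \<le> x) * x)"
      by eventually_elim (auto simp: indicator_def)
  qed (auto simp: of_bool_def)
  moreover have "(\<integral>x. of_bool (z \<le> x) * x \<partial>std_normal_distribution) =
      (\<integral>x. std_normal_density x *\<^sub>R (of_bool (z \<le> x) * x) \<partial>lborel)"
    by (rule integral_density) (auto simp: of_bool_def)
  ultimately show ?thesis by simp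
qed

lemma integrable_std_normal_resid:
  "integrable std_normal_distribution (resid z)"
  "integrable std_normal_distribution (\<lambda>x. resid z x * x)"
  "integrable std_normal_distribution (\<lambda>x. (resid z x)\<^sup>2)"
proof -
  show "integrable std_normal_distribution (resid z)"
    by (rule integrable_std_normal_bound[where c=1 and k=1]) (use abs_resid_le in auto)
  have "\<bar>resid z x\<bar> * \<bar>x\<bar> \<le> (1 + \<bar>x\<bar>) * (1 + \<bar>x\<bar>)" for x
    by (intro mult_mono abs_resid_le) auto
  then show "integrable std_normal_distribution (\<lambda>x. resid z x * x)"
    by (intro integrable_std_normal_bound[where c=1 and k=2]) (auto simp: abs_mult power2_eq_square)
  have "\<bar>resid z x\<bar>\<^sup>2 \<le> (1 + \<bar>x\<bar>)\<^sup>2" for x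
    by (intro power_mono abs_resid_le) auto
  then show "integrable std_normal_distribution (\<lambda>x. (resid z x)\<^sup>2)"
    by (intro integrable_std_normal_bound[where c=1 and k=2]) auto
qed

lemma integrable_std_normal_parts:
  "integrable std_normal_distribution (\<lambda>x. of_bool (z \<le> x) :: real)"
  "integrable std_normal_distribution (\<lambda>x. x)"
  "integrable std_normal_distribution (\<lambda>x. x\<^sup>2)"
  "integrable std_normal_distribution (\<lambda>x. of_bool (z \<le> x) * x)"
proof -
  show "integrable std_normal_distribution (\<lambda>x. of_bool (z \<le> x) :: real)"
    by (rule integrable_std_normal_bound[where c=1 and k=1]) (auto simp: of_bool_def)
  show "integrable std_normal_distribution (\<lambda>x. of_bool (z \<le> x) * x)"
    by (rule integrable_std_normal_bound[where c=1 and k=1]) (auto simp: of_bool_def)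
  show "integrable std_normal_distribution (\<lambda>x. x)"
    using integrable_std_normal_distribution_moment[of 1] by simp
  show "integrable std_normal_distribution (\<lambda>x. x\<^sup>2)"
    by (rule integrable_std_normal_distribution_moment)
qed

lemma integral_std_normal_resid: "(\<integral>x. resid z x \<partial>std_normal_distribution) = 0"
proof -
  interpret std_normal: prob_space std_normal_distribution by (rule std_normal_prob_space)
  have "(\<integral>x. resid z x \<partial>std_normal_distribution) = (\<integral>x. of_bool (z \<le> x) \<partial>std_normal_distribution)
      - (\<integral>x. Phi z \<partial>std_normal_distribution) - (\<integral>x. std_normal_density z * x \<partial>std_normal_distribution)"
    unfolding resid_def
    by (subst Bochner_Integration.integral_diff, (intro Bochner_Integration.integrable_diff integrable_mult_right integrable_std_normal_parts std_normal.integrable_const)+)+ (rule refl)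
  also have "(\<integral>x. Phi z \<partial>std_normal_distribution) = Phi z"
    using std_normal.prob_space by (simp only: lebesgue_integral_const) simp
  finally show ?thesis
    by (simp only: integral_mult_right_zero integral_std_normal_indicator integral_std_normal_id)
qed

lemma integral_std_normal_resid_id: "(\<integral>x. resid z x * x \<partial>std_normal_distribution) = 0"
proof -
  have eq: "resid z x * x = of_bool (z \<le> x) * x - Phi z * x - std_normal_density z * x\<^sup>2" for x
    by (simp add: resid_def algebra_simps power2_eq_square)
  have "(\<integral>x. resid z x * x \<partial>std_normal_distribution) = (\<integral>x. of_bool (z \<le> x) * x \<partial>std_normal_distribution)
      - (\<integral>x. Phi z * x \<partial>std_normal_distribution) - (\<integral>x. std_normal_density z * x\<^sup>2 \<partial>std_normal_distribution)"
    unfolding eq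
    by (subst Bochner_Integration.integral_diff, (intro Bochner_Integration.integrable_diff integrable_mult_right integrable_std_normal_parts)+)+ (rule refl)
  also have "\<dots> = std_normal_density z - Phi z * 0 - std_normal_density z * 1"
    by (simp only: integral_mult_right_zero integral_std_normal_indicator_id integral_std_normal_id integral_std_normal_square)
  finally show ?thesis by simp
qed

definition rvar :: "real \<Rightarrow> real" where
  "rvar z = Phi z * (1 - Phi z) - (std_normal_density z)\<^sup>2"

lemma integral_std_normal_resid_square: "(\<integral>x. (resid z x)\<^sup>2 \<partial>std_normal_distribution) = rvar z"
proof -
  let ?p = "std_normal_density z"
  have eq: "(resid z x)\<^sup>2 = (1 - Phi z) * of_bool (z \<le> x) - Phi z * resid z x - ?p * (resid z x * x) - ?p * (of_bool (z \<le> x) * x)" for x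
    by (cases "z \<le> x") (auto simp: resid_def algebra_simps power2_eq_square)
  have i: "integrable std_normal_distribution (\<lambda>x. (1 - Phi z) * of_bool (z \<le> x))"
    "integrable std_normal_distribution (\<lambda>x. Phi z * resid z x)"
    "integrable std_normal_distribution (\<lambda>x. ?p * (resid z x * x))"
    "integrable std_normal_distribution (\<lambda>x. ?p * (of_bool (z \<le> x) * x))"
    by (intro integrable_mult_right integrable_std_normal_parts integrable_std_normal_resid)+
  have "(\<integral>x. (resid z x)\<^sup>2 \<partial>std_normal_distribution) =
      (\<integral>x. (1 - Phi z) * of_bool (z \<le> x) \<partial>std_normal_distribution) - (\<integral>x. Phi z * resid z x \<partial>std_normal_distribution)
      - (\<integral>x. ?p * (resid z x * x) \<partial>std_normal_distribution) - (\<integral>x. ?p * (of_bool (z \<le> x) * x) \<partial>std_normal_distribution)"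
    unfolding eq by (simp only: Bochner_Integration.integral_diff Bochner_Integration.integrable_diff i)
  also have "\<dots> = (1 - Phi z) * Phi z - ?p * ?p"
    by (simp only: integral_mult_right_zero integral_std_normal_indicator integral_std_normal_resid
        integral_std_normal_resid_id integral_std_normal_indicator_id mult_zero_right diff_zero)
  also have "\<dots> = rvar z" by (simp add: rvar_def power2_eq_square algebra_simps)
  finally show ?thesis .
qed

text \<open>A vanishing variance would make the indicator affine almost everywhere; but far to the
  left the indicator is zero while the affine function that is subtracted is not. This
  strict positivity keeps the normalisation of the limit theorem from degenerating when
  the correlations cancel in the linear part.\<close>

lemma rvar_pos: "rvar z > 0"
proof -
  have "rvar z \<ge> 0" unfolding integral_std_normal_resid_square[symmetric] by simp
  moreover have "rvar z \<noteq> 0"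
  proof
    assume "rvar z = 0"
    then have "AE x in std_normal_distribution. (resid z x)\<^sup>2 = 0"
      using integrable_std_normal_resid(3)[of z]
      by (subst integral_nonneg_eq_0_iff_AE[symmetric]) (auto simp: integral_std_normal_resid_square)
    then have "AE x in lborel. resid z x = 0"
      by (subst (asm) AE_density) (auto simp: std_normal_pos)
    moreover have "\<exists>y. y < z \<and> (\<forall>x<y. resid z x \<noteq> 0)"
    proof (intro exI[of _ "min (z - 1) (- Phi z / std_normal_density z)"] conjI allI impI)
      fix x assume x: "x < min (z - 1) (- Phi z / std_normal_density z)"
      then have "x * std_normal_density z < - Phi z"
        using std_normal_pos[of z] by (auto simp: field_simps)
      then show "resid z x \<noteq> 0" using x by (auto simp: resid_def mult.commute)
    qed simp
    then obtain y where y: "\<And>x. x < y \<Longrightarrow> resid z x \<noteq> 0" by blast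
    ultimately have "AE x in lborel. x \<notin> {y-1..<y}"
      by (auto elim!: eventually_mono)
    then have "emeasure lborel {y-1..<y} = 0"
      by (subst (asm) AE_iff_measurable[of "{y-1..<y}"]) auto
    then show False by simp
  qed
  ultimately show ?thesis by simp
qed

section \<open>Decoupling by characteristic functions\<close>

lemma (in prob_space) integrable_bounded:
  fixes f :: "'a \<Rightarrow> 'b :: {banach, second_countable_topology}"
  assumes "f \<in> borel_measurable M" "\<And>x. norm (f x) \<le> B"
  shows "integrable M f"
  using assms by (intro integrable_const_bound[of _ B]) auto

text \<open>Shifted and normalised, \<open>W\<close> is a probability density, and the hypothesis
  says that the change of measure that it defines leaves the characteristic function of
  \<open>X\<close> unchanged. By uniqueness of characteristic functions it leaves the law
  of \<open>X\<close> unchanged, which is the claim. In this way independence is obtained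
  from factorising characteristic functions without joint laws in several dimensions.\<close>

lemma (in prob_space) decouple_real:
  fixes W :: "'a \<Rightarrow> real" and f :: "real \<Rightarrow> complex"
  assumes [measurable]: "X \<in> borel_measurable M" "W \<in> borel_measurable M" "f \<in> borel_measurable borel"
    and W: "\<And>\<omega>. \<bar>W \<omega>\<bar> \<le> B" and f: "\<And>x. norm (f x) \<le> D"
    and char: "\<And>a. (CLINT \<omega>|M. iexp (a * X \<omega>) * of_real (W \<omega>)) = (CLINT \<omega>|M. iexp (a * X \<omega>)) * of_real w"
  shows "(CLINT \<omega>|M. f (X \<omega>) * of_real (W \<omega>)) = (CLINT \<omega>|M. f (X \<omega>)) * of_real w"
proof -
  have B0: "B \<ge> 0" using W[of undefined] by linarith
  have intW: "integrable M W" by (rule integrable_bounded) (use W in auto)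
  have "complex_of_real (expectation W) = of_real w"
    using char[of 0] by (simp add: prob_space)
  then have Ew: "expectation W = w" by (simp only: of_real_eq_iff)
  have "\<bar>w\<bar> \<le> B" unfolding Ew[symmetric]
    by (rule order_trans[OF integral_abs_bound])
       (use W intW in \<open>auto intro!: integral_le_const\<close>)
  (* The summand 1 makes the density positive and its normalisation c nonzero even when W
     is constantly - B. *)
  define c where "c = B + 1 + w"
  have c: "c > 0" using \<open>\<bar>w\<bar> \<le> B\<close> by (auto simp: c_def)
  define g where "g \<omega> = (B + 1 + W \<omega>) / c" for \<omega>
  have g0: "g \<omega> \<ge> 0" for \<omega> using W[of \<omega>] c by (auto simp: g_def)
  have [measurable]: "g \<in> borel_measurable M" unfolding g_def by measurable
  have intg: "integrable M g"
    unfolding g_def by (intro integrable_divide Bochner_Integration.integrable_add intW) auto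
  have Eg: "expectation g = 1"
  proof -
    have "expectation g = (B + 1 + expectation W) / c"
      using intW by (simp add: g_def[abs_def] prob_space)
    then show ?thesis using c by (simp add: Ew c_def)
  qed
  define N where "N = density M (\<lambda>\<omega>. ennreal (g \<omega>))"
  have sets_N [measurable_cong, simp]: "sets N = sets M" by (simp add: N_def)
  have "emeasure N (space N) = (\<integral>\<^sup>+ \<omega>. ennreal (g \<omega>) \<partial>M)"
    unfolding N_def by (subst emeasure_density) (auto intro!: nn_integral_cong)
  also have "\<dots> = 1" using g0 intg Eg by (simp add: nn_integral_eq_integral)
  finally interpret N: prob_space N by (rule prob_spaceI)
  have intN: "(CLINT \<omega>|N. h (X \<omega>)) = (of_real (B + 1) * (CLINT \<omega>|M. h (X \<omega>)) + (CLINT \<omega>|M. h (X \<omega>) * of_real (W \<omega>))) / of_real c"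
    if [measurable]: "h \<in> borel_measurable borel" and h: "\<And>x. norm (h x) \<le> D'" for h :: "real \<Rightarrow> complex" and D'
  proof -
    have i1: "integrable M (\<lambda>\<omega>. h (X \<omega>))" by (rule integrable_bounded) (use h in auto)
    have "norm (h (X \<omega>) * of_real (W \<omega>)) \<le> D' * B" for \<omega>
      unfolding norm_mult using h W B0 norm_ge_zero[of "h 0"] order_trans[OF norm_ge_zero h]
      by (intro mult_mono) auto
    then have i2: "integrable M (\<lambda>\<omega>. h (X \<omega>) * of_real (W \<omega>))" by (intro integrable_bounded) auto
    have "(CLINT \<omega>|N. h (X \<omega>)) = (CLINT \<omega>|M. g \<omega> *\<^sub>R h (X \<omega>))"
      unfolding N_def by (rule integral_density) (use g0 in auto)
    also have "\<dots> = (CLINT \<omega>|M. (of_real (B + 1) * h (X \<omega>) + h (X \<omega>) * of_real (W \<omega>)) / of_real c)"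
      by (rule Bochner_Integration.integral_cong)
         (auto simp: g_def scaleR_conv_of_real field_simps)
    finally show ?thesis using i1 i2 by simp
  qed
  have XN [measurable]: "X \<in> borel_measurable N" by simp
  have D1: "distr N borel X = distr M borel X"
  proof (rule Levy_uniqueness)
    show "real_distribution (distr N borel X)"
      unfolding real_distribution_def real_distribution_axioms_def
      by (auto intro!: N.prob_space_distr)
    show "real_distribution (distr M borel X)"
      unfolding real_distribution_def real_distribution_axioms_def
      by (auto intro!: prob_space_distr)
    show "char (distr N borel X) = char (distr M borel X)"
    proof
      fix a
      have "char (distr N borel X) a = (CLINT \<omega>|N. iexp (a * X \<omega>))"
        unfolding char_def by (rule integral_distr) auto
      also have "\<dots> = (of_real (B + 1) * (CLINT \<omega>|M. iexp (a * X \<omega>)) + (CLINT \<omega>|M. iexp (a * X \<omega>) * of_real (W \<omega>))) / of_real c"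
        by (rule intN[of "\<lambda>x. iexp (a * x)" 1]) auto
      also have "\<dots> = (CLINT \<omega>|M. iexp (a * X \<omega>)) * of_real (B + 1 + w) / of_real c"
        by (subst char) (simp add: algebra_simps)
      also have "\<dots> = (CLINT \<omega>|M. iexp (a * X \<omega>))" using c unfolding c_def by (simp del: of_real_add)
      also have "\<dots> = char (distr M borel X) a"
        unfolding char_def by (rule integral_distr[symmetric]) auto
      finally show "char (distr N borel X) a = char (distr M borel X) a" .
    qed
  qed
  have "(CLINT \<omega>|N. f (X \<omega>)) = (CLINT x|distr N borel X. f x)"
    by (rule integral_distr[symmetric]) auto
  also have "\<dots> = (CLINT \<omega>|M. f (X \<omega>))"
    unfolding D1 by (rule integral_distr) auto
  finally have "(of_real (B + 1) * (CLINT \<omega>|M. f (X \<omega>)) + (CLINT \<omega>|M. f (X \<omega>) * of_real (W \<omega>))) / of_real c = (CLINT \<omega>|M. f (X \<omega>))"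
    by (subst (asm) intN[of f D]) (use f in auto)
  then have "of_real (B + 1) * (CLINT \<omega>|M. f (X \<omega>)) + (CLINT \<omega>|M. f (X \<omega>) * of_real (W \<omega>)) = (CLINT \<omega>|M. f (X \<omega>)) * of_real c"
    using c by (simp add: divide_eq_eq)
  then show ?thesis by (simp add: c_def algebra_simps)
qed

text \<open>The hypothesis at \<open>- a\<close>, conjugated, is the hypothesis for \<open>cnj
  W\<close>; so it passes to the real and the imaginary part of \<open>W\<close>.\<close>

lemma (in prob_space) decouple:
  fixes W :: "'a \<Rightarrow> complex" and f :: "real \<Rightarrow> complex"
  assumes [measurable]: "X \<in> borel_measurable M" "W \<in> borel_measurable M" "f \<in> borel_measurable borel"
    and W: "\<And>\<omega>. norm (W \<omega>) \<le> B" and f: "\<And>x. norm (f x) \<le> D"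
    and char: "\<And>a. (CLINT \<omega>|M. iexp (a * X \<omega>) * W \<omega>) = (CLINT \<omega>|M. iexp (a * X \<omega>)) * w"
  shows "(CLINT \<omega>|M. f (X \<omega>) * W \<omega>) = (CLINT \<omega>|M. f (X \<omega>)) * w"
proof -
  have B0: "B \<ge> 0" using W norm_ge_zero order_trans by blast
  have D0: "D \<ge> 0" using f norm_ge_zero order_trans by blast
  have intW: "integrable M (\<lambda>\<omega>. h (X \<omega>) * V \<omega>)"
    if [measurable]: "h \<in> borel_measurable borel" "V \<in> borel_measurable M"
      and h: "\<And>x. norm (h x) \<le> D'" and V: "\<And>\<omega>. norm (V \<omega>) \<le> B'" for h V :: "_ \<Rightarrow> complex" and D' B'
  proof -
    have "norm (h (X \<omega>) * V \<omega>) \<le> D' * B'" for \<omega>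
      unfolding norm_mult using h V order_trans[OF norm_ge_zero h]
      by (intro mult_mono) auto
    then show ?thesis by (intro integrable_bounded) auto
  qed
  have [measurable]: "(\<lambda>\<omega>. cnj (W \<omega>)) \<in> borel_measurable M"
    by (rule borel_measurable_continuous_on[where f=cnj]) (auto intro!: continuous_intros)
  have char': "(CLINT \<omega>|M. iexp (a * X \<omega>) * cnj (W \<omega>)) = (CLINT \<omega>|M. iexp (a * X \<omega>)) * cnj w" for a
  proof -
    have "(CLINT \<omega>|M. iexp (a * X \<omega>) * cnj (W \<omega>)) = (CLINT \<omega>|M. cnj (iexp (- a * X \<omega>) * W \<omega>))"
      by (simp add: exp_cnj)
    also have "\<dots> = cnj ((CLINT \<omega>|M. iexp (- a * X \<omega>)) * w)"
      by (simp only: Bochner_Integration.integral_cnj char)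
    also have "\<dots> = (CLINT \<omega>|M. cnj (iexp (- a * X \<omega>))) * cnj w"
      by (simp only: Bochner_Integration.integral_cnj complex_cnj_mult)
    also have "\<dots> = (CLINT \<omega>|M. iexp (a * X \<omega>)) * cnj w"
      by (simp add: exp_cnj)
    finally show ?thesis .
  qed
  have re: "complex_of_real (Re v) = (1/2) * v + (1/2) * cnj v" for v by (simp add: complex_eq_iff)
  have im: "complex_of_real (Im v) = (-\<i>/2) * v + (\<i>/2) * cnj v" for v
    by (simp add: complex_eq_iff)
  have lin: "(CLINT \<omega>|M. iexp (a * X \<omega>) * (p * W \<omega> + q * cnj (W \<omega>))) = (CLINT \<omega>|M. iexp (a * X \<omega>)) * (p * w + q * cnj w)" for a p q
  proof -
    have "(CLINT \<omega>|M. iexp (a * X \<omega>) * (p * W \<omega> + q * cnj (W \<omega>))) =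
       (CLINT \<omega>|M. p * (iexp (a * X \<omega>) * W \<omega>) + q * (iexp (a * X \<omega>) * cnj (W \<omega>)))"
      by (simp add: algebra_simps)
    also have "\<dots> = p * (CLINT \<omega>|M. iexp (a * X \<omega>) * W \<omega>) + q * (CLINT \<omega>|M. iexp (a * X \<omega>) * cnj (W \<omega>))"
    proof -
      have "complex_integrable M (\<lambda>\<omega>. iexp (a * X \<omega>) * W \<omega>)"
        by (rule intW[of "\<lambda>x. iexp (a * x)" W 1 B]) (use W in auto)
      moreover have "complex_integrable M (\<lambda>\<omega>. iexp (a * X \<omega>) * cnj (W \<omega>))"
        by (rule intW[of "\<lambda>x. iexp (a * x)" "\<lambda>\<omega>. cnj (W \<omega>)" 1 B]) (use W in auto)
      ultimately show ?thesis
        by (simp only: Bochner_Integration.integral_add integrable_mult_right integral_mult_right_zero)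
    qed
    finally show ?thesis by (simp only: char char') (simp add: algebra_simps)
  qed
  have bR: "norm (complex_of_real (Re (W \<omega>))) \<le> B" "norm (complex_of_real (Im (W \<omega>))) \<le> B" for \<omega>
    using W[of \<omega>] abs_Re_le_cmod[of "W \<omega>"] abs_Im_le_cmod[of "W \<omega>"] by auto
  have *: "(CLINT \<omega>|M. f (X \<omega>) * of_real (Re (W \<omega>))) = (CLINT \<omega>|M. f (X \<omega>)) * of_real (Re w)"
  proof (rule decouple_real[where B=B and D=D])
    show "(CLINT \<omega>|M. iexp (a * X \<omega>) * of_real (Re (W \<omega>))) = (CLINT \<omega>|M. iexp (a * X \<omega>)) * of_real (Re w)" for a
      unfolding re by (rule lin)
  qed (use f bR in auto)
  have **: "(CLINT \<omega>|M. f (X \<omega>) * of_real (Im (W \<omega>))) = (CLINT \<omega>|M. f (X \<omega>)) * of_real (Im w)"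
  proof (rule decouple_real[where B=B and D=D])
    show "(CLINT \<omega>|M. iexp (a * X \<omega>) * of_real (Im (W \<omega>))) = (CLINT \<omega>|M. iexp (a * X \<omega>)) * of_real (Im w)" for a
      unfolding im by (rule lin)
  qed (use f bR in auto)
  have "(CLINT \<omega>|M. f (X \<omega>) * W \<omega>) = (CLINT \<omega>|M. f (X \<omega>) * of_real (Re (W \<omega>)) + \<i> * (f (X \<omega>) * of_real (Im (W \<omega>))))"
    by (intro Bochner_Integration.integral_cong refl, subst complex_eq[of "W _"]) (simp add: algebra_simps)
  also have "\<dots> = (CLINT \<omega>|M. f (X \<omega>)) * of_real (Re w) + \<i> * ((CLINT \<omega>|M. f (X \<omega>)) * of_real (Im w))"
    using intW[of f "\<lambda>\<omega>. of_real (Re (W \<omega>))" D B] intW[of f "\<lambda>\<omega>. of_real (Im (W \<omega>))" D B] f bR * ** by simp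
  also have "\<dots> = (CLINT \<omega>|M. f (X \<omega>)) * w"
    by (subst (3) complex_eq[of w]) (simp add: algebra_simps)
  finally show ?thesis .
qed

section \<open>Gaussian variables and pairs\<close>

lemma char_distr:
  assumes "X \<in> borel_measurable M"
  shows "char (distr M borel X) u = (CLINT \<omega>|M. iexp (u * X \<omega>))"
  unfolding char_def using assms by (intro integral_distr) auto

text \<open>The centred Gaussian law with variance \<open>v\<close>, given by its characteristic
  function so that \<open>v = 0\<close> is included and that linear combinations need no
  case distinction.\<close>

definition gaussian_rv :: "'a measure \<Rightarrow> ('a \<Rightarrow> real) \<Rightarrow> real \<Rightarrow> bool" where
  "gaussian_rv M X v \<longleftrightarrow> X \<in> borel_measurable M \<and>
     (\<forall>u. (CLINT \<omega>|M. iexp (u * X \<omega>)) = of_real (exp (- (v * u\<^sup>2) / 2)))"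

lemma (in prob_space) norm_expectation_iexp_le_1:
  assumes "X \<in> borel_measurable M" shows "norm (CLINT \<omega>|M. iexp (X \<omega>)) \<le> 1"
proof -
  have "norm (CLINT \<omega>|M. iexp (X \<omega>)) \<le> (\<integral>\<omega>. norm (iexp (X \<omega>)) \<partial>M)"
    by (rule integral_norm_bound)
  then show ?thesis by (simp add: prob_space)
qed

lemma (in prob_space) gaussian_rv_distr:
  assumes "gaussian_rv M X 1"
  shows "distr M borel X = std_normal_distribution"
proof (rule Levy_uniqueness)
  have [measurable]: "X \<in> borel_measurable M" using assms by (simp add: gaussian_rv_def)
  show "real_distribution (distr M borel X)"
    by (rule real_distribution_distr) simp
  show "char (distr M borel X) = char std_normal_distribution"
    using assms by (auto simp: fun_eq_iff char_distr char_std_normal_distribution gaussian_rv_def)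
qed (rule real_dist_normal_dist)

lemma (in prob_space) gaussian_rv_scale:
  assumes "gaussian_rv M X v" shows "gaussian_rv M (\<lambda>\<omega>. c * X \<omega>) (c\<^sup>2 * v)"
proof -
  have "(CLINT \<omega>|M. iexp ((u * c) * X \<omega>)) = of_real (exp (- (v * (u * c)\<^sup>2) / 2))" for u
    using assms by (simp only: gaussian_rv_def)
  then show ?thesis
    using assms by (auto simp: gaussian_rv_def algebra_simps power_mult_distrib)
qed

text \<open>The bound 1 on characteristic functions forces \<open>v \<ge> 0\<close>. For \<open>v =
  0\<close> the law is the point mass at 0, and otherwise rescaling reduces the moments to
  those of the standard law.\<close>

lemma (in prob_space) gaussian_rv_moments:
  assumes "gaussian_rv M X v"
  shows "v \<ge> 0" "integrable M (\<lambda>\<omega>. (X \<omega>)\<^sup>2)" "expectation (\<lambda>\<omega>. (X \<omega>)\<^sup>2) = v"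
    "integrable M X" "expectation X = 0"
proof -
  have [measurable]: "X \<in> borel_measurable M" using assms by (simp add: gaussian_rv_def)
  have "norm (CLINT \<omega>|M. iexp (1 * X \<omega>)) \<le> 1"
    by (rule norm_expectation_iexp_le_1) simp
  also have "(CLINT \<omega>|M. iexp (1 * X \<omega>)) = of_real (exp (- (v * 1\<^sup>2) / 2))"
    using assms by (simp only: gaussian_rv_def)
  finally show v: "v \<ge> 0" by simp
  have "integrable M (\<lambda>\<omega>. (X \<omega>)\<^sup>2) \<and> expectation (\<lambda>\<omega>. (X \<omega>)\<^sup>2) = v \<and> integrable M X \<and> expectation X = 0"
  proof (cases "v = 0")
    case True
    have "distr M borel X = return borel 0"
    proof (rule Levy_uniqueness)
      show "real_distribution (return borel (0::real))"
        unfolding real_distribution_def real_distribution_axioms_def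
        by (auto intro!: prob_space_return)
      show "char (distr M borel X) = char (return borel 0)"
      proof
        fix u
        have "char (return borel 0) u = iexp (u * 0)"
          unfolding char_def by (rule integral_return) auto
        then show "char (distr M borel X) u = char (return borel 0) u"
          using assms True by (simp add: char_distr gaussian_rv_def)
      qed
    qed (rule real_distribution_distr, simp)
    moreover have "AE x in return borel 0. x = (0::real)" by (subst AE_return) auto
    ultimately have "AE x in distr M borel X. x = 0" by (simp only:)
    then have AE0: "AE \<omega> in M. X \<omega> = 0" by (subst (asm) AE_distr_iff) auto
    then have "AE \<omega> in M. (X \<omega>)\<^sup>2 = 0" by eventually_elim simp
    then have "integrable M (\<lambda>\<omega>. (X \<omega>)\<^sup>2) \<longleftrightarrow> integrable M (\<lambda>\<omega>. 0::real)"
      "expectation (\<lambda>\<omega>. (X \<omega>)\<^sup>2) = expectation (\<lambda>\<omega>. 0::real)"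
      by (intro integrable_cong_AE integral_cong_AE; simp)+
    moreover have "integrable M X \<longleftrightarrow> integrable M (\<lambda>\<omega>. 0::real)"
      "expectation X = expectation (\<lambda>\<omega>. 0::real)"
      using AE0 by (intro integrable_cong_AE integral_cong_AE; simp)+
    ultimately show ?thesis using True by simp
  next
    case False
    then have "v > 0" using v by simp
    define c where "c = 1 / sqrt v"
    have c: "c > 0" "c\<^sup>2 * v = 1" using \<open>v > 0\<close> by (auto simp: c_def power_divide)
    have "gaussian_rv M (\<lambda>\<omega>. c * X \<omega>) 1"
      using gaussian_rv_scale[OF assms, of c] by (simp only: c)
    note D = gaussian_rv_distr[OF this]
    have int2: "integrable M (\<lambda>\<omega>. (c * X \<omega>)\<^sup>2)"
    proof -
      have "integrable (distr M borel (\<lambda>\<omega>. c * X \<omega>)) (\<lambda>x. x\<^sup>2)"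
        unfolding D by (rule integrable_std_normal_parts)
      then show ?thesis by (subst (asm) integrable_distr_eq) auto
    qed
    have int1: "integrable M (\<lambda>\<omega>. c * X \<omega>)"
    proof -
      have "integrable (distr M borel (\<lambda>\<omega>. c * X \<omega>)) (\<lambda>x. x)"
        unfolding D by (rule integrable_std_normal_parts)
      then show ?thesis by (subst (asm) integrable_distr_eq) auto
    qed
    have "expectation (\<lambda>\<omega>. (c * X \<omega>)\<^sup>2) = (\<integral>x. x\<^sup>2 \<partial>distr M borel (\<lambda>\<omega>. c * X \<omega>))"
      by (rule integral_distr[symmetric]) auto
    also have "\<dots> = 1" unfolding D by (rule integral_std_normal_square)
    finally have e2: "c\<^sup>2 * expectation (\<lambda>\<omega>. (X \<omega>)\<^sup>2) = 1"
      by (simp add: power_mult_distrib)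
    have "expectation (\<lambda>\<omega>. c * X \<omega>) = (\<integral>x. x \<partial>distr M borel (\<lambda>\<omega>. c * X \<omega>))"
      by (rule integral_distr[symmetric]) auto
    also have "\<dots> = 0" unfolding D by (rule integral_std_normal_id)
    finally have "c * expectation X = 0" by simp
    have "c\<^sup>2 * expectation (\<lambda>\<omega>. (X \<omega>)\<^sup>2) = c\<^sup>2 * v"
      unfolding e2 c(2) ..
    then have "expectation (\<lambda>\<omega>. (X \<omega>)\<^sup>2) = v" using c(1) by (simp only: mult_cancel_left) simp
    then show ?thesis
      using c(1) int1 int2 \<open>c * expectation X = 0\<close> by (auto simp: power_mult_distrib)
  qed
  then show "integrable M (\<lambda>\<omega>. (X \<omega>)\<^sup>2)" "expectation (\<lambda>\<omega>. (X \<omega>)\<^sup>2) = v"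
    "integrable M X" "expectation X = 0" by auto
qed

lemma (in prob_space) std_gaussian_expectation:
  fixes f :: "real \<Rightarrow> 'b :: {banach, second_countable_topology}"
  assumes X: "gaussian_rv M X 1" and [measurable]: "f \<in> borel_measurable borel"
  shows "(\<integral>\<omega>. f (X \<omega>) \<partial>M) = (\<integral>x. f x \<partial>std_normal_distribution)"
    and "integrable M (\<lambda>\<omega>. f (X \<omega>)) \<longleftrightarrow> integrable std_normal_distribution f"
proof -
  have [measurable]: "X \<in> borel_measurable M" using X by (simp add: gaussian_rv_def)
  show "(\<integral>\<omega>. f (X \<omega>) \<partial>M) = (\<integral>x. f x \<partial>std_normal_distribution)"
    unfolding gaussian_rv_distr[OF X, symmetric] by (rule integral_distr[symmetric]) auto
  show "integrable M (\<lambda>\<omega>. f (X \<omega>)) \<longleftrightarrow> integrable std_normal_distribution f"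
    unfolding gaussian_rv_distr[OF X, symmetric] by (rule integrable_distr_eq[symmetric]) auto
qed

text \<open>A Gaussian pair with standard marginals and correlation \<open>\<rho>\<close>; the
  values \<open>\<rho> = 1\<close> and \<open>\<rho> = -1\<close>, where the pair has no
  density, are included.\<close>

definition std_pair :: "'a measure \<Rightarrow> ('a \<Rightarrow> real) \<Rightarrow> ('a \<Rightarrow> real) \<Rightarrow> real \<Rightarrow> bool" where
  "std_pair M U V \<rho> \<longleftrightarrow> U \<in> borel_measurable M \<and> V \<in> borel_measurable M \<and>
     (\<forall>a b. (CLINT \<omega>|M. iexp (a * U \<omega> + b * V \<omega>)) = of_real (exp (- (a\<^sup>2 + 2 * \<rho> * a * b + b\<^sup>2) / 2)))"

lemma std_pair_marginals:
  assumes "std_pair M U V \<rho>"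
  shows "gaussian_rv M U 1" "gaussian_rv M V 1"
proof -
  have *: "(CLINT \<omega>|M. iexp (a * U \<omega> + b * V \<omega>)) = of_real (exp (- (a\<^sup>2 + 2 * \<rho> * a * b + b\<^sup>2) / 2))" for a b
    using assms by (simp only: std_pair_def)
  show "gaussian_rv M U 1" using *[of _ 0] assms by (simp add: gaussian_rv_def std_pair_def)
  show "gaussian_rv M V 1" using *[of 0 ] assms by (simp add: gaussian_rv_def std_pair_def)
qed

lemma std_pair_diff:
  assumes "std_pair M U V \<rho>"
  shows "gaussian_rv M (\<lambda>\<omega>. U \<omega> - V \<omega>) (2 - 2 * \<rho>)"
proof -
  have *: "(CLINT \<omega>|M. iexp (u * U \<omega> + (-u) * V \<omega>)) = of_real (exp (- (u\<^sup>2 + 2 * \<rho> * u * (-u) + (-u)\<^sup>2) / 2))" for u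
    using assms by (simp only: std_pair_def)
  have e: "u * (U \<omega> - V \<omega>) = u * U \<omega> + (-u) * V \<omega>" "- ((2 - 2 * \<rho>) * u\<^sup>2) = - (u\<^sup>2 + 2 * \<rho> * u * (-u) + (-u)\<^sup>2)" for u \<omega>
    by (auto simp: algebra_simps power2_eq_square)
  show ?thesis unfolding gaussian_rv_def e using * assms by (auto simp: std_pair_def)
qed

text \<open>Decouple twice: replace the character of \<open>V\<close> by an indicator of
  \<open>V\<close>, then the character of \<open>U\<close> by an indicator of
  \<open>U\<close>.\<close>

lemma (in prob_space) std_pair_indep:
  assumes "std_pair M U V 0"
  shows "distr M (borel \<Otimes>\<^sub>M borel) (\<lambda>\<omega>. (U \<omega>, V \<omega>)) = std_normal_distribution \<Otimes>\<^sub>M std_normal_distribution"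
proof (rule pair_measure_eqI[symmetric])
  interpret N: prob_space std_normal_distribution by (rule std_normal_prob_space)
  show "sigma_finite_measure std_normal_distribution" "sigma_finite_measure std_normal_distribution" by unfold_locales
  have [measurable]: "U \<in> borel_measurable M" "V \<in> borel_measurable M"
    using assms by (auto simp: std_pair_def)
  have U: "gaussian_rv M U 1" and V: "gaussian_rv M V 1" using std_pair_marginals[OF assms] by auto
  show "sets (std_normal_distribution \<Otimes>\<^sub>M std_normal_distribution) = sets (distr M (borel \<Otimes>\<^sub>M borel) (\<lambda>\<omega>. (U \<omega>, V \<omega>)))"
    by (simp cong: sets_pair_measure_cong)
  fix A B assume "A \<in> sets std_normal_distribution" "B \<in> sets std_normal_distribution"
  then have [measurable]: "A \<in> sets borel" "B \<in> sets borel" by auto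
  let ?iA = "\<lambda>x. complex_of_real (indicator A x)" and ?iB = "\<lambda>x. complex_of_real (indicator B x)"
  have bdd: "norm (?iA x) \<le> 1" "norm (?iB x) \<le> 1" for x by (auto simp: indicator_def)
  have s1: "(CLINT \<omega>|M. ?iB (V \<omega>) * iexp (a * U \<omega>)) = (CLINT \<omega>|M. ?iB (V \<omega>)) * (CLINT \<omega>|M. iexp (a * U \<omega>))" for a
  proof (rule decouple[where B=1 and D=1 and f="?iB" and X=V])
    fix b
    have "(CLINT \<omega>|M. iexp (b * V \<omega>) * iexp (a * U \<omega>)) = (CLINT \<omega>|M. iexp (a * U \<omega> + b * V \<omega>))"
      by (intro Bochner_Integration.integral_cong refl) (simp add: exp_add[symmetric] algebra_simps)
    also have "\<dots> = of_real (exp (- (a\<^sup>2 + 2 * 0 * a * b + b\<^sup>2) / 2))"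
      using assms by (simp only: std_pair_def)
    also have "\<dots> = of_real (exp (- (1 * b\<^sup>2) / 2)) * of_real (exp (- (1 * a\<^sup>2) / 2))"
      by (simp add: of_real_mult[symmetric] exp_add[symmetric] add_divide_distrib del: of_real_mult)
    also have "\<dots> = (CLINT \<omega>|M. iexp (b * V \<omega>)) * (CLINT \<omega>|M. iexp (a * U \<omega>))"
      using U V unfolding gaussian_rv_def by metis
    finally show "(CLINT \<omega>|M. iexp (b * V \<omega>) * iexp (a * U \<omega>)) = (CLINT \<omega>|M. iexp (b * V \<omega>)) * (CLINT \<omega>|M. iexp (a * U \<omega>))" .
  qed (use bdd in auto)
  have s2: "(CLINT \<omega>|M. ?iA (U \<omega>) * ?iB (V \<omega>)) = (CLINT \<omega>|M. ?iA (U \<omega>)) * (CLINT \<omega>|M. ?iB (V \<omega>))"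
  proof (rule decouple[where B=1 and D=1 and f="?iA" and X=U])
    show "(CLINT \<omega>|M. iexp (a * U \<omega>) * ?iB (V \<omega>)) = (CLINT \<omega>|M. iexp (a * U \<omega>)) * (CLINT \<omega>|M. ?iB (V \<omega>))" for a
      using s1[of a] by (simp only: mult.commute)
  qed (use bdd in auto)
  have m1: "(CLINT \<omega>|M. ?iA (U \<omega>)) = of_real (measure std_normal_distribution A)"
    using std_gaussian_expectation(1)[OF U, of "indicator A :: _ \<Rightarrow> real"] by simp
  have m2: "(CLINT \<omega>|M. ?iB (V \<omega>)) = of_real (measure std_normal_distribution B)"
    using std_gaussian_expectation(1)[OF V, of "indicator B :: _ \<Rightarrow> real"] by simp
  have "(CLINT \<omega>|M. ?iA (U \<omega>) * ?iB (V \<omega>)) = (CLINT \<omega>|M. of_real (indicator ((\<lambda>\<omega>. (U \<omega>, V \<omega>)) -` (A \<times> B) \<inter> space M) \<omega>))"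
    by (rule Bochner_Integration.integral_cong) (auto simp: indicator_def)
  also have "\<dots> = of_real (measure M ((\<lambda>\<omega>. (U \<omega>, V \<omega>)) -` (A \<times> B) \<inter> space M))"
    by simp
  finally have "measure M ((\<lambda>\<omega>. (U \<omega>, V \<omega>)) -` (A \<times> B) \<inter> space M) = measure std_normal_distribution A * measure std_normal_distribution B"
    unfolding s2 m1 m2 by (simp only: of_real_mult[symmetric] of_real_eq_iff)
  then show "emeasure std_normal_distribution A * emeasure std_normal_distribution B =
      emeasure (distr M (borel \<Otimes>\<^sub>M borel) (\<lambda>\<omega>. (U \<omega>, V \<omega>))) (A \<times> B)"
    by (simp add: emeasure_distr emeasure_eq_measure N.emeasure_eq_measure ennreal_mult[symmetric])
qed

lemma std_normal_density_lipschitz: "\<bar>std_normal_density a - std_normal_density b\<bar> \<le> \<bar>a - b\<bar>"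
proof -
  have bd: "\<bar>- x * std_normal_density x\<bar> \<le> 1" for x :: real
  proof -
    have "\<bar>x\<bar> \<le> 1 + x\<^sup>2 / 2"
      using zero_le_power2[of "\<bar>x\<bar> - 1"] by (simp add: power2_diff)
    also have "\<dots> \<le> exp (x\<^sup>2 / 2)" using exp_ge_add_one_self[of "x\<^sup>2 / 2"] by simp
    finally have "\<bar>x\<bar> * exp (- x\<^sup>2 / 2) \<le> exp (x\<^sup>2 / 2) * exp (- x\<^sup>2 / 2)"
      by (intro mult_right_mono) auto
    also have "\<dots> = 1" by (simp add: exp_add[symmetric])
    finally have "\<bar>x\<bar> * exp (- x\<^sup>2 / 2) \<le> 1" .
    moreover have "1 / sqrt (2 * pi) \<le> 1"
      using pi_gt3 by (simp add: real_le_rsqrt)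
    ultimately have "(1 / sqrt (2 * pi)) * (\<bar>x\<bar> * exp (- x\<^sup>2 / 2)) \<le> 1"
      by (rule mult_le_one[rotated 2]) simp
    then show ?thesis by (simp add: std_normal_density_def abs_mult)
  qed
  have "norm (std_normal_density a - std_normal_density b) \<le> 1 * norm (a - b)"
    by (rule field_differentiable_bound[of UNIV _ "\<lambda>x. - x * std_normal_density x"])
       (use std_normal_density_deriv bd in \<open>auto intro: has_field_derivative_at_within\<close>)
  then show ?thesis by simp
qed

lemma Phi_mvt: "\<exists>\<xi>. \<bar>\<xi> - b\<bar> \<le> \<bar>a - b\<bar> \<and> Phi a - Phi b = - std_normal_density \<xi> * (a - b)"
proof (cases a b rule: linorder_cases)
  case less
  then obtain \<xi> where "\<xi> > a" "\<xi> < b" "Phi b - Phi a = (b - a) * - std_normal_density \<xi>"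
    using MVT2[of a b Phi "\<lambda>x. - std_normal_density x"] Phi_deriv by blast
  then show ?thesis by (intro exI[of _ \<xi>]) (auto simp: algebra_simps)
next
  case greater
  then obtain \<xi> where "\<xi> > b" "\<xi> < a" "Phi a - Phi b = (a - b) * - std_normal_density \<xi>"
    using MVT2[of b a Phi "\<lambda>x. - std_normal_density x"] Phi_deriv by blast
  then show ?thesis by (intro exI[of _ \<xi>]) (auto simp: algebra_simps)
qed auto

lemma Phi_lipschitz: "\<bar>Phi a - Phi b\<bar> \<le> \<bar>a - b\<bar>"
proof -
  obtain \<xi> where "Phi a - Phi b = - std_normal_density \<xi> * (a - b)" using Phi_mvt[of b a] by blast
  then show ?thesis
    using std_normal_density_le_1[of \<xi>] std_normal_density_nonneg[of \<xi>]
    by (simp add: abs_mult mult_left_le_one_le)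
qed

lemma Phi_taylor: "\<bar>Phi a - Phi b + std_normal_density b * (a - b)\<bar> \<le> (a - b)\<^sup>2"
proof -
  obtain \<xi> where \<xi>: "\<bar>\<xi> - b\<bar> \<le> \<bar>a - b\<bar>" "Phi a - Phi b = - std_normal_density \<xi> * (a - b)"
    using Phi_mvt[of b a] by blast
  have "\<bar>Phi a - Phi b + std_normal_density b * (a - b)\<bar> = \<bar>std_normal_density \<xi> - std_normal_density b\<bar> * \<bar>a - b\<bar>"
    unfolding \<xi>(2) abs_mult[symmetric] by (subst abs_minus_cancel[symmetric]) (simp add: algebra_simps)
  also have "\<dots> \<le> \<bar>a - b\<bar> * \<bar>a - b\<bar>"
    using std_normal_density_lipschitz[of \<xi> b] \<xi>(1) by (intro mult_right_mono) auto
  finally show ?thesis by (simp add: power2_eq_square)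
qed

text \<open>Since \<open>resid z x\<close> is at most \<open>1 + \<bar>x\<bar>\<close>, this moment
  dominates all the integrals of third order that occur below, uniformly in
  \<open>z\<close>.\<close>

definition K3 :: real where
  "K3 = (\<integral>x. (1 + \<bar>x\<bar>) ^ 3 \<partial>std_normal_distribution)"

lemma K3_ge_1: "K3 \<ge> 1"
proof -
  interpret N: prob_space std_normal_distribution by (rule std_normal_prob_space)
  have "1 \<le> (1 + \<bar>x\<bar>) ^ 3" for x :: real by (rule one_le_power) simp
  then show ?thesis
    unfolding K3_def by (intro N.integral_ge_const integrable_std_normal_abs_power AE_I2)
qed

lemma integral_std_normal_affine_indicator:
  assumes "\<sigma> > 0"
  shows "(\<integral>y. of_bool (w \<le> b + \<sigma> * y) \<partial>std_normal_distribution) = Phi ((w - b) / \<sigma>)"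
proof -
  have "(w \<le> b + \<sigma> * y) = ((w - b) / \<sigma> \<le> y)" for y
    using assms by (simp add: pos_divide_le_eq algebra_simps)
  then show ?thesis by (simp only: integral_std_normal_indicator)
qed

lemma integral_std_normal_affine_resid:
  assumes "\<sigma> > 0"
  shows "(\<integral>y. resid w (b + \<sigma> * y) \<partial>std_normal_distribution) = Phi ((w - b) / \<sigma>) - Phi w - std_normal_density w * b"
proof -
  interpret N: prob_space std_normal_distribution by (rule std_normal_prob_space)
  have i: "integrable std_normal_distribution (\<lambda>y. of_bool (w \<le> b + \<sigma> * y) :: real)"
    by (rule integrable_std_normal_bound[where c=1 and k=1]) (auto simp: of_bool_def)
  have i2: "integrable std_normal_distribution (\<lambda>y. std_normal_density w * (b + \<sigma> * y))"
    by (intro integrable_mult_right Bochner_Integration.integrable_add N.integrable_const integrable_std_normal_parts)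
  have "(\<integral>y. b + \<sigma> * y \<partial>std_normal_distribution) = (\<integral>y. b \<partial>std_normal_distribution) + \<sigma> * (\<integral>y. y \<partial>std_normal_distribution)"
    using integrable_std_normal_parts(2) by (subst Bochner_Integration.integral_add) auto
  also have "\<dots> = b" using N.prob_space by (simp add: integral_std_normal_id)
  finally have e: "(\<integral>y. b + \<sigma> * y \<partial>std_normal_distribution) = b" .
  have "(\<integral>y. resid w (b + \<sigma> * y) \<partial>std_normal_distribution) = (\<integral>y. of_bool (w \<le> b + \<sigma> * y) \<partial>std_normal_distribution)
      - (\<integral>y. Phi w \<partial>std_normal_distribution) - (\<integral>y. std_normal_density w * (b + \<sigma> * y) \<partial>std_normal_distribution)"
    unfolding resid_def using i i2
    by (simp only: Bochner_Integration.integral_diff Bochner_Integration.integrable_diff N.integrable_const)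
  also have "\<dots> = Phi ((w - b) / \<sigma>) - Phi w - std_normal_density w * b"
    using N.prob_space
    by (simp only: integral_std_normal_affine_indicator[OF assms] integral_mult_right_zero e lebesgue_integral_const) simp
  finally show ?thesis .
qed

text \<open>For a pair of correlation \<open>\<rho>\<close>, the conditional expectation of
  \<open>resid w V\<close> given \<open>U = x\<close> is the quantity bounded here. The
  argument of \<open>Phi\<close> differs from \<open>w\<close> by \<open>- \<rho> x +
  O(\<rho>\<^sup>2)\<close>, and the first order term of its Taylor expansion is cancelled
  by the linear part of the residual.\<close>

lemma conditional_resid_bound:
  assumes \<rho>: "\<bar>\<rho>\<bar> \<le> 1 / 2" and w: "\<bar>w\<bar> \<le> B"
  defines "\<sigma> \<equiv> sqrt (1 - \<rho>\<^sup>2)"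
  shows "\<bar>Phi ((w - \<rho> * x) / \<sigma>) - Phi w - std_normal_density w * (\<rho> * x)\<bar> \<le> 5 * (B + 1)\<^sup>2 * \<rho>\<^sup>2 * (1 + \<bar>x\<bar>)\<^sup>2"
proof -
  have B: "B \<ge> 0" using w by linarith
  have r2: "\<rho>\<^sup>2 \<le> 1 / 4" using power_mono[OF \<rho>, of 2] by (simp add: power_divide)
  then have \<sigma>: "\<sigma> > 0" "\<sigma>\<^sup>2 = 1 - \<rho>\<^sup>2" unfolding \<sigma>_def by auto
  define c where "c = 1 / \<sigma>"
  have "\<sigma> \<le> 1" unfolding \<sigma>_def by simp
  then have c1: "1 \<le> c" using \<sigma> by (simp add: c_def)
  have "1 \<le> ((1 + \<rho>\<^sup>2) * \<sigma>)\<^sup>2"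
  proof -
    have "\<rho>\<^sup>2 * \<rho>\<^sup>2 \<le> 1/4 * (1/4)" using r2 by (intro mult_mono) auto
    then have "\<rho>\<^sup>2 * (\<rho>\<^sup>2 + \<rho>\<^sup>2 * \<rho>\<^sup>2) \<le> \<rho>\<^sup>2 * 1"
      using r2 by (intro mult_left_mono) auto
    moreover have "((1 + \<rho>\<^sup>2) * \<sigma>)\<^sup>2 = 1 + \<rho>\<^sup>2 - \<rho>\<^sup>2 * (\<rho>\<^sup>2 + \<rho>\<^sup>2 * \<rho>\<^sup>2)"
      unfolding power_mult_distrib \<sigma>(2) by (simp add: algebra_simps power2_eq_square)
    ultimately show ?thesis by simp
  qed
  then have "1 \<le> (1 + \<rho>\<^sup>2) * \<sigma>"
    using power2_le_imp_le[of 1 "(1 + \<rho>\<^sup>2) * \<sigma>"] \<sigma> by simp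
  (* The effect of the rescaling by 1 / sigma is of order rho^2; this uses that rho is
     bounded away from 1. *)
  then have c2: "c \<le> 1 + \<rho>\<^sup>2" using \<sigma> by (simp add: c_def pos_divide_le_eq)
  define s where "s = (w - \<rho> * x) / \<sigma>"
  have s: "s - w = (c - 1) * w - c * (\<rho> * x)" unfolding s_def c_def using \<sigma> by (simp add: field_simps)
  have cw: "\<bar>(c - 1) * w\<bar> \<le> \<rho>\<^sup>2 * B"
    unfolding abs_mult using c1 c2 w by (intro mult_mono) auto
  have rx: "\<rho>\<^sup>2 * B \<le> \<bar>\<rho>\<bar> * (1/2) * B"
  proof -
    have "\<rho>\<^sup>2 = \<bar>\<rho>\<bar> * \<bar>\<rho>\<bar>" by (simp add: power2_eq_square)
    also have "\<dots> \<le> \<bar>\<rho>\<bar> * (1/2)" using \<rho> by (intro mult_left_mono) auto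
    finally show ?thesis using B by (intro mult_right_mono)
  qed
  have c54: "c \<le> 5 / 4" using c2 r2 by simp
  have "\<bar>s - w\<bar> \<le> \<bar>(c - 1) * w\<bar> + \<bar>c * (\<rho> * x)\<bar>" unfolding s by (rule abs_triangle_ineq4)
  also have "\<dots> \<le> \<bar>\<rho>\<bar> * (1/2) * B + (5/4) * (\<bar>\<rho>\<bar> * \<bar>x\<bar>)"
  proof (rule add_mono)
    show "\<bar>(c - 1) * w\<bar> \<le> \<bar>\<rho>\<bar> * (1/2) * B" using cw rx by linarith
    have "\<bar>c\<bar> * (\<bar>\<rho>\<bar> * \<bar>x\<bar>) \<le> (5/4) * (\<bar>\<rho>\<bar> * \<bar>x\<bar>)"
      using c54 c1 by (intro mult_right_mono) auto
    then show "\<bar>c * (\<rho> * x)\<bar> \<le> (5/4) * (\<bar>\<rho>\<bar> * \<bar>x\<bar>)" by (simp only: abs_mult)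
  qed
  also have "\<dots> = \<bar>\<rho>\<bar> * (B / 2 + (5/4) * \<bar>x\<bar>)" by (simp add: algebra_simps)
  also have "\<dots> \<le> \<bar>\<rho>\<bar> * (2 * (B + 1) * (1 + \<bar>x\<bar>))"
  proof (intro mult_left_mono)
    have "0 \<le> B * \<bar>x\<bar>" using B by simp
    then show "B / 2 + (5/4) * \<bar>x\<bar> \<le> 2 * (B + 1) * (1 + \<bar>x\<bar>)"
      unfolding ring_distribs using B by linarith
  qed simp
  finally have "\<bar>s - w\<bar>\<^sup>2 \<le> (\<bar>\<rho>\<bar> * (2 * (B + 1) * (1 + \<bar>x\<bar>)))\<^sup>2" by (intro power_mono) auto
  then have s2: "(s - w)\<^sup>2 \<le> 4 * (B + 1)\<^sup>2 * \<rho>\<^sup>2 * (1 + \<bar>x\<bar>)\<^sup>2"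
    by (simp only: power_mult_distrib power2_abs mult_ac) simp
  have "\<bar>s - w + \<rho> * x\<bar> = \<bar>(c - 1) * w - (c - 1) * (\<rho> * x)\<bar>" unfolding s by (simp add: algebra_simps)
  also have "\<dots> \<le> \<bar>(c - 1) * w\<bar> + \<bar>(c - 1) * (\<rho> * x)\<bar>" by (rule abs_triangle_ineq4)
  also have "\<dots> \<le> \<rho>\<^sup>2 * B + \<rho>\<^sup>2 * (1 * \<bar>x\<bar>)"
    unfolding abs_mult[of "c - 1" "\<rho> * x"] abs_mult[of \<rho> x]
    using c1 c2 \<rho> by (intro add_mono cw mult_mono) auto
  also have "\<dots> \<le> (B + 1)\<^sup>2 * \<rho>\<^sup>2 * (1 + \<bar>x\<bar>)\<^sup>2"
  proof -
    have "B + \<bar>x\<bar> \<le> (B + 1) * (1 + \<bar>x\<bar>)" using B by (simp add: algebra_simps)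
    also have "\<dots> \<le> ((B + 1) * (1 + \<bar>x\<bar>))\<^sup>2" 
    proof -
      have "1 * 1 \<le> (B + 1) * (1 + \<bar>x\<bar>)" using B by (intro mult_mono) auto
      then show ?thesis by (intro self_le_power) auto
    qed
    finally have "\<rho>\<^sup>2 * (B + \<bar>x\<bar>) \<le> \<rho>\<^sup>2 * ((B + 1) * (1 + \<bar>x\<bar>))\<^sup>2" by (intro mult_left_mono) auto
    moreover have "\<rho>\<^sup>2 * ((B + 1) * (1 + \<bar>x\<bar>))\<^sup>2 = (B + 1)\<^sup>2 * \<rho>\<^sup>2 * (1 + \<bar>x\<bar>)\<^sup>2"
      by (simp only: power_mult_distrib mult_ac)
    ultimately show ?thesis by (simp only: distrib_left mult_1)
  qed
  finally have sx: "\<bar>s - w + \<rho> * x\<bar> \<le> (B + 1)\<^sup>2 * \<rho>\<^sup>2 * (1 + \<bar>x\<bar>)\<^sup>2" .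
  have "Phi s - Phi w - std_normal_density w * (\<rho> * x) =
      (Phi s - Phi w + std_normal_density w * (s - w)) - std_normal_density w * (s - w + \<rho> * x)"
    by (simp add: algebra_simps)
  also have "\<bar>\<dots>\<bar> \<le> \<bar>Phi s - Phi w + std_normal_density w * (s - w)\<bar> + \<bar>std_normal_density w * (s - w + \<rho> * x)\<bar>"
    by (rule abs_triangle_ineq4)
  also have "\<dots> \<le> (s - w)\<^sup>2 + \<bar>s - w + \<rho> * x\<bar>"
    using std_normal_density_le_1[of w] std_normal_density_nonneg[of w]
    by (intro add_mono Phi_taylor) (simp add: abs_mult mult_left_le_one_le)
  also have "\<dots> \<le> 5 * (B + 1)\<^sup>2 * \<rho>\<^sup>2 * (1 + \<bar>x\<bar>)\<^sup>2" using s2 sx by simp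
  finally show ?thesis unfolding s_def .
qed

lemma rvar_le_1: "rvar z \<le> 1"
proof -
  have "Phi z * (1 - Phi z) \<le> 1 * 1"
    using Phi_gt_0[of z] Phi_lt_1[of z] by (intro mult_mono) auto
  then show ?thesis unfolding rvar_def using zero_le_power2[of "std_normal_density z"] by linarith
qed

lemma (in prob_space) resid_integrable:
  assumes "gaussian_rv M U 1"
  shows "integrable M (\<lambda>\<omega>. resid z (U \<omega>))" "integrable M (\<lambda>\<omega>. (resid z (U \<omega>))\<^sup>2)"
    and "expectation (\<lambda>\<omega>. resid z (U \<omega>)) = 0" "expectation (\<lambda>\<omega>. (resid z (U \<omega>))\<^sup>2) = rvar z"
  using std_gaussian_expectation[OF assms, of "resid z"] std_gaussian_expectation[OF assms, of "\<lambda>x. (resid z x)\<^sup>2"]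
  by (simp_all add: integrable_std_normal_resid integral_std_normal_resid integral_std_normal_resid_square)

lemma integrable_mult_L2:
  fixes f g :: "'a \<Rightarrow> real"
  assumes [measurable]: "f \<in> borel_measurable M" "g \<in> borel_measurable M"
    and "integrable M (\<lambda>x. (f x)\<^sup>2)" "integrable M (\<lambda>x. (g x)\<^sup>2)"
  shows "integrable M (\<lambda>x. f x * g x)"
proof (rule Bochner_Integration.integrable_bound)
  show "integrable M (\<lambda>x. (f x)\<^sup>2 + (g x)\<^sup>2)" using assms by auto
  have "\<bar>a * b\<bar> \<le> a\<^sup>2 + b\<^sup>2" for a b :: real
    using sum_squares_bound[of "\<bar>a\<bar>" "\<bar>b\<bar>"] zero_le_power2[of a] zero_le_power2[of b]
    unfolding abs_mult power2_abs by linarith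
  then show "AE x in M. norm (f x * g x) \<le> norm ((f x)\<^sup>2 + (g x)\<^sup>2)" by (intro AE_I2) auto
qed auto

text \<open>The covariance is quadratic in the correlation because the residuals have no Hermite
  component of degree one. For \<open>\<bar>\<rho>\<bar> \<le> 1 / 2\<close> decompose
  \<open>V = \<rho> U + \<sigma> W\<close> with \<open>W\<close> independent of
  \<open>U\<close> and integrate \<open>W\<close> out; for larger \<open>\<rho>\<close>
  the variance bound 1 is already of order \<open>\<rho>\<^sup>2\<close>.\<close>

lemma (in prob_space) resid_covariance_bound:
  assumes UV: "std_pair M U V \<rho>" and w: "\<bar>w\<bar> \<le> B"
  shows "\<bar>expectation (\<lambda>\<omega>. resid z (U \<omega>) * resid w (V \<omega>))\<bar> \<le> 5 * (B + 1)\<^sup>2 * K3 * \<rho>\<^sup>2"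
proof -
  have [measurable]: "U \<in> borel_measurable M" "V \<in> borel_measurable M"
    using UV by (auto simp: std_pair_def)
  have U: "gaussian_rv M U 1" and V: "gaussian_rv M V 1" using std_pair_marginals[OF UV] by auto
  note RU = resid_integrable[OF U] and RV = resid_integrable[OF V]
  have int: "integrable M (\<lambda>\<omega>. resid z (U \<omega>) * resid w (V \<omega>))"
    by (rule integrable_mult_L2) (use RU RV in auto)
  have B: "B \<ge> 0" using w by linarith
  show ?thesis
  proof (cases "\<bar>\<rho>\<bar> \<le> 1 / 2")
    case False
    then have "1 / 4 \<le> \<rho>\<^sup>2" using power_mono[of "1/2" "\<bar>\<rho>\<bar>" 2] by (simp add: power_divide)
    moreover have "1 \<le> (B + 1)\<^sup>2 * K3"
      using B K3_ge_1 mult_mono[of 1 "(B + 1)\<^sup>2" 1 K3] by (simp add: one_le_power)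
    ultimately have big: "1 * (1/4) \<le> ((B + 1)\<^sup>2 * K3) * \<rho>\<^sup>2" by (intro mult_mono) auto
    have "\<bar>expectation (\<lambda>\<omega>. resid z (U \<omega>) * resid w (V \<omega>))\<bar> \<le> expectation (\<lambda>\<omega>. \<bar>resid z (U \<omega>) * resid w (V \<omega>)\<bar>)"
      by (rule integral_abs_bound)
    also have "\<dots> \<le> expectation (\<lambda>\<omega>. (resid z (U \<omega>))\<^sup>2 / 2 + (resid w (V \<omega>))\<^sup>2 / 2)"
    proof (rule integral_mono)
      show "\<bar>resid z (U \<omega>) * resid w (V \<omega>)\<bar> \<le> (resid z (U \<omega>))\<^sup>2 / 2 + (resid w (V \<omega>))\<^sup>2 / 2" for \<omega>
        using sum_squares_bound[of "\<bar>resid z (U \<omega>)\<bar>" "\<bar>resid w (V \<omega>)\<bar>"] by (simp add: abs_mult)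
    qed (use RU RV int in auto)
    also have "\<dots> = rvar z / 2 + rvar w / 2" using RU RV by simp
    also have "\<dots> \<le> 1" using rvar_le_1[of z] rvar_le_1[of w] by simp
    finally show ?thesis using big by simp
  next
    case True
    define \<sigma> where "\<sigma> = sqrt (1 - \<rho>\<^sup>2)"
    have "\<rho>\<^sup>2 \<le> 1 / 4" using power_mono[OF True, of 2] by (simp add: power_divide)
    then have \<sigma>: "\<sigma> > 0" "\<sigma>\<^sup>2 = 1 - \<rho>\<^sup>2" unfolding \<sigma>_def by auto
    define W where "W \<omega> = (V \<omega> - \<rho> * U \<omega>) / \<sigma>" for \<omega>
    have V_eq: "V \<omega> = \<rho> * U \<omega> + \<sigma> * W \<omega>" for \<omega> using \<sigma> by (simp add: W_def)
    have [measurable]: "W \<in> borel_measurable M" unfolding W_def by measurable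
    have UW: "std_pair M U W 0"
      unfolding std_pair_def
    proof (intro conjI allI)
      fix a b
      have e: "a * U \<omega> + b * W \<omega> = (a - b * \<rho> / \<sigma>) * U \<omega> + (b / \<sigma>) * V \<omega>" for \<omega>
        using \<sigma> by (simp add: W_def field_simps)
      have "(CLINT \<omega>|M. iexp (a * U \<omega> + b * W \<omega>)) =
          of_real (exp (- ((a - b * \<rho> / \<sigma>)\<^sup>2 + 2 * \<rho> * (a - b * \<rho> / \<sigma>) * (b / \<sigma>) + (b / \<sigma>)\<^sup>2) / 2))"
        unfolding e using UV unfolding std_pair_def by blast
      also have "(a - b * \<rho> / \<sigma>)\<^sup>2 + 2 * \<rho> * (a - b * \<rho> / \<sigma>) * (b / \<sigma>) + (b / \<sigma>)\<^sup>2 = a\<^sup>2 + b\<^sup>2 * (1 - \<rho>\<^sup>2) / \<sigma>\<^sup>2"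
        using \<sigma>(1) by (simp add: field_simps power2_eq_square)
      also have "\<dots> = a\<^sup>2 + 2 * 0 * a * b + b\<^sup>2"
        unfolding \<sigma>(2)[symmetric] using \<sigma>(1) by simp
      finally show "(CLINT \<omega>|M. iexp (a * U \<omega> + b * W \<omega>)) = of_real (exp (- (a\<^sup>2 + 2 * 0 * a * b + b\<^sup>2) / 2))" .
    qed auto
    interpret N: prob_space std_normal_distribution by (rule std_normal_prob_space)
    interpret NN: pair_prob_space std_normal_distribution std_normal_distribution ..
    let ?N = "std_normal_distribution"
    define F where "F = (\<lambda>(x, y). resid z x * resid w (\<rho> * x + \<sigma> * y))"
    have [measurable]: "F \<in> borel_measurable (borel \<Otimes>\<^sub>M borel)" unfolding F_def by measurable
    have FM: "F (U \<omega>, W \<omega>) = resid z (U \<omega>) * resid w (V \<omega>)" for \<omega> by (simp add: F_def V_eq)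
    have intF: "integrable (?N \<Otimes>\<^sub>M ?N) F"
      unfolding std_pair_indep[OF UW, symmetric]
      by (subst integrable_distr_eq) (use int in \<open>auto simp: FM\<close>)
    let ?q = "\<lambda>x. Phi ((w - \<rho> * x) / \<sigma>) - Phi w - std_normal_density w * (\<rho> * x)"
    have "expectation (\<lambda>\<omega>. resid z (U \<omega>) * resid w (V \<omega>)) = (\<integral>p. F p \<partial>distr M (borel \<Otimes>\<^sub>M borel) (\<lambda>\<omega>. (U \<omega>, W \<omega>)))"
      unfolding FM[symmetric] by (rule integral_distr[symmetric]) auto
    also have "\<dots> = (\<integral>x. (\<integral>y. F (x, y) \<partial>?N) \<partial>?N)"
      unfolding std_pair_indep[OF UW] by (rule NN.integral_fst'[OF intF, symmetric])
    also have "\<dots> = (\<integral>x. resid z x * ?q x \<partial>?N)"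
      by (simp only: F_def case_prod_conv integral_mult_right_zero integral_std_normal_affine_resid[OF \<sigma>(1)])
    finally have E: "expectation (\<lambda>\<omega>. resid z (U \<omega>) * resid w (V \<omega>)) = (\<integral>x. resid z x * ?q x \<partial>?N)" .
    let ?c = "5 * (B + 1)\<^sup>2 * \<rho>\<^sup>2"
    have bd: "\<bar>resid z x * ?q x\<bar> \<le> ?c * (1 + \<bar>x\<bar>) ^ 3" for x
    proof -
      have "\<bar>resid z x * ?q x\<bar> \<le> (1 + \<bar>x\<bar>) * (?c * (1 + \<bar>x\<bar>)\<^sup>2)"
        unfolding abs_mult
        by (intro mult_mono abs_resid_le conditional_resid_bound[OF True w, folded \<sigma>_def]) auto
      then show ?thesis by (simp add: power2_eq_square power3_eq_cube mult_ac)
    qed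
    have "\<bar>\<integral>x. resid z x * ?q x \<partial>?N\<bar> \<le> (\<integral>x. \<bar>resid z x * ?q x\<bar> \<partial>?N)"
      by (rule integral_abs_bound)
    also have "\<dots> \<le> (\<integral>x. ?c * (1 + \<bar>x\<bar>) ^ 3 \<partial>?N)"
      by (rule integral_mono'[OF _ bd]) (auto intro!: integrable_std_normal_abs_power)
    also have "\<dots> = ?c * K3" by (simp add: K3_def)
    finally show ?thesis unfolding E by (simp add: mult_ac)
  qed
qed

text \<open>The two indicators can differ only if \<open>U\<close> is within \<open>\<eta>\<close>
  of the jump or \<open>U\<close> and \<open>V\<close> are at least \<open>\<eta>\<close>
  apart. The indicator not being Lipschitz, the term \<open>4 \<eta>\<close> does not tend
  to 0 with \<open>1 - \<rho>\<close>; \<open>\<eta>\<close> is chosen at the very end.\<close>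

lemma (in prob_space) resid_increment_bound:
  assumes UV: "std_pair M U V \<rho>" and \<eta>: "\<eta> > 0"
  shows "expectation (\<lambda>\<omega>. (resid z (U \<omega>) - resid z (V \<omega>))\<^sup>2) \<le> 4 * \<eta> + (2 / \<eta>\<^sup>2 + 2) * (2 - 2 * \<rho>)"
proof -
  have [measurable]: "U \<in> borel_measurable M" "V \<in> borel_measurable M"
    using UV by (auto simp: std_pair_def)
  have U: "gaussian_rv M U 1" and V: "gaussian_rv M V 1" using std_pair_marginals[OF UV] by auto
  note D = gaussian_rv_moments[OF std_pair_diff[OF UV]]
  have intb: "integrable M (\<lambda>\<omega>. of_bool (y \<le> U \<omega>) :: real)" for y
    by (rule integrable_bounded[where B=1]) (auto simp: of_bool_def)
  have Eb: "expectation (\<lambda>\<omega>. of_bool (y \<le> U \<omega>) :: real) = Phi y" for y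
    using std_gaussian_expectation(1)[OF U, of "\<lambda>x. of_bool (y \<le> x) :: real"]
    by (simp add: integral_std_normal_indicator)
  have pt: "(of_bool (z \<le> u) - of_bool (z \<le> v))\<^sup>2 \<le> of_bool (z - \<eta> \<le> u) - of_bool (z + \<eta> \<le> u) + (u - v)\<^sup>2 / \<eta>\<^sup>2" for u v :: real
  proof -
    define Q where "Q = (u - v)\<^sup>2 / \<eta>\<^sup>2"
    have "0 \<le> Q" by (simp add: Q_def)
    moreover have "1 \<le> Q" if "\<eta> \<le> \<bar>u - v\<bar>"
      using \<eta> power_mono[OF that, of 2] by (simp add: Q_def)
    ultimately show ?thesis unfolding Q_def[symmetric] using \<eta>
      by (cases "z - \<eta> \<le> u"; cases "z + \<eta> \<le> u"; cases "z \<le> u"; cases "z \<le> v") auto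
  qed
  let ?R = "\<lambda>\<omega>. 2 * (of_bool (z - \<eta> \<le> U \<omega>) - of_bool (z + \<eta> \<le> U \<omega>)) + (2 / \<eta>\<^sup>2 + 2) * (U \<omega> - V \<omega>)\<^sup>2"
  have le: "(resid z (U \<omega>) - resid z (V \<omega>))\<^sup>2 \<le> ?R \<omega>" for \<omega>
  proof -
    define d e q p where "d = (of_bool (z \<le> U \<omega>) - of_bool (z \<le> V \<omega>) :: real)"
      and "e = std_normal_density z * (U \<omega> - V \<omega>)" and "q = (U \<omega> - V \<omega>)\<^sup>2"
      and "p = (of_bool (z - \<eta> \<le> U \<omega>) - of_bool (z + \<eta> \<le> U \<omega>) :: real)"
    have eq: "resid z (U \<omega>) - resid z (V \<omega>) = d - e" by (simp add: resid_def d_def e_def algebra_simps)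
    have "(d - e)\<^sup>2 \<le> 2 * d\<^sup>2 + 2 * e\<^sup>2"
      using zero_le_power2[of "d + e"] by (simp add: power2_eq_square algebra_simps)
    moreover have "e\<^sup>2 \<le> q"
      unfolding power_mult_distrib e_def q_def using std_normal_density_le_1[of z] std_normal_density_nonneg[of z]
      by (intro mult_left_le_one_le) (auto intro: power_le_one)
    moreover have "d\<^sup>2 \<le> p + q / \<eta>\<^sup>2" unfolding d_def q_def p_def by (rule pt)
    ultimately have "(d - e)\<^sup>2 \<le> 2 * (p + q / \<eta>\<^sup>2) + 2 * q"
      by (meson add_mono dual_order.trans mult_left_mono zero_le_numeral)
    then have "(resid z (U \<omega>) - resid z (V \<omega>))\<^sup>2 \<le> 2 * (p + q / \<eta>\<^sup>2) + 2 * q" unfolding eq .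
    also have "\<dots> = 2 * p + (2 / \<eta>\<^sup>2 + 2) * q" by (simp add: algebra_simps)
    finally show ?thesis unfolding p_def q_def .
  qed
  have intR: "integrable M ?R"
    by (intro Bochner_Integration.integrable_add integrable_mult_right Bochner_Integration.integrable_diff intb D(2))
  have "expectation (\<lambda>\<omega>. (resid z (U \<omega>) - resid z (V \<omega>))\<^sup>2) \<le> expectation ?R"
    by (rule integral_mono'[OF intR le]) (rule order_trans[OF zero_le_power2 le])
  also have "\<dots> = 2 * (Phi (z - \<eta>) - Phi (z + \<eta>)) + (2 / \<eta>\<^sup>2 + 2) * (2 - 2 * \<rho>)"
    by (simp only: Bochner_Integration.integral_add Bochner_Integration.integral_diff integrable_mult_right
        Bochner_Integration.integrable_diff intb D(2) integral_mult_right_zero Eb D(3))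
  also have "\<dots> \<le> 4 * \<eta> + (2 / \<eta>\<^sup>2 + 2) * (2 - 2 * \<rho>)"
    using Phi_lipschitz[of "z - \<eta>" "z + \<eta>"] \<eta> by simp
  finally show ?thesis .
qed

section \<open>The resolvent of a covariance matrix\<close>

text \<open>Inner product and matrix-vector product over an arbitrary finite index set: the
  dimension \<open>m\<close> is a variable, and index sets are removed and split in the
  proofs.\<close>

definition ip :: "'i set \<Rightarrow> ('i \<Rightarrow> real) \<Rightarrow> ('i \<Rightarrow> real) \<Rightarrow> real" where
  "ip I x y = (\<Sum>i\<in>I. x i * y i)"

definition mv :: "'i set \<Rightarrow> ('i \<Rightarrow> 'i \<Rightarrow> real) \<Rightarrow> ('i \<Rightarrow> real) \<Rightarrow> 'i \<Rightarrow> real" where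
  "mv I A x i = (\<Sum>j\<in>I. A i j * x j)"

lemma ip_commute: "ip I x y = ip I y x"
  by (simp add: ip_def mult.commute)

lemma ip_add_left: "ip I (\<lambda>i. x i + y i) z = ip I x z + ip I y z"
  and ip_add_right: "ip I z (\<lambda>i. x i + y i) = ip I z x + ip I z y"
  and ip_diff_left: "ip I (\<lambda>i. x i - y i) z = ip I x z - ip I y z"
  and ip_diff_right: "ip I z (\<lambda>i. x i - y i) = ip I z x - ip I z y"
  and ip_scale_left: "ip I (\<lambda>i. c * x i) z = c * ip I x z"
  and ip_scale_right: "ip I z (\<lambda>i. c * x i) = c * ip I z x"
  by (simp_all add: ip_def sum.distrib sum_subtractf algebra_simps sum_distrib_left)

lemmas ip_linear = ip_add_left ip_add_right ip_diff_left ip_diff_right ip_scale_left ip_scale_right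

lemma ip_cong: "(\<And>i. i \<in> I \<Longrightarrow> x i = x' i) \<Longrightarrow> (\<And>i. i \<in> I \<Longrightarrow> y i = y' i) \<Longrightarrow> ip I x y = ip I x' y'"
  by (simp add: ip_def)

lemma mv_add: "mv I A (\<lambda>i. x i + y i) = (\<lambda>i. mv I A x i + mv I A y i)"
  and mv_scale: "mv I A (\<lambda>i. c * x i) = (\<lambda>i. c * mv I A x i)"
  by (auto simp: fun_eq_iff mv_def sum.distrib sum_distrib_left algebra_simps)

lemma ip_mv_adjoint:
  assumes "\<And>i j. i \<in> I \<Longrightarrow> j \<in> I \<Longrightarrow> A i j = A j i"
  shows "ip I x (mv I A y) = ip I (mv I A x) y"
proof -
  have "ip I x (mv I A y) = (\<Sum>i\<in>I. \<Sum>j\<in>I. x i * (A i j * y j))"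
    by (simp add: ip_def mv_def sum_distrib_left)
  also have "\<dots> = (\<Sum>j\<in>I. \<Sum>i\<in>I. x i * (A i j * y j))" by (rule sum.swap)
  also have "\<dots> = (\<Sum>j\<in>I. \<Sum>i\<in>I. A j i * x i * y j)"
    using assms by (intro sum.cong refl) auto
  also have "\<dots> = ip I (mv I A x) y"
    by (simp add: ip_def mv_def sum_distrib_right)
  finally show ?thesis .
qed

lemma ip_self_nonneg: "0 \<le> ip I x x"
  by (simp add: ip_def sum_nonneg)

text \<open>Elimination of one index \<open>k\<close> leaves the Schur complement \<open>s\<close>
  as pivot. It is the value of the quadratic form at a vector whose \<open>k\<close>-th
  entry is 1, hence positive.\<close>

lemma positive_definite_solvable:
  assumes "finite I"
    and "\<And>x. \<exists>i\<in>I. x i \<noteq> 0 \<Longrightarrow> 0 < ip I x (mv I S x)"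
  shows "\<exists>x. \<forall>i\<in>I. mv I S x i = b i"
  using assms
proof (induction I arbitrary: b rule: finite_induct)
  case (insert k I)
  have pd: "0 < ip I x (mv I S x)" if "\<exists>i\<in>I. x i \<noteq> 0" for x
  proof -
    let ?x = "x(k := 0)"
    have mvx: "mv (insert k I) S ?x i = mv I S x i" for i
      using insert.hyps by (auto simp: mv_def intro!: sum.cong)
    have "ip (insert k I) ?x (mv (insert k I) S ?x) = ip I x (mv I S x)"
      unfolding ip_def mvx using insert.hyps by (auto intro!: sum.cong)
    moreover have "\<exists>i\<in>insert k I. ?x i \<noteq> 0" using that insert.hyps by auto
    ultimately show ?thesis using insert.prems[of ?x] by (simp only:)
  qed
  obtain u where u: "\<And>i. i \<in> I \<Longrightarrow> mv I S u i = S i k" using insert.IH[OF pd, of "\<lambda>i. S i k"] by auto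
  obtain v where v: "\<And>i. i \<in> I \<Longrightarrow> mv I S v i = b i" using insert.IH[OF pd, of b] by auto
  have split: "mv (insert k I) S (\<lambda>j. if j = k then c else y j) i = S i k * c + mv I S y i" for c y i
    unfolding mv_def using insert.hyps by (subst sum.insert) (auto intro!: sum.cong)
  define s where "s = S k k - mv I S u k"
  have neg: "mv I S (\<lambda>j. - u j) i = - mv I S u i" for i by (simp add: mv_def sum_negf)
  have "0 < ip (insert k I) (\<lambda>j. if j = k then 1 else - u j) (mv (insert k I) S (\<lambda>j. if j = k then 1 else - u j))"
    by (rule insert.prems) auto
  also have "\<dots> = s"
  proof -
    have "(\<Sum>i\<in>I. (if i = k then 1 else - u i) * (S i k * 1 + mv I S (\<lambda>j. - u j) i)) = 0"
      using u by (intro sum.neutral) (auto simp: neg)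
    then show ?thesis
      unfolding ip_def split using insert.hyps by (simp add: neg s_def)
  qed
  finally have s: "s > 0" .
  define c where "c = (b k - mv I S v k) / s"
  have lin: "mv I S (\<lambda>j. v j - c * u j) i = mv I S v i - c * mv I S u i" for i
    by (simp add: mv_def sum_subtractf sum_distrib_left algebra_simps)
  show ?case
  proof (intro exI ballI)
    fix i assume "i \<in> insert k I"
    then consider "i = k" | "i \<in> I" by auto
    then show "mv (insert k I) S (\<lambda>j. if j = k then c else v j - c * u j) i = b i"
    proof cases
      case 1
      have "c * s = b k - mv I S v k" using s by (simp add: c_def)
      then show ?thesis unfolding split lin 1 by (simp add: s_def algebra_simps)
    next
      case 2 then show ?thesis unfolding split lin using u v by simp
    qed
  qed
qed simp

definition delta :: "'i \<Rightarrow> 'i \<Rightarrow> real" where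
  "delta i j = (if i = j then 1 else 0)"

lemma ip_delta: "finite I \<Longrightarrow> j \<in> I \<Longrightarrow> ip I x (\<lambda>i. delta i j) = x j"
  by (simp add: ip_def delta_def if_distrib[of "\<lambda>y. _ * y"] sum.delta cong: if_cong)

text \<open>Although \<open>\<Gamma>\<close> may be singular, \<open>1 + \<Gamma>\<close> is
  positive definite. Its inverse is symmetric since \<open>1 + \<Gamma>\<close> is.\<close>

lemma resolvent_exists:
  assumes fin: "finite I" and sym: "\<And>i j. i \<in> I \<Longrightarrow> j \<in> I \<Longrightarrow> \<Gamma> i j = \<Gamma> j i"
    and psd: "\<And>x. 0 \<le> ip I x (mv I \<Gamma> x)"
  obtains R where "\<And>i j. i \<in> I \<Longrightarrow> j \<in> I \<Longrightarrow> R i j = R j i"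
    "\<And>i j. i \<in> I \<Longrightarrow> j \<in> I \<Longrightarrow> R i j + mv I \<Gamma> (\<lambda>k. R k j) i = delta i j"
proof -
  let ?S = "\<lambda>i j. delta i j + \<Gamma> i j"
  have mvS: "mv I ?S x i = x i + mv I \<Gamma> x i" if "i \<in> I" for x i
  proof -
    have "(\<Sum>j\<in>I. delta i j * x j) = x i"
      using fin that by (simp add: delta_def if_distrib[of "\<lambda>y. y * _"] sum.delta cong: if_cong)
    then show ?thesis by (simp add: mv_def distrib_right sum.distrib)
  qed
  have "\<exists>x. \<forall>i\<in>I. mv I ?S x i = delta i j" for j
  proof (rule positive_definite_solvable[OF fin])
    fix x :: "'a \<Rightarrow> real" assume "\<exists>i\<in>I. x i \<noteq> 0"
    then obtain i where i: "i \<in> I" "x i \<noteq> 0" by auto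
    have "0 < x i * x i" using i(2) not_real_square_gt_zero by blast
    also have "\<dots> \<le> ip I x x" unfolding ip_def using fin i by (intro member_le_sum) auto
    also have "\<dots> \<le> ip I x x + ip I x (mv I \<Gamma> x)" using psd by simp
    also have "\<dots> = ip I x (\<lambda>i. x i + mv I \<Gamma> x i)" by (simp add: ip_linear)
    also have "\<dots> = ip I x (mv I ?S x)" using mvS by (intro ip_cong) auto
    finally show "0 < ip I x (mv I ?S x)" .
  qed
  then obtain R' where R': "\<And>j i. i \<in> I \<Longrightarrow> mv I ?S (R' j) i = delta i j" by metis
  define R where "R i j = R' j i" for i j
  have R: "R i j + mv I \<Gamma> (\<lambda>k. R k j) i = delta i j" if "i \<in> I" for i j
    using R'[OF that, of j] mvS[OF that] by (simp add: R_def)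
  have Ssym: "?S i j = ?S j i" if "i \<in> I" "j \<in> I" for i j using sym[OF that] by (simp add: delta_def)
  have "R i j = R j i" if ij: "i \<in> I" "j \<in> I" for i j
  proof -
    have "ip I (R' i) (mv I ?S (R' j)) = ip I (R' i) (\<lambda>k. delta k j)"
      using R' by (intro ip_cong) auto
    then have 1: "ip I (R' i) (mv I ?S (R' j)) = R' i j" using ip_delta[OF fin ij(2)] by simp
    have "ip I (mv I ?S (R' i)) (R' j) = ip I (\<lambda>k. delta k i) (R' j)"
      using R' by (intro ip_cong) auto
    then have 2: "ip I (mv I ?S (R' i)) (R' j) = R' j i" using ip_delta[OF fin ij(1)] by (simp add: ip_commute)
    show ?thesis using 1 2 ip_mv_adjoint[of I ?S "R' i" "R' j"] Ssym by (simp add: R_def)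
  qed
  then show thesis using R that by blast
qed

text \<open>Here \<open>R = (1 + \<Gamma>)\<^sup>-\<^sup>1\<close>.\<close>

locale covariance_resolvent =
  fixes I :: "'i set" and \<Gamma> R :: "'i \<Rightarrow> 'i \<Rightarrow> real"
  assumes fin: "finite I"
    and sym: "\<And>i j. i \<in> I \<Longrightarrow> j \<in> I \<Longrightarrow> \<Gamma> i j = \<Gamma> j i"
    and diag: "\<And>i. i \<in> I \<Longrightarrow> \<Gamma> i i = 1"
    and psd: "\<And>x. 0 \<le> ip I x (mv I \<Gamma> x)"
    and Rsym: "\<And>i j. i \<in> I \<Longrightarrow> j \<in> I \<Longrightarrow> R i j = R j i"
    and R: "\<And>i j. i \<in> I \<Longrightarrow> j \<in> I \<Longrightarrow> R i j + mv I \<Gamma> (\<lambda>k. R k j) i = delta i j"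
begin

text \<open>The Cayley transform \<open>(\<Gamma> - 1) (\<Gamma> + 1)\<^sup>-\<^sup>1\<close>, which
  is of the size of \<open>\<Gamma> - 1\<close> and has norm at most 1 for every positive
  semidefinite \<open>\<Gamma>\<close>.\<close>

definition C :: "'i \<Rightarrow> 'i \<Rightarrow> real" where "C i j = delta i j - 2 * R i j"

definition E2 :: real where "E2 = (\<Sum>i\<in>I. \<Sum>j\<in>I - {i}. (\<Gamma> i j)\<^sup>2)"

lemma Csym: "i \<in> I \<Longrightarrow> j \<in> I \<Longrightarrow> C i j = C j i"
  using Rsym by (auto simp: C_def delta_def)

lemma mv_delta: "i \<in> I \<Longrightarrow> mv I delta x i = x i"
  using fin by (simp add: mv_def delta_def if_distrib[of "\<lambda>y. y * _"] sum.delta cong: if_cong)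

lemma C_equation:
  assumes "i \<in> I" "j \<in> I"
  shows "C i j + mv I \<Gamma> (\<lambda>k. C k j) i = \<Gamma> i j - delta i j"
proof -
  have "mv I \<Gamma> (\<lambda>k. C k j) i = (\<Sum>k\<in>I. \<Gamma> i k * delta k j) - 2 * mv I \<Gamma> (\<lambda>k. R k j) i"
    by (simp add: mv_def C_def right_diff_distrib sum_subtractf sum_distrib_left mult_ac)
  also have "(\<Sum>k\<in>I. \<Gamma> i k * delta k j) = \<Gamma> i j"
    using ip_delta[OF fin assms(2), of "\<Gamma> i"] by (simp add: ip_def)
  finally show ?thesis using R[OF assms] by (simp add: C_def)
qed

lemma E2_eq: "(\<Sum>i\<in>I. \<Sum>j\<in>I. (\<Gamma> i j - delta i j)\<^sup>2) = E2"
  unfolding E2_def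
proof (rule sum.cong[OF refl])
  fix i assume i: "i \<in> I"
  have "(\<Sum>j\<in>I. (\<Gamma> i j - delta i j)\<^sup>2) = (\<Gamma> i i - delta i i)\<^sup>2 + (\<Sum>j\<in>I - {i}. (\<Gamma> i j - delta i j)\<^sup>2)"
    by (rule sum.remove[OF fin i])
  also have "\<dots> = (\<Sum>j\<in>I - {i}. (\<Gamma> i j)\<^sup>2)"
  proof -
    have "(\<Sum>j\<in>I - {i}. (\<Gamma> i j - delta i j)\<^sup>2) = (\<Sum>j\<in>I - {i}. (\<Gamma> i j)\<^sup>2)"
      by (rule sum.cong) (auto simp: delta_def)
    then show ?thesis using diag[OF i] by (simp add: delta_def)
  qed
  finally show "(\<Sum>j\<in>I. (\<Gamma> i j - delta i j)\<^sup>2) = (\<Sum>j\<in>I - {i}. (\<Gamma> i j)\<^sup>2)" .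
qed

text \<open>In \<open>(1 + \<Gamma>) C = \<Gamma> - 1\<close> the factor \<open>1 + \<Gamma>\<close>
  does not decrease the length of any column.\<close>

lemma C_frobenius: "(\<Sum>i\<in>I. \<Sum>j\<in>I. (C i j)\<^sup>2) \<le> E2"
proof -
  have "(\<Sum>i\<in>I. (C i j)\<^sup>2) \<le> (\<Sum>i\<in>I. (\<Gamma> i j - delta i j)\<^sup>2)" if j: "j \<in> I" for j
  proof -
    let ?c = "\<lambda>i. C i j" let ?g = "mv I \<Gamma> ?c"
    have "(\<Sum>i\<in>I. (\<Gamma> i j - delta i j)\<^sup>2) = ip I (\<lambda>i. ?c i + ?g i) (\<lambda>i. ?c i + ?g i)"
      unfolding ip_def using C_equation[OF _ j] by (intro sum.cong refl) (simp add: power2_eq_square)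
    also have "\<dots> = ip I ?c ?c + 2 * ip I ?c ?g + ip I ?g ?g"
      unfolding ip_linear by (subst (3) ip_commute) simp
    finally show ?thesis
      using psd[of ?c] ip_self_nonneg[of I ?g] by (simp add: ip_def power2_eq_square)
  qed
  then have "(\<Sum>j\<in>I. \<Sum>i\<in>I. (C i j)\<^sup>2) \<le> (\<Sum>j\<in>I. \<Sum>i\<in>I. (\<Gamma> i j - delta i j)\<^sup>2)"
    by (rule sum_mono)
  also have "(\<Sum>j\<in>I. \<Sum>i\<in>I. (C i j)\<^sup>2) = (\<Sum>i\<in>I. \<Sum>j\<in>I. (C i j)\<^sup>2)" by (rule sum.swap)
  also have "(\<Sum>j\<in>I. \<Sum>i\<in>I. (\<Gamma> i j - delta i j)\<^sup>2) = E2"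
    unfolding E2_eq[symmetric] by (rule sum.swap)
  finally show ?thesis .
qed

text \<open>Since \<open>\<Gamma>\<close> has unit diagonal, so that \<open>C\<close> and
  \<open>\<Gamma> C\<close> have opposite diagonals, \<open>- 2 C\<close> and
  \<open>(\<Gamma> - 1) C\<close> have the same diagonal. The trace is therefore of second
  order in \<open>\<Gamma> - 1\<close>, while single entries of \<open>C\<close> are of
  first order.\<close>

lemma C_trace: "(\<Sum>i\<in>I. - 2 * C i i) \<le> E2"
proof -
  let ?E = "\<lambda>i j. \<Gamma> i j - delta i j"
  have "- 2 * C i i = (\<Sum>k\<in>I. ?E i k * C k i)" if i: "i \<in> I" for i
  proof -
    have "(\<Sum>k\<in>I. ?E i k * C k i) = mv I \<Gamma> (\<lambda>k. C k i) i - mv I delta (\<lambda>k. C k i) i"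
      by (simp add: mv_def left_diff_distrib sum_subtractf)
    then show ?thesis using C_equation[OF i i] diag[OF i] mv_delta[OF i, of "\<lambda>k. C k i"] by (simp add: delta_def)
  qed
  then have "(\<Sum>i\<in>I. - 2 * C i i) = (\<Sum>i\<in>I. \<Sum>k\<in>I. ?E i k * C k i)" by simp
  also have "\<dots> \<le> (\<Sum>i\<in>I. \<Sum>k\<in>I. (?E i k)\<^sup>2 / 2 + (C k i)\<^sup>2 / 2)"
  proof (intro sum_mono)
    have "x * y \<le> x\<^sup>2 / 2 + y\<^sup>2 / 2" for x y :: real using sum_squares_bound[of x y] by simp
    then show "?E i k * C k i \<le> (?E i k)\<^sup>2 / 2 + (C k i)\<^sup>2 / 2" for i k .
  qed
  also have "\<dots> = (\<Sum>i\<in>I. \<Sum>k\<in>I. (?E i k)\<^sup>2) / 2 + (\<Sum>i\<in>I. \<Sum>k\<in>I. (C k i)\<^sup>2) / 2"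
    by (simp add: sum.distrib sum_divide_distrib)
  also have "(\<Sum>i\<in>I. \<Sum>k\<in>I. (C k i)\<^sup>2) = (\<Sum>i\<in>I. \<Sum>k\<in>I. (C i k)\<^sup>2)" by (rule sum.swap)
  also have "(\<Sum>i\<in>I. \<Sum>k\<in>I. (?E i k)\<^sup>2) / 2 + (\<Sum>i\<in>I. \<Sum>k\<in>I. (C i k)\<^sup>2) / 2 \<le> E2"
    using E2_eq C_frobenius by simp
  finally show ?thesis .
qed

text \<open>The left side is the variance of \<open>ip I a Z + ip I b Y\<close> for \<open>Z = 2 R Y
  + C \<xi>\<close>. The right side shows that \<open>Z\<close> has the identity as
  covariance and that the covariance of \<open>Y\<close> and \<open>Z\<close> is \<open>1
  + C\<close>, because \<open>4 R \<Gamma> R + C\<^sup>2 = 1\<close> and \<open>2 \<Gamma>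
  R = 1 + C\<close>.\<close>

lemma quadratic_identity:
  fixes a b
  defines "p \<equiv> mv I R a"
  defines "y \<equiv> (\<lambda>i. 2 * p i + b i)"
  shows "ip I y (mv I \<Gamma> y) + ip I (mv I C a) (mv I C a) =
    ip I a a + 2 * ip I b (\<lambda>i. a i + mv I C a i) + ip I b (mv I \<Gamma> b)"
proof -
  have Gp: "mv I \<Gamma> p i = a i - p i" if i: "i \<in> I" for i
  proof -
    have "mv I \<Gamma> p i = (\<Sum>k\<in>I. \<Sum>j\<in>I. \<Gamma> i k * (R k j * a j))"
      by (simp add: p_def mv_def sum_distrib_left)
    also have "\<dots> = (\<Sum>j\<in>I. \<Sum>k\<in>I. \<Gamma> i k * (R k j * a j))" by (rule sum.swap)
    also have "\<dots> = (\<Sum>j\<in>I. mv I \<Gamma> (\<lambda>k. R k j) i * a j)"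
      by (simp add: mv_def sum_distrib_right mult.assoc)
    also have "\<dots> = (\<Sum>j\<in>I. (delta i j - R i j) * a j)"
    proof (rule sum.cong[OF refl])
      fix j assume "j \<in> I"
      then show "mv I \<Gamma> (\<lambda>k. R k j) i * a j = (delta i j - R i j) * a j" using R[OF i, of j] by simp
    qed
    also have "\<dots> = mv I delta a i - p i"
      by (simp add: left_diff_distrib sum_subtractf p_def mv_def)
    finally show ?thesis using mv_delta[OF i] by simp
  qed
  have Ca: "mv I C a i = a i - 2 * p i" if "i \<in> I" for i
  proof -
    have "mv I C a i = mv I delta a i - 2 * p i"
      by (simp add: C_def mv_def p_def sum_subtractf[symmetric] sum_distrib_left algebra_simps)
    then show ?thesis using mv_delta[OF that] by simp
  qed
  have Gy: "mv I \<Gamma> y i = 2 * mv I \<Gamma> p i + mv I \<Gamma> b i" for i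
    by (simp add: y_def mv_add mv_scale)
  have 1: "ip I y (mv I \<Gamma> y) = ip I (\<lambda>i. 2 * p i + b i) (\<lambda>i. 2 * (a i - p i) + mv I \<Gamma> b i)"
    using Gp Gy by (intro ip_cong) (auto simp: y_def)
  have 2: "ip I (mv I C a) (mv I C a) = ip I (\<lambda>i. a i - 2 * p i) (\<lambda>i. a i - 2 * p i)"
    using Ca by (intro ip_cong) auto
  have 3: "ip I b (\<lambda>i. a i + mv I C a i) = ip I b (\<lambda>i. 2 * a i - 2 * p i)"
    using Ca by (intro ip_cong) auto
  have 4: "ip I p (mv I \<Gamma> b) = ip I b (\<lambda>i. a i - p i)"
  proof -
    have "ip I p (mv I \<Gamma> b) = ip I (mv I \<Gamma> p) b" by (rule ip_mv_adjoint) (rule sym)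
    also have "\<dots> = ip I (\<lambda>i. a i - p i) b" using Gp by (intro ip_cong) auto
    finally show ?thesis by (simp only: ip_commute)
  qed
  show ?thesis
    unfolding 1 2 3 unfolding ip_linear 4 by (simp add: ip_linear ip_commute[of I a p] ip_commute[of I a b] ip_commute[of I p b] algebra_simps)
qed

end

section \<open>Coupling with independent standard Gaussian variables\<close>

lemma integral_PiM_std_normal_iexp:
  assumes "finite I"
  shows "(CLINT \<xi>|PiM I (\<lambda>_. std_normal_distribution). iexp (\<Sum>k\<in>I. d k * \<xi> k)) = of_real (exp (- (\<Sum>k\<in>I. (d k)\<^sup>2) / 2))"
proof -
  interpret N: prob_space std_normal_distribution by (rule std_normal_prob_space)
  interpret PP: product_sigma_finite "\<lambda>_. std_normal_distribution" by unfold_locales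
  have "(CLINT \<xi>|PiM I (\<lambda>_. std_normal_distribution). iexp (\<Sum>k\<in>I. d k * \<xi> k)) =
      (CLINT \<xi>|PiM I (\<lambda>_. std_normal_distribution). (\<Prod>k\<in>I. iexp (d k * \<xi> k)))"
    using assms by (intro Bochner_Integration.integral_cong refl) (simp add: exp_sum[symmetric] sum_distrib_left)
  also have "\<dots> = (\<Prod>k\<in>I. (CLINT x|std_normal_distribution. iexp (d k * x)))"
    by (rule PP.product_integral_prod[OF assms]) (rule N.integrable_bounded[where B=1], auto)
  also have "\<dots> = (\<Prod>k\<in>I. of_real (exp (- (d k)\<^sup>2 / 2)))"
    using fun_cong[OF char_std_normal_distribution] unfolding char_def by (intro prod.cong refl) blast
  also have "\<dots> = of_real (exp (\<Sum>k\<in>I. - (d k)\<^sup>2 / 2))"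
    using assms by (simp add: exp_sum)
  also have "(\<Sum>k\<in>I. - (d k)\<^sup>2 / 2) = - (\<Sum>k\<in>I. (d k)\<^sup>2) / 2"
    by (simp add: sum_divide_distrib sum_negf)
  finally show ?thesis .
qed

text \<open>The coupling is \<open>Z = 2 R Y + C \<xi>\<close> with \<open>\<xi>\<close> on the
  second factor of the product space. The gain over \<open>Z =
  \<Gamma>\<^sup>-\<^sup>1\<^sup>/\<^sup>2 Y\<close> is that it exists for singular
  \<open>\<Gamma>\<close> and that
  the deviation \<open>C\<close> of the cross-covariance from the identity is bounded without any spectral condition; the second moment of
  \<open>Y i - Z i\<close> is \<open>- 2 C i i\<close>, which explains the last but one
  estimate.\<close>

lemma gaussian_coupling:
  fixes Y :: "'i \<Rightarrow> 'a \<Rightarrow> real"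
  assumes "prob_space M" and fin: "finite I"
    and Y [measurable]: "\<And>i. i \<in> I \<Longrightarrow> Y i \<in> borel_measurable M"
    and sym: "\<And>i j. i \<in> I \<Longrightarrow> j \<in> I \<Longrightarrow> \<Gamma> i j = \<Gamma> j i"
    and diag: "\<And>i. i \<in> I \<Longrightarrow> \<Gamma> i i = 1"
    and gauss: "\<And>b. gaussian_rv M (\<lambda>\<omega>. \<Sum>i\<in>I. b i * Y i \<omega>) (ip I b (mv I \<Gamma> b))"
  defines "P \<equiv> M \<Otimes>\<^sub>M PiM I (\<lambda>_. std_normal_distribution)"
  obtains Z C where "\<And>i. i \<in> I \<Longrightarrow> Z i \<in> borel_measurable P"
    "\<And>a b. gaussian_rv P (\<lambda>\<omega>. (\<Sum>i\<in>I. a i * Z i \<omega>) + (\<Sum>i\<in>I. b i * Y i (fst \<omega>)))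
       (ip I a a + 2 * ip I b (\<lambda>i. a i + mv I C a i) + ip I b (mv I \<Gamma> b))"
    "(\<Sum>i\<in>I. \<Sum>j\<in>I. (C i j)\<^sup>2) \<le> (\<Sum>i\<in>I. \<Sum>j\<in>I - {i}. (\<Gamma> i j)\<^sup>2)"
    "(\<Sum>i\<in>I. - 2 * C i i) \<le> (\<Sum>i\<in>I. \<Sum>j\<in>I - {i}. (\<Gamma> i j)\<^sup>2)"
    "\<And>i j. i \<in> I \<Longrightarrow> j \<in> I \<Longrightarrow> C i j = C j i"
proof -
  interpret M: prob_space M by fact
  have psd: "0 \<le> ip I x (mv I \<Gamma> x)" for x by (rule M.gaussian_rv_moments(1)[OF gauss])
  obtain R where R: "\<And>i j. i \<in> I \<Longrightarrow> j \<in> I \<Longrightarrow> R i j = R j i"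
    "\<And>i j. i \<in> I \<Longrightarrow> j \<in> I \<Longrightarrow> R i j + mv I \<Gamma> (\<lambda>k. R k j) i = delta i j"
    using resolvent_exists[OF fin sym psd] by blast
  interpret covariance_resolvent I \<Gamma> R
    by unfold_locales (use fin sym diag psd R in auto)
  let ?X = "PiM I (\<lambda>_. std_normal_distribution)"
  interpret X: prob_space ?X by (intro prob_space_PiM std_normal_prob_space)
  interpret MX: pair_prob_space M ?X ..
  define Z where "Z j \<omega> = (\<Sum>i\<in>I. 2 * R j i * Y i (fst \<omega>)) + (\<Sum>k\<in>I. C j k * snd \<omega> k)" for j \<omega>
  have meas_xi [measurable]: "(\<lambda>\<xi>. \<xi> k) \<in> borel_measurable ?X" if "k \<in> I" for k
    using measurable_component_singleton[OF that, of "\<lambda>_. std_normal_distribution"] by simp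
  have Z: "Z i \<in> borel_measurable P" for i unfolding Z_def P_def by measurable
  have g: "gaussian_rv P (\<lambda>\<omega>. (\<Sum>i\<in>I. a i * Z i \<omega>) + (\<Sum>i\<in>I. b i * Y i (fst \<omega>)))
       (ip I a a + 2 * ip I b (\<lambda>i. a i + mv I C a i) + ip I b (mv I \<Gamma> b))" for a b
  proof -
    define y where "y = (\<lambda>i. 2 * mv I R a i + b i)"
    let ?S = "\<lambda>\<omega>. \<Sum>i\<in>I. y i * Y i \<omega>" and ?T = "\<lambda>\<xi>. \<Sum>k\<in>I. mv I C a k * \<xi> k"
    have dec: "(\<Sum>i\<in>I. a i * Z i \<omega>) + (\<Sum>i\<in>I. b i * Y i (fst \<omega>)) = ?S (fst \<omega>) + ?T (snd \<omega>)" for \<omega>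
    proof -
      have "(\<Sum>j\<in>I. a j * (\<Sum>i\<in>I. 2 * R j i * Y i (fst \<omega>))) = (\<Sum>j\<in>I. \<Sum>i\<in>I. a j * (2 * R j i * Y i (fst \<omega>)))"
        by (simp add: sum_distrib_left)
      also have "\<dots> = (\<Sum>i\<in>I. \<Sum>j\<in>I. a j * (2 * R j i * Y i (fst \<omega>)))" by (rule sum.swap)
      also have "\<dots> = (\<Sum>i\<in>I. \<Sum>j\<in>I. 2 * (R i j * a j) * Y i (fst \<omega>))"
        using Rsym by (intro sum.cong refl) (auto simp: mult_ac)
      also have "\<dots> = (\<Sum>i\<in>I. 2 * mv I R a i * Y i (fst \<omega>))"
        by (simp add: mv_def sum_distrib_left sum_distrib_right)
      finally have 1: "(\<Sum>j\<in>I. a j * (\<Sum>i\<in>I. 2 * R j i * Y i (fst \<omega>))) = (\<Sum>i\<in>I. 2 * mv I R a i * Y i (fst \<omega>))" .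
      have "(\<Sum>j\<in>I. a j * (\<Sum>k\<in>I. C j k * snd \<omega> k)) = (\<Sum>j\<in>I. \<Sum>k\<in>I. a j * (C j k * snd \<omega> k))"
        by (simp add: sum_distrib_left)
      also have "\<dots> = (\<Sum>k\<in>I. \<Sum>j\<in>I. a j * (C j k * snd \<omega> k))" by (rule sum.swap)
      also have "\<dots> = (\<Sum>k\<in>I. \<Sum>j\<in>I. (C k j * a j) * snd \<omega> k)"
        using Csym by (intro sum.cong refl) (auto simp: mult_ac)
      also have "\<dots> = ?T (snd \<omega>)"
        by (simp add: mv_def sum_distrib_right)
      finally show ?thesis
        using 1 by (simp add: Z_def y_def distrib_left distrib_right sum.distrib)
    qed
    have [measurable]: "?S \<in> borel_measurable M" "?T \<in> borel_measurable ?X" by measurable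
    have "(CLINT \<omega>|P. iexp (u * (?S (fst \<omega>) + ?T (snd \<omega>)))) =
        of_real (exp (- ((ip I y (mv I \<Gamma> y) + ip I (mv I C a) (mv I C a)) * u\<^sup>2) / 2))" for u
    proof -
      have int: "complex_integrable P (\<lambda>\<omega>. iexp (u * (?S (fst \<omega>) + ?T (snd \<omega>))))"
        unfolding P_def by (rule MX.integrable_bounded[where B=1]) auto
      have "(CLINT \<omega>|P. iexp (u * (?S (fst \<omega>) + ?T (snd \<omega>)))) = (CLINT \<omega>|M. CLINT \<xi>|?X. iexp (u * (?S \<omega> + ?T \<xi>)))"
        using MX.integral_fst'[OF int[unfolded P_def]] unfolding P_def by simp
      also have "\<dots> = (CLINT \<omega>|M. CLINT \<xi>|?X. iexp (u * ?S \<omega>) * iexp (\<Sum>k\<in>I. (u * mv I C a k) * \<xi> k))"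
        by (intro Bochner_Integration.integral_cong refl)
           (simp add: exp_add[symmetric] distrib_left sum_distrib_left mult.assoc)
      also have "\<dots> = (CLINT \<omega>|M. iexp (u * ?S \<omega>)) * of_real (exp (- (\<Sum>k\<in>I. (u * mv I C a k)\<^sup>2) / 2))"
        by (simp only: integral_mult_right_zero integral_PiM_std_normal_iexp[OF fin] integral_mult_left_zero)
      also have "(CLINT \<omega>|M. iexp (u * ?S \<omega>)) = of_real (exp (- (ip I y (mv I \<Gamma> y) * u\<^sup>2) / 2))"
        using gauss[of y] unfolding gaussian_rv_def by blast
      also have "(\<Sum>k\<in>I. (u * mv I C a k)\<^sup>2) = ip I (mv I C a) (mv I C a) * u\<^sup>2"
        by (simp add: ip_def sum_distrib_left power2_eq_square mult_ac)
      finally show ?thesis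
        by (simp add: of_real_mult[symmetric] exp_add[symmetric] distrib_right add_divide_distrib diff_divide_distrib del: of_real_mult)
    qed
    moreover have "(\<lambda>\<omega>. ?S (fst \<omega>) + ?T (snd \<omega>)) \<in> borel_measurable P" unfolding P_def by measurable
    ultimately show ?thesis
      unfolding dec gaussian_rv_def quadratic_identity[symmetric] y_def by blast
  qed
  show thesis
    by (rule that[OF Z g C_frobenius[unfolded E2_def] C_trace[unfolded E2_def] Csym])
qed

text \<open>The factor \<open>f j\<close> is moved from the product into the expectation one index
  at a time: by the induction hypothesis the characters of \<open>\<xi> j\<close> decouple
  from everything else, hence so does \<open>f j\<close>.\<close>

lemma (in prob_space) gaussian_independence:
  fixes f :: "'i \<Rightarrow> real \<Rightarrow> complex"
  assumes fin: "finite J"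
    and \<xi> [measurable]: "\<And>k. k \<in> J \<Longrightarrow> \<xi> k \<in> borel_measurable M" and T [measurable]: "T \<in> borel_measurable M"
    and char: "\<And>c s. (CLINT \<omega>|M. iexp ((\<Sum>k\<in>J. c k * \<xi> k \<omega>) + s * T \<omega>)) = of_real (exp (- ((\<Sum>k\<in>J. (c k)\<^sup>2) + s\<^sup>2 * q) / 2))"
    and f [measurable]: "\<And>k. f k \<in> borel_measurable borel" and f1: "\<And>k x. norm (f k x) \<le> 1"
    and K: "K \<subseteq> J"
  shows "(CLINT \<omega>|M. iexp ((\<Sum>k\<in>J - K. c k * \<xi> k \<omega>) + s * T \<omega>) * (\<Prod>k\<in>K. f k (\<xi> k \<omega>))) =
    of_real (exp (- ((\<Sum>k\<in>J - K. (c k)\<^sup>2) + s\<^sup>2 * q) / 2)) * (\<Prod>k\<in>K. (CLINT x|std_normal_distribution. f k x))"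
proof -
  have "finite K" using K fin by (rule finite_subset)
  from this K show ?thesis
  proof (induction K arbitrary: c rule: finite_induct)
    case empty
    then show ?case using char[of c s] by simp
  next
    case (insert j K)
    then have j: "j \<in> J" "j \<notin> K" "K \<subseteq> J" by auto
    have [measurable]: "\<xi> k \<in> borel_measurable M" if "k \<in> K" for k using that j \<xi> by auto
    have [measurable]: "\<xi> j \<in> borel_measurable M" using j by auto
    have gj: "gaussian_rv M (\<xi> j) 1"
      unfolding gaussian_rv_def
    proof (intro conjI allI)
      fix u
      have "(\<Sum>k\<in>J. (if k = j then u else 0) * \<xi> k \<omega>) = u * \<xi> j \<omega>" for \<omega>
        using fin j by (simp add: if_distrib[of "\<lambda>y. y * _"] cong: if_cong)
      moreover have "(\<Sum>k\<in>J. ((if k = j then u else 0))\<^sup>2) = u\<^sup>2"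
        using fin j by (simp add: if_distrib[of "\<lambda>y. y\<^sup>2"] cong: if_cong)
      ultimately show "(CLINT \<omega>|M. iexp (u * \<xi> j \<omega>)) = of_real (exp (- (1 * u\<^sup>2) / 2))"
        using char[of "\<lambda>k. if k = j then u else 0" 0] by simp
    qed fact
    have JK: "J - K = insert j (J - insert j K)" "j \<notin> J - insert j K" "finite (J - insert j K)"
      using j fin by auto
    define W where "W \<omega> = iexp ((\<Sum>k\<in>J - insert j K. c k * \<xi> k \<omega>) + s * T \<omega>) * (\<Prod>k\<in>K. f k (\<xi> k \<omega>))" for \<omega>
    define w where "w = of_real (exp (- ((\<Sum>k\<in>J - insert j K. (c k)\<^sup>2) + s\<^sup>2 * q) / 2)) * (\<Prod>k\<in>K. (CLINT x|std_normal_distribution. f k x))"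
    have [measurable]: "W \<in> borel_measurable M" unfolding W_def by measurable
    have W1: "norm (W \<omega>) \<le> 1" for \<omega>
      using f1 by (auto simp: W_def norm_mult prod_norm[symmetric] intro!: prod_le_1)
    have step: "(CLINT \<omega>|M. iexp (a * \<xi> j \<omega>) * W \<omega>) = (CLINT \<omega>|M. iexp (a * \<xi> j \<omega>)) * w" for a
    proof -
      have s1: "(\<Sum>k\<in>J - K. (c(j := a)) k * \<xi> k \<omega>) = a * \<xi> j \<omega> + (\<Sum>k\<in>J - insert j K. c k * \<xi> k \<omega>)" for \<omega>
        unfolding JK(1) using JK(2,3) by (subst sum.insert) (auto intro!: sum.cong)
      have s2: "(\<Sum>k\<in>J - K. ((c(j := a)) k)\<^sup>2) = a\<^sup>2 + (\<Sum>k\<in>J - insert j K. (c k)\<^sup>2)"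
        unfolding JK(1) using JK(2,3) by (subst sum.insert) (auto intro!: sum.cong)
      have "(CLINT \<omega>|M. iexp (a * \<xi> j \<omega>) * W \<omega>) =
          (CLINT \<omega>|M. iexp ((\<Sum>k\<in>J - K. (c(j := a)) k * \<xi> k \<omega>) + s * T \<omega>) * (\<Prod>k\<in>K. f k (\<xi> k \<omega>)))"
        unfolding s1 W_def by (intro Bochner_Integration.integral_cong refl) (simp add: exp_add[symmetric] distrib_left add.assoc)
      also have "\<dots> = of_real (exp (- ((a\<^sup>2 + (\<Sum>k\<in>J - insert j K. (c k)\<^sup>2)) + s\<^sup>2 * q) / 2)) * (\<Prod>k\<in>K. (CLINT x|std_normal_distribution. f k x))"
        unfolding s2[symmetric] by (rule insert.IH[OF j(3)])
      also have "\<dots> = of_real (exp (- (1 * a\<^sup>2) / 2)) * w"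
        unfolding w_def mult.assoc[symmetric] of_real_mult[symmetric] exp_add[symmetric]
        by (simp add: add_divide_distrib diff_divide_distrib)
      also have "of_real (exp (- (1 * a\<^sup>2) / 2)) = (CLINT \<omega>|M. iexp (a * \<xi> j \<omega>))"
        using gj unfolding gaussian_rv_def by metis
      finally show ?thesis .
    qed
    have "(CLINT \<omega>|M. f j (\<xi> j \<omega>) * W \<omega>) = (CLINT \<omega>|M. f j (\<xi> j \<omega>)) * w"
      by (rule decouple[where B=1 and D=1]) (use W1 f1 step in auto)
    also have "(CLINT \<omega>|M. f j (\<xi> j \<omega>)) = (CLINT x|std_normal_distribution. f j x)"
      by (rule std_gaussian_expectation(1)[OF gj f])
    finally show ?case
      unfolding W_def w_def using insert.hyps by (simp add: mult_ac)
  qed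
qed

text \<open>The character of the linear part is kept exact, and only the residual is expanded, since
  \<open>a\<close> is not small. There is no mixed term of second order because the
  residual is orthogonal to the constants and to the identity; this is what makes the
  limiting variances add up.\<close>

lemma residual_factor_bound:
  assumes \<theta>: "\<bar>\<theta>\<bar> \<le> 1"
  shows "norm ((CLINT x|std_normal_distribution. iexp (\<theta> * (a * x + resid z x))) - of_real (exp (- (\<theta>\<^sup>2 * (a\<^sup>2 + rvar z)) / 2)))
    \<le> 4 * K3 * \<bar>\<theta>\<bar> ^ 3 * (1 + a\<^sup>2)"
proof -
  interpret N: prob_space std_normal_distribution by (rule std_normal_prob_space)
  let ?N = "std_normal_distribution"
  let ?X = "\<lambda>x. \<theta> * a * x" and ?R = "\<lambda>x. \<theta> * resid z x"
  (* Second order expansion in the residual, in which the coefficient exp (i X) of R is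
     expanded to first order and that of R^2 to order zero. *)
  define h where "h x = iexp (?X x) + \<i> * of_real (?R x) - of_real (?X x * ?R x) - of_real ((?R x)\<^sup>2 / 2)" for x
  have pt: "norm (iexp (\<theta> * (a * x + resid z x)) - h x) \<le> 3 * \<bar>\<theta>\<bar> ^ 3 * (1 + a\<^sup>2) * (1 + \<bar>x\<bar>) ^ 3" for x
  proof -
    define X R y where "X = ?X x" and "R = ?R x" and "y = 1 + \<bar>x\<bar>"
    have y: "y \<ge> 0" by (simp add: y_def)
    have R: "\<bar>R\<bar> \<le> \<bar>\<theta>\<bar> * y" unfolding R_def abs_mult y_def by (intro mult_left_mono abs_resid_le) auto
    have X: "\<bar>X\<bar> \<le> \<bar>\<theta>\<bar> * \<bar>a\<bar> * y" unfolding X_def abs_mult y_def by (intro mult_left_mono) auto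
    have e1: "norm (iexp R - (1 + \<i> * of_real R - of_real (R\<^sup>2 / 2))) \<le> \<bar>R\<bar> ^ 3"
    proof -
      have "norm (iexp R - (\<Sum>k\<le>2. (\<i> * of_real R) ^ k / fact k)) \<le> \<bar>R\<bar> ^ Suc 2 / fact (Suc 2)"
        by (rule iexp_approx1)
      also have "(\<Sum>k\<le>2. (\<i> * of_real R) ^ k / fact k) = 1 + \<i> * of_real R - of_real (R\<^sup>2 / 2)"
      proof -
        have "(\<Sum>k\<le>(2::nat). c k) = c 0 + c 1 + c 2" for c :: "nat \<Rightarrow> complex"
          by (simp add: numeral_2_eq_2)
        then show ?thesis by (simp add: power_mult_distrib)
      qed
      also have "\<bar>R\<bar> ^ Suc 2 / fact (Suc 2) = \<bar>R\<bar> ^ 3 / 6"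
        by (simp add: fact_numeral numeral_3_eq_3 numeral_2_eq_2)
      also have "\<dots> \<le> \<bar>R\<bar> ^ 3" by simp
      finally show ?thesis .
    qed
    have e2: "norm (iexp X - (1 + \<i> * of_real X)) \<le> X\<^sup>2"
    proof -
      have "norm (iexp X - (\<Sum>k\<le>1. (\<i> * of_real X) ^ k / fact k)) \<le> \<bar>X\<bar> ^ Suc 1 / fact (Suc 1)"
        by (rule iexp_approx1)
      then have "norm (iexp X - (1 + \<i> * of_real X)) \<le> X\<^sup>2 / 2" by (simp add: power2_eq_square)
      also have "\<dots> \<le> X\<^sup>2" by simp
      finally show ?thesis .
    qed
    have e3: "norm (iexp X - 1) \<le> \<bar>X\<bar>"
      using iexp_approx1[of X 0] by simp
    have "iexp (\<theta> * (a * x + resid z x)) = iexp X * iexp R"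
      by (simp add: X_def R_def exp_add[symmetric] algebra_simps)
    then have "iexp (\<theta> * (a * x + resid z x)) - h x =
        iexp X * (iexp R - (1 + \<i> * of_real R - of_real (R\<^sup>2 / 2)))
        + \<i> * of_real R * (iexp X - (1 + \<i> * of_real X)) - of_real (R\<^sup>2 / 2) * (iexp X - 1)"
    proof -
      define Q :: complex where "Q = of_real (R\<^sup>2 / 2)"
      assume eq: "iexp (\<theta> * (a * x + resid z x)) = iexp X * iexp R"
      show ?thesis
        unfolding eq h_def X_def[symmetric] R_def[symmetric] Q_def[symmetric] by (simp add: algebra_simps)
    qed
    also have "norm \<dots> \<le> norm (iexp X * (iexp R - (1 + \<i> * of_real R - of_real (R\<^sup>2 / 2))))
        + norm (\<i> * of_real R * (iexp X - (1 + \<i> * of_real X))) + norm (of_real (R\<^sup>2 / 2) * (iexp X - 1))"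
      by (rule order_trans[OF norm_triangle_ineq4 add_right_mono[OF norm_triangle_ineq]])
    also have "\<dots> \<le> \<bar>R\<bar> ^ 3 + \<bar>R\<bar> * X\<^sup>2 + R\<^sup>2 * \<bar>X\<bar>"
    proof (intro add_mono)
      show "norm (iexp X * (iexp R - (1 + \<i> * of_real R - of_real (R\<^sup>2 / 2)))) \<le> \<bar>R\<bar> ^ 3"
        unfolding norm_mult using e1 by simp
      show "norm (\<i> * of_real R * (iexp X - (1 + \<i> * of_real X))) \<le> \<bar>R\<bar> * X\<^sup>2"
        unfolding norm_mult using mult_left_mono[OF e2, of "\<bar>R\<bar>"] by simp
      have "norm (complex_of_real (R\<^sup>2 / 2)) \<le> R\<^sup>2" unfolding norm_of_real by simp
      then show "norm (of_real (R\<^sup>2 / 2) * (iexp X - 1)) \<le> R\<^sup>2 * \<bar>X\<bar>"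
        unfolding norm_mult using e3 by (intro mult_mono) auto
    qed
    also have "\<dots> \<le> \<bar>\<theta>\<bar> ^ 3 * y ^ 3 * 1 + \<bar>\<theta>\<bar> ^ 3 * y ^ 3 * a\<^sup>2 + \<bar>\<theta>\<bar> ^ 3 * y ^ 3 * \<bar>a\<bar>"
    proof (intro add_mono)
      show "\<bar>R\<bar> ^ 3 \<le> \<bar>\<theta>\<bar> ^ 3 * y ^ 3 * 1" using power_mono[OF R, of 3] by (simp add: power_mult_distrib)
      have "\<bar>R\<bar> * \<bar>X\<bar>\<^sup>2 \<le> (\<bar>\<theta>\<bar> * y) * (\<bar>\<theta>\<bar> * \<bar>a\<bar> * y)\<^sup>2"
        using y by (intro mult_mono R power_mono X) auto
      also have "\<dots> = \<bar>\<theta>\<bar> ^ 3 * y ^ 3 * \<bar>a\<bar>\<^sup>2" by (simp only: power_mult_distrib power2_eq_square power3_eq_cube mult_ac)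
      finally show "\<bar>R\<bar> * X\<^sup>2 \<le> \<bar>\<theta>\<bar> ^ 3 * y ^ 3 * a\<^sup>2" by simp
      have "\<bar>R\<bar>\<^sup>2 * \<bar>X\<bar> \<le> (\<bar>\<theta>\<bar> * y)\<^sup>2 * (\<bar>\<theta>\<bar> * \<bar>a\<bar> * y)"
        using y by (intro mult_mono R power_mono X) auto
      also have "\<dots> = \<bar>\<theta>\<bar> ^ 3 * y ^ 3 * \<bar>a\<bar>" by (simp only: power_mult_distrib power2_eq_square power3_eq_cube mult_ac)
      finally show "R\<^sup>2 * \<bar>X\<bar> \<le> \<bar>\<theta>\<bar> ^ 3 * y ^ 3 * \<bar>a\<bar>" by simp
    qed
    also have "\<dots> = \<bar>\<theta>\<bar> ^ 3 * y ^ 3 * (1 + a\<^sup>2 + \<bar>a\<bar>)" by (simp add: distrib_left)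
    also have "\<dots> \<le> \<bar>\<theta>\<bar> ^ 3 * y ^ 3 * (3 * (1 + a\<^sup>2))"
    proof (rule mult_left_mono)
      have "2 * \<bar>a\<bar> \<le> 1 + a\<^sup>2" using sum_squares_bound[of 1 "\<bar>a\<bar>"] by simp
      moreover have "0 \<le> a\<^sup>2" by simp
      moreover have "2 * c \<le> 1 + b \<Longrightarrow> 0 \<le> b \<Longrightarrow> 1 + b + c \<le> 3 * (1 + b)" for b c :: real by simp
      ultimately show "1 + a\<^sup>2 + \<bar>a\<bar> \<le> 3 * (1 + a\<^sup>2)" by blast
    qed (use y in auto)
    finally show ?thesis unfolding y_def by (simp only: mult_ac)
  qed
  have i1: "complex_integrable ?N (\<lambda>x. iexp (\<theta> * (a * x + resid z x)))" by (rule N.integrable_bounded[where B=1]) auto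
  have i2: "complex_integrable ?N (\<lambda>x. iexp (?X x))" by (rule N.integrable_bounded[where B=1]) auto
  note ir = integrable_std_normal_resid[of z]
  have i3: "complex_integrable ?N (\<lambda>x. \<i> * of_real (?R x))"
    using ir(1) by (intro integrable_mult_right integrable_of_real)
  have eX: "?X x * ?R x = (\<theta> * a * \<theta>) * (resid z x * x)" for x by simp
  have i4: "complex_integrable ?N (\<lambda>x. of_real (?X x * ?R x))"
    unfolding eX using ir(2) by (intro integrable_mult_right integrable_of_real)
  have eR: "(?R x)\<^sup>2 / 2 = (\<theta>\<^sup>2 / 2) * (resid z x)\<^sup>2" for x by (simp add: power_mult_distrib)
  have i5: "complex_integrable ?N (\<lambda>x. of_real ((?R x)\<^sup>2 / 2))"
    unfolding eR using ir(3) by (intro integrable_mult_right integrable_of_real)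
  have ih: "complex_integrable ?N h"
    unfolding h_def[abs_def]
    by (intro Bochner_Integration.integrable_diff Bochner_Integration.integrable_add i2 i3 i4 i5)
  define A B where "A = \<theta>\<^sup>2 * a\<^sup>2 / 2" and "B = \<theta>\<^sup>2 * rvar z / 2"
  have "(CLINT x|?N. iexp (?X x)) = of_real (exp (- A))"
    using fun_cong[OF char_std_normal_distribution, of "\<theta> * a"] unfolding char_def
    by (simp add: A_def power_mult_distrib)
  moreover have "(CLINT x|?N. \<i> * of_real (?R x)) = 0"
    by (simp only: integral_mult_right_zero integral_complex_of_real integral_std_normal_resid) simp
  moreover have "(CLINT x|?N. of_real (?X x * ?R x)) = 0"
    unfolding eX by (simp only: integral_mult_right_zero integral_complex_of_real integral_std_normal_resid_id) simp
  moreover have "(CLINT x|?N. of_real ((?R x)\<^sup>2 / 2)) = of_real B"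
    unfolding eR by (simp only: integral_mult_right_zero integral_complex_of_real integral_std_normal_resid_square) (simp add: B_def)
  ultimately have Eh: "(CLINT x|?N. h x) = of_real (exp (- A) - B)"
    unfolding h_def using i2 i3 i4 i5
    by (simp only: Bochner_Integration.integral_diff Bochner_Integration.integral_add Bochner_Integration.integrable_diff Bochner_Integration.integrable_add) simp
  have 1: "norm ((CLINT x|?N. iexp (\<theta> * (a * x + resid z x))) - of_real (exp (- A) - B)) \<le> 3 * \<bar>\<theta>\<bar> ^ 3 * (1 + a\<^sup>2) * K3"
  proof -
    have eq: "(CLINT x|?N. iexp (\<theta> * (a * x + resid z x))) - of_real (exp (- A) - B) = (CLINT x|?N. iexp (\<theta> * (a * x + resid z x)) - h x)"
      unfolding Eh[symmetric] by (rule Bochner_Integration.integral_diff[OF i1 ih, symmetric])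
    have "norm (CLINT x|?N. iexp (\<theta> * (a * x + resid z x)) - h x) \<le> (\<integral>x. 3 * \<bar>\<theta>\<bar> ^ 3 * (1 + a\<^sup>2) * (1 + \<bar>x\<bar>) ^ 3 \<partial>?N)"
      by (rule Bochner_Integration.integral_norm_bound_integral[OF Bochner_Integration.integrable_diff[OF i1 ih]])
         (intro integrable_mult_right integrable_std_normal_abs_power, rule pt)
    moreover have "(\<integral>x. 3 * \<bar>\<theta>\<bar> ^ 3 * (1 + a\<^sup>2) * (1 + \<bar>x\<bar>) ^ 3 \<partial>?N) = 3 * \<bar>\<theta>\<bar> ^ 3 * (1 + a\<^sup>2) * K3"
      unfolding K3_def by (rule integral_mult_right_zero)
    ultimately show ?thesis unfolding eq by (simp only:)
  qed
  have A0: "A \<ge> 0" by (simp add: A_def)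
  have B0: "B \<ge> 0" using rvar_pos[of z] by (simp add: B_def)
  have \<theta>2: "\<theta>\<^sup>2 = \<bar>\<theta>\<bar> * \<bar>\<theta>\<bar>" by (simp add: power2_eq_square)
  have t2: "\<theta>\<^sup>2 \<le> \<bar>\<theta>\<bar>" unfolding \<theta>2 using \<theta> mult_left_mono[of "\<bar>\<theta>\<bar>" 1 "\<bar>\<theta>\<bar>"] by simp
  have B1: "B \<le> \<theta>\<^sup>2"
  proof -
    have "\<theta>\<^sup>2 * rvar z \<le> \<theta>\<^sup>2 * 1" using rvar_le_1 by (intro mult_left_mono) auto
    moreover have "0 \<le> \<theta>\<^sup>2" by simp
    ultimately show ?thesis unfolding B_def by linarith
  qed
  have q1: "exp (- B) \<le> 1 - B + B\<^sup>2"
  proof -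
    have "exp (- B) \<le> 1 / (1 + B)"
      using exp_ge_add_one_self[of B] B0 by (simp add: exp_minus inverse_eq_divide frac_le)
    also have "\<dots> \<le> 1 - B + B\<^sup>2"
    proof -
      have "(1 - B + B\<^sup>2) * (1 + B) = 1 + B ^ 3" by (simp add: algebra_simps power2_eq_square power3_eq_cube)
      then show ?thesis using B0 by (simp add: pos_divide_le_eq)
    qed
    finally show ?thesis .
  qed
  have q2: "1 - B \<le> exp (- B)" using exp_ge_add_one_self[of "- B"] by simp
  have q3: "1 - A \<le> exp (- A)" using exp_ge_add_one_self[of "- A"] by simp
  have "exp (- (A + B)) = exp (- A) * exp (- B)" by (simp add: exp_add[symmetric])
  then have decAB: "exp (- (A + B)) - (exp (- A) - B) = exp (- A) * (exp (- B) - 1 + B) + B * (1 - exp (- A))"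
    by (simp add: algebra_simps)
  have "exp (- A) * (exp (- B) - 1 + B) \<le> 1 * B\<^sup>2"
    using q1 q2 A0 by (intro mult_mono) auto
  moreover have "B * (1 - exp (- A)) \<le> B * A" using q3 B0 by (intro mult_left_mono) auto
  moreover have "0 \<le> exp (- A) * (exp (- B) - 1 + B)" using q2 by simp
  moreover have "0 \<le> B * (1 - exp (- A))" using A0 B0 by simp
  ultimately have "\<bar>exp (- A) * (exp (- B) - 1 + B) + B * (1 - exp (- A))\<bar> \<le> 1 * B\<^sup>2 + B * A"
    by linarith
  also have "\<dots> = B * (B + A)" by (simp add: power2_eq_square distrib_left)
  also have "\<dots> \<le> \<theta>\<^sup>2 * (\<bar>\<theta>\<bar> * (1 + a\<^sup>2))"
  proof (intro mult_mono B1)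
    have "\<theta>\<^sup>2 * a\<^sup>2 \<le> \<bar>\<theta>\<bar> * a\<^sup>2" using t2 by (intro mult_right_mono) auto
    moreover have "0 \<le> \<bar>\<theta>\<bar> * a\<^sup>2" by simp
    ultimately have "A \<le> \<bar>\<theta>\<bar> * a\<^sup>2" unfolding A_def by linarith
    moreover have "B \<le> \<bar>\<theta>\<bar>" using B1 t2 by simp
    ultimately show "B + A \<le> \<bar>\<theta>\<bar> * (1 + a\<^sup>2)" by (simp add: distrib_left)
  qed (use A0 B0 in auto)
  also have "\<dots> = \<bar>\<theta>\<bar> ^ 3 * (1 + a\<^sup>2)" unfolding \<theta>2 by (simp add: power3_eq_cube)
  also have "\<dots> \<le> \<bar>\<theta>\<bar> ^ 3 * (1 + a\<^sup>2) * K3" 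
    using K3_ge_1 mult_left_mono[of 1 K3 "\<bar>\<theta>\<bar> ^ 3 * (1 + a\<^sup>2)"] by simp
  finally have 2: "\<bar>exp (- (A + B)) - (exp (- A) - B)\<bar> \<le> \<bar>\<theta>\<bar> ^ 3 * (1 + a\<^sup>2) * K3" unfolding decAB .
  have AB: "exp (- (\<theta>\<^sup>2 * (a\<^sup>2 + rvar z)) / 2) = exp (- (A + B))" by (simp add: A_def B_def distrib_left add_divide_distrib diff_divide_distrib)
  let ?E = "CLINT x|?N. iexp (\<theta> * (a * x + resid z x))"
  have "norm (?E - of_real (exp (- (A + B)))) = norm ((?E - of_real (exp (- A) - B)) - of_real (exp (- (A + B)) - (exp (- A) - B)))"
    by simp
  also have "\<dots> \<le> norm (?E - of_real (exp (- A) - B)) + norm (complex_of_real (exp (- (A + B)) - (exp (- A) - B)))"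
    by (rule norm_triangle_ineq4)
  also have "\<dots> \<le> 3 * \<bar>\<theta>\<bar> ^ 3 * (1 + a\<^sup>2) * K3 + \<bar>\<theta>\<bar> ^ 3 * (1 + a\<^sup>2) * K3"
    using 1 2 by (intro add_mono) (simp_all only: norm_of_real)
  finally show ?thesis unfolding AB by (simp add: mult_ac)
qed

section \<open>Sums of functions of a weakly correlated Gaussian vector\<close>

lemma (in prob_space) second_moment_sum_bound:
  fixes X :: "'i \<Rightarrow> 'a \<Rightarrow> real"
  assumes fin: "finite J" and [measurable]: "\<And>i. i \<in> J \<Longrightarrow> X i \<in> borel_measurable M"
    and int: "\<And>i. i \<in> J \<Longrightarrow> integrable M (\<lambda>\<omega>. (X i \<omega>)\<^sup>2)"
    and diag: "\<And>i. i \<in> J \<Longrightarrow> expectation (\<lambda>\<omega>. (X i \<omega>)\<^sup>2) \<le> v i"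
    and off: "\<And>i j. i \<in> J \<Longrightarrow> j \<in> J \<Longrightarrow> i \<noteq> j \<Longrightarrow> expectation (\<lambda>\<omega>. X i \<omega> * X j \<omega>) \<le> c i j"
  shows "integrable M (\<lambda>\<omega>. (\<Sum>i\<in>J. X i \<omega>)\<^sup>2)"
    and "expectation (\<lambda>\<omega>. (\<Sum>i\<in>J. X i \<omega>)\<^sup>2) \<le> (\<Sum>i\<in>J. v i) + (\<Sum>i\<in>J. \<Sum>j\<in>J - {i}. c i j)"
proof -
  have ii: "integrable M (\<lambda>\<omega>. X i \<omega> * X j \<omega>)" if "i \<in> J" "j \<in> J" for i j
    by (rule integrable_mult_L2) (use that int in auto)
  have sq: "(\<Sum>i\<in>J. X i \<omega>)\<^sup>2 = (\<Sum>i\<in>J. \<Sum>j\<in>J. X i \<omega> * X j \<omega>)" for \<omega>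
    by (simp add: power2_eq_square sum_product)
  show "integrable M (\<lambda>\<omega>. (\<Sum>i\<in>J. X i \<omega>)\<^sup>2)"
    unfolding sq by (intro Bochner_Integration.integrable_sum ii)
  have "expectation (\<lambda>\<omega>. (\<Sum>i\<in>J. X i \<omega>)\<^sup>2) = (\<Sum>i\<in>J. expectation (\<lambda>\<omega>. \<Sum>j\<in>J. X i \<omega> * X j \<omega>))"
    unfolding sq by (rule Bochner_Integration.integral_sum) (intro Bochner_Integration.integrable_sum ii)
  also have "\<dots> = (\<Sum>i\<in>J. \<Sum>j\<in>J. expectation (\<lambda>\<omega>. X i \<omega> * X j \<omega>))"
    by (intro sum.cong refl Bochner_Integration.integral_sum ii)
  also have "\<dots> \<le> (\<Sum>i\<in>J. v i + (\<Sum>j\<in>J - {i}. c i j))"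
  proof (rule sum_mono)
    fix i assume i: "i \<in> J"
    have "(\<Sum>j\<in>J. expectation (\<lambda>\<omega>. X i \<omega> * X j \<omega>)) =
        expectation (\<lambda>\<omega>. X i \<omega> * X i \<omega>) + (\<Sum>j\<in>J - {i}. expectation (\<lambda>\<omega>. X i \<omega> * X j \<omega>))"
      by (rule sum.remove[OF fin i])
    also have "\<dots> \<le> v i + (\<Sum>j\<in>J - {i}. c i j)"
    proof (rule add_mono)
      show "expectation (\<lambda>\<omega>. X i \<omega> * X i \<omega>) \<le> v i" using diag[OF i] by (simp add: power2_eq_square)
      show "(\<Sum>j\<in>J - {i}. expectation (\<lambda>\<omega>. X i \<omega> * X j \<omega>)) \<le> (\<Sum>j\<in>J - {i}. c i j)"
        using off[OF i] by (intro sum_mono) auto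
    qed
    finally show "(\<Sum>j\<in>J. expectation (\<lambda>\<omega>. X i \<omega> * X j \<omega>)) \<le> v i + (\<Sum>j\<in>J - {i}. c i j)" .
  qed
  finally show "expectation (\<lambda>\<omega>. (\<Sum>i\<in>J. X i \<omega>)\<^sup>2) \<le> (\<Sum>i\<in>J. v i) + (\<Sum>i\<in>J. \<Sum>j\<in>J - {i}. c i j)"
    by (simp add: sum.distrib)
qed

lemma (in prob_space) expectation_abs_le_sqrt:
  fixes X :: "'a \<Rightarrow> real"
  assumes [measurable]: "X \<in> borel_measurable M" and int: "integrable M (\<lambda>\<omega>. (X \<omega>)\<^sup>2)"
  shows "integrable M X" "expectation (\<lambda>\<omega>. \<bar>X \<omega>\<bar>) \<le> sqrt (expectation (\<lambda>\<omega>. (X \<omega>)\<^sup>2))"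
proof -
  show i: "integrable M X" by (rule square_integrable_imp_integrable[OF _ int]) simp
  have "0 \<le> variance (\<lambda>\<omega>. \<bar>X \<omega>\<bar>)" by simp
  also have "\<dots> = expectation (\<lambda>\<omega>. \<bar>X \<omega>\<bar>\<^sup>2) - (expectation (\<lambda>\<omega>. \<bar>X \<omega>\<bar>))\<^sup>2"
    by (rule variance_eq) (use i int in auto)
  finally show "expectation (\<lambda>\<omega>. \<bar>X \<omega>\<bar>) \<le> sqrt (expectation (\<lambda>\<omega>. (X \<omega>)\<^sup>2))"
    by (intro real_le_rsqrt) simp
qed

text \<open>The square of the difference of two indicators is an indicator, so its expectation is
  \<open>\<bar>Phi z - Phi w\<bar>\<close>; centring only decreases the second moment.\<close>

lemma (in prob_space) resid_difference_second_moment: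
  assumes U: "gaussian_rv M U 1"
  shows "expectation (\<lambda>\<omega>. (resid z (U \<omega>) - resid w (U \<omega>))\<^sup>2)
    \<le> 2 * \<bar>Phi z - Phi w\<bar> + 2 * (std_normal_density z - std_normal_density w)\<^sup>2"
proof -
  have [measurable]: "U \<in> borel_measurable M" using U by (simp add: gaussian_rv_def)
  note mom = gaussian_rv_moments[OF U]
  define d where "d \<omega> = (of_bool (z \<le> U \<omega>) - of_bool (w \<le> U \<omega>) :: real)" for \<omega>
  have [measurable]: "d \<in> borel_measurable M" unfolding d_def of_bool_def by measurable
  have dB: "\<bar>d \<omega>\<bar> \<le> 1" for \<omega> by (simp add: d_def of_bool_def)
  have intb: "integrable M (\<lambda>\<omega>. of_bool (y \<le> U \<omega>) :: real)" for y
    by (rule integrable_bounded[where B=1]) (auto simp: of_bool_def)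
  have Eb: "expectation (\<lambda>\<omega>. of_bool (y \<le> U \<omega>) :: real) = Phi y" for y
    using std_gaussian_expectation(1)[OF U, of "\<lambda>x. of_bool (y \<le> x) :: real"]
    by (simp add: integral_std_normal_indicator)
  have Ed: "expectation d = Phi z - Phi w" unfolding d_def using intb by (simp add: Eb)
  have intd: "integrable M d" by (rule integrable_bounded[where B=1]) (use dB in auto)
  have intd2: "integrable M (\<lambda>\<omega>. (d \<omega>)\<^sup>2)"
    by (rule integrable_bounded[where B=1]) (use dB in \<open>auto simp: abs_square_le_1\<close>)
  have d2: "expectation (\<lambda>\<omega>. (d \<omega>)\<^sup>2) = \<bar>Phi z - Phi w\<bar>"
  proof (cases "z \<le> w")
    case True
    then have "(d \<omega>)\<^sup>2 = d \<omega>" for \<omega> by (auto simp: d_def)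
    moreover have "Phi w \<le> Phi z" using True Phi_strict_antimono[of z w] by (cases "z = w") auto
    ultimately show ?thesis using Ed by simp
  next
    case False
    then have "(d \<omega>)\<^sup>2 = - d \<omega>" for \<omega> by (auto simp: d_def)
    moreover have "Phi z \<le> Phi w" using False Phi_strict_antimono[of w z] by auto
    ultimately show ?thesis using Ed by simp
  qed
  define p e where "p = Phi z - Phi w" and "e = std_normal_density z - std_normal_density w"
  have dec: "resid z (U \<omega>) - resid w (U \<omega>) = (d \<omega> - p) - e * U \<omega>" for \<omega>
    by (simp add: resid_def d_def p_def e_def algebra_simps)
  have var: "expectation (\<lambda>\<omega>. (d \<omega> - p)\<^sup>2) \<le> \<bar>p\<bar>"
  proof -
    have "expectation (\<lambda>\<omega>. (d \<omega> - p)\<^sup>2) = variance d" by (simp add: Ed p_def)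
    also have "\<dots> = \<bar>p\<bar> - p\<^sup>2" using variance_eq[OF intd intd2] by (simp add: d2 Ed p_def)
    finally show ?thesis by simp
  qed
  have int1: "integrable M (\<lambda>\<omega>. (d \<omega> - p)\<^sup>2)"
    unfolding power2_diff using intd intd2 by auto
  have "expectation (\<lambda>\<omega>. (resid z (U \<omega>) - resid w (U \<omega>))\<^sup>2) \<le> expectation (\<lambda>\<omega>. 2 * (d \<omega> - p)\<^sup>2 + 2 * e\<^sup>2 * (U \<omega>)\<^sup>2)"
  proof (rule integral_mono')
    show "integrable M (\<lambda>\<omega>. 2 * (d \<omega> - p)\<^sup>2 + 2 * e\<^sup>2 * (U \<omega>)\<^sup>2)"
      by (intro Bochner_Integration.integrable_add integrable_mult_right int1 mom(2))
    fix \<omega>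
    have "(x - y)\<^sup>2 \<le> 2 * x\<^sup>2 + 2 * y\<^sup>2" for x y :: real
      using zero_le_power2[of "x + y"] by (simp add: power2_eq_square algebra_simps)
    from this[of "d \<omega> - p" "e * U \<omega>"]
    show "(resid z (U \<omega>) - resid w (U \<omega>))\<^sup>2 \<le> 2 * (d \<omega> - p)\<^sup>2 + 2 * e\<^sup>2 * (U \<omega>)\<^sup>2"
      unfolding dec by (simp add: power_mult_distrib)
  qed simp
  also have "\<dots> = 2 * expectation (\<lambda>\<omega>. (d \<omega> - p)\<^sup>2) + 2 * e\<^sup>2"
    using int1 mom(2) by (subst Bochner_Integration.integral_add) (auto simp: mom(3))
  also have "\<dots> \<le> 2 * \<bar>p\<bar> + 2 * e\<^sup>2" using var by simp
  finally show ?thesis unfolding p_def e_def .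
qed

text \<open>The form in which Gaussian vectors are used: every linear combination is Gaussian with
  the variance given by \<open>\<Gamma>\<close>. In particular \<open>\<Gamma>\<close> is
  positive semidefinite.\<close>

locale gaussian_family = prob_space M for M :: "'a measure" +
  fixes I :: "'i set" and Y :: "'i \<Rightarrow> 'a \<Rightarrow> real" and \<Gamma> :: "'i \<Rightarrow> 'i \<Rightarrow> real"
  assumes finite_I: "finite I"
    and measurable_Y: "\<And>i. i \<in> I \<Longrightarrow> Y i \<in> borel_measurable M"
    and \<Gamma>_sym: "\<And>i j. i \<in> I \<Longrightarrow> j \<in> I \<Longrightarrow> \<Gamma> i j = \<Gamma> j i"
    and \<Gamma>_diag: "\<And>i. i \<in> I \<Longrightarrow> \<Gamma> i i = 1"
    and gaussian_Y: "\<And>b. gaussian_rv M (\<lambda>\<omega>. \<Sum>i\<in>I. b i * Y i \<omega>) (ip I b (mv I \<Gamma> b))"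
begin

definition E2 :: real where "E2 = (\<Sum>i\<in>I. \<Sum>j\<in>I - {i}. (\<Gamma> i j)\<^sup>2)"

text \<open>\<open>V J\<close> is the variance of the sum of the \<open>Y i\<close> over \<open>J\<close>.\<close>

definition V :: "'i set \<Rightarrow> real" where "V J = (\<Sum>i\<in>J. \<Sum>j\<in>J. \<Gamma> i j)"

text \<open>A p-value \<open>Phi (Y i)\<close> is at most \<open>t\<close> exactly if \<open>Y i
  \<ge> Phi_inv t\<close>, so that \<open>D J (Phi_inv t)\<close> is the centred number of
  p-values up to \<open>t\<close>.\<close>

definition D :: "'i set \<Rightarrow> real \<Rightarrow> 'a \<Rightarrow> real" where
  "D J z \<omega> = (\<Sum>i\<in>J. of_bool (z \<le> Y i \<omega>) - Phi z)"

lemma E2_nonneg: "E2 \<ge> 0" unfolding E2_def by (intro sum_nonneg) auto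

lemma E2_subset:
  assumes "J \<subseteq> I"
  shows "(\<Sum>i\<in>J. \<Sum>j\<in>J - {i}. (\<Gamma> i j)\<^sup>2) \<le> E2"
proof -
  have "(\<Sum>i\<in>J. \<Sum>j\<in>J - {i}. (\<Gamma> i j)\<^sup>2) \<le> (\<Sum>i\<in>J. \<Sum>j\<in>I - {i}. (\<Gamma> i j)\<^sup>2)"
    using assms finite_I by (intro sum_mono sum_mono2) auto
  also have "\<dots> \<le> E2"
    unfolding E2_def using assms finite_I by (intro sum_mono2) (auto intro: sum_nonneg)
  finally show ?thesis .
qed

lemma ip_delta_mv:
  assumes "i \<in> I"
  shows "ip I (delta i) x = x i" "mv I \<Gamma> (delta j) i = (if j \<in> I then \<Gamma> i j else 0)"
  using finite_I assms
  by (auto simp: ip_def mv_def delta_def if_distrib[of "\<lambda>y. y * _"] if_distrib[of "\<lambda>y. _ * y"] cong: if_cong)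

lemma std_pair_Y:
  assumes ij: "i \<in> I" "j \<in> I"
  shows "std_pair M (Y i) (Y j) (\<Gamma> i j)"
  unfolding std_pair_def
proof (intro conjI allI measurable_Y ij)
  fix a b
  let ?b = "\<lambda>k. a * delta i k + b * delta j k"
  have "(\<Sum>k\<in>I. delta i k * Y k \<omega>) = Y i \<omega>" if "i \<in> I" for i \<omega>
    using ip_delta_mv(1)[OF that, of "\<lambda>k. Y k \<omega>"] by (simp add: ip_def)
  then have s: "(\<Sum>k\<in>I. ?b k * Y k \<omega>) = a * Y i \<omega> + b * Y j \<omega>" for \<omega>
    using ij by (simp add: distrib_right sum.distrib mult.assoc sum_distrib_left[symmetric])
  have "ip I ?b (mv I \<Gamma> ?b) = a * mv I \<Gamma> ?b i + b * mv I \<Gamma> ?b j"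
    by (simp only: ip_linear ip_delta_mv ij)
  also have "\<dots> = a\<^sup>2 + 2 * \<Gamma> i j * a * b + b\<^sup>2"
    unfolding mv_add mv_scale using ip_delta_mv(2)[OF ij(1)] ip_delta_mv(2)[OF ij(2)] ij \<Gamma>_sym[OF ij] \<Gamma>_diag
    by (simp add: algebra_simps power2_eq_square)
  finally have q: "ip I ?b (mv I \<Gamma> ?b) = a\<^sup>2 + 2 * \<Gamma> i j * a * b + b\<^sup>2" .
  have "(CLINT \<omega>|M. iexp (1 * (\<Sum>k\<in>I. ?b k * Y k \<omega>))) = of_real (exp (- (ip I ?b (mv I \<Gamma> ?b) * 1\<^sup>2) / 2))"
    using gaussian_Y[of ?b] unfolding gaussian_rv_def by blast
  then show "(CLINT \<omega>|M. iexp (a * Y i \<omega> + b * Y j \<omega>)) = of_real (exp (- (a\<^sup>2 + 2 * \<Gamma> i j * a * b + b\<^sup>2) / 2))"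
    unfolding q s by simp
qed

lemma gaussian_Yi: "i \<in> I \<Longrightarrow> gaussian_rv M (Y i) 1"
  using std_pair_marginals(1)[OF std_pair_Y] by blast

lemma gaussian_sum:
  assumes J: "J \<subseteq> I"
  shows "gaussian_rv M (\<lambda>\<omega>. \<Sum>i\<in>J. Y i \<omega>) (V J)"
proof -
  let ?w = "\<lambda>i. of_bool (i \<in> J) :: real"
  have sub: "(\<Sum>i\<in>I. ?w i * f i) = (\<Sum>i\<in>J. f i)" "(\<Sum>i\<in>I. f i * ?w i) = (\<Sum>i\<in>J. f i)" for f :: "'i \<Rightarrow> real"
    using J finite_I by (auto simp: of_bool_def if_distrib[of "\<lambda>y. y * _"] if_distrib[of "\<lambda>y. _ * y"] sum.If_cases Int_absorb1 cong: if_cong)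
  have "ip I ?w (mv I \<Gamma> ?w) = V J" unfolding ip_def mv_def V_def sub ..
  then show ?thesis using gaussian_Y[of ?w] unfolding sub by simp
qed

lemma V_nonneg: "J \<subseteq> I \<Longrightarrow> V J \<ge> 0"
  using gaussian_rv_moments(1)[OF gaussian_sum] .

lemma resid_sum_second_moment:
  assumes J: "J \<subseteq> I" and z: "\<bar>z\<bar> \<le> B"
  shows "integrable M (\<lambda>\<omega>. (\<Sum>i\<in>J. resid z (Y i \<omega>))\<^sup>2)"
    and "expectation (\<lambda>\<omega>. (\<Sum>i\<in>J. resid z (Y i \<omega>))\<^sup>2) \<le> card J + 5 * (B + 1)\<^sup>2 * K3 * E2"
proof -
  let ?K = "5 * (B + 1)\<^sup>2 * K3"
  note [measurable] = measurable_Y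
  have fin: "finite J" using J finite_I by (rule finite_subset)
  have JI: "i \<in> I" if "i \<in> J" for i using that J by auto
  note * = second_moment_sum_bound[of J "\<lambda>i \<omega>. resid z (Y i \<omega>)" "\<lambda>_. 1" "\<lambda>i j. ?K * (\<Gamma> i j)\<^sup>2"]
  have m: "(\<lambda>\<omega>. resid z (Y i \<omega>)) \<in> borel_measurable M" if "i \<in> J" for i using JI[OF that] by measurable
  have i2: "integrable M (\<lambda>\<omega>. (resid z (Y i \<omega>))\<^sup>2)" if "i \<in> J" for i
    using resid_integrable(2)[OF gaussian_Yi[OF JI[OF that]]] .
  have d: "expectation (\<lambda>\<omega>. (resid z (Y i \<omega>))\<^sup>2) \<le> 1" if "i \<in> J" for i
    using resid_integrable(4)[OF gaussian_Yi[OF JI[OF that]]] rvar_le_1 by simp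
  have o: "expectation (\<lambda>\<omega>. resid z (Y i \<omega>) * resid z (Y j \<omega>)) \<le> ?K * (\<Gamma> i j)\<^sup>2" if "i \<in> J" "j \<in> J" "i \<noteq> j" for i j
    using resid_covariance_bound[OF std_pair_Y[OF JI JI] z, OF that(1,2), of z] by linarith
  show "integrable M (\<lambda>\<omega>. (\<Sum>i\<in>J. resid z (Y i \<omega>))\<^sup>2)" by (rule *(1)[OF fin m i2 d o])
  have "expectation (\<lambda>\<omega>. (\<Sum>i\<in>J. resid z (Y i \<omega>))\<^sup>2) \<le> (\<Sum>i\<in>J. 1) + (\<Sum>i\<in>J. \<Sum>j\<in>J - {i}. ?K * (\<Gamma> i j)\<^sup>2)"
    by (rule *(2)[OF fin m i2 d o])
  also have "\<dots> = card J + ?K * (\<Sum>i\<in>J. \<Sum>j\<in>J - {i}. (\<Gamma> i j)\<^sup>2)" by (simp add: sum_distrib_left)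
  also have "\<dots> \<le> card J + ?K * E2"
    using E2_subset[OF J] K3_ge_1 by (intro add_left_mono mult_left_mono) auto
  finally show "expectation (\<lambda>\<omega>. (\<Sum>i\<in>J. resid z (Y i \<omega>))\<^sup>2) \<le> card J + ?K * E2" .
qed

lemma D_eq: "D J z \<omega> = (\<Sum>i\<in>J. resid z (Y i \<omega>)) + std_normal_density z * (\<Sum>i\<in>J. Y i \<omega>)"
  by (simp add: D_def resid_def sum_subtractf sum_distrib_left)

lemma measurable_D [measurable]: "J \<subseteq> I \<Longrightarrow> D J z \<in> borel_measurable M"
  unfolding D_def of_bool_def using measurable_Y by (intro borel_measurable_sum borel_measurable_diff measurable_If) auto

lemma power2_sum_le: "(x + y)\<^sup>2 \<le> 2 * x\<^sup>2 + 2 * y\<^sup>2" for x y :: real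
  using zero_le_power2[of "x - y"] by (simp add: power2_eq_square algebra_simps)

text \<open>The residuals and the linear part are estimated separately: strong correlations are
  visible in \<open>V J\<close> only.\<close>

lemma D_second_moment:
  assumes J: "J \<subseteq> I" and z: "\<bar>z\<bar> \<le> B"
  shows "integrable M (\<lambda>\<omega>. (D J z \<omega>)\<^sup>2)"
    and "expectation (\<lambda>\<omega>. (D J z \<omega>)\<^sup>2) \<le> 2 * (card J + 5 * (B + 1)\<^sup>2 * K3 * E2) + 2 * V J"
proof -
  let ?N = "\<lambda>\<omega>. \<Sum>i\<in>J. resid z (Y i \<omega>)" and ?L = "\<lambda>\<omega>. \<Sum>i\<in>J. Y i \<omega>"
  note N = resid_sum_second_moment[OF J z] and L = gaussian_rv_moments[OF gaussian_sum[OF J]]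
  have le: "(D J z \<omega>)\<^sup>2 \<le> 2 * (?N \<omega>)\<^sup>2 + 2 * (?L \<omega>)\<^sup>2" for \<omega>
  proof -
    have "(D J z \<omega>)\<^sup>2 \<le> 2 * (?N \<omega>)\<^sup>2 + 2 * (std_normal_density z * ?L \<omega>)\<^sup>2"
      unfolding D_eq by (rule power2_sum_le)
    moreover have "(std_normal_density z * ?L \<omega>)\<^sup>2 \<le> (?L \<omega>)\<^sup>2"
      unfolding power_mult_distrib using std_normal_density_le_1[of z] std_normal_density_nonneg[of z]
      by (intro mult_left_le_one_le) (auto intro: power_le_one)
    ultimately show ?thesis by linarith
  qed
  have int: "integrable M (\<lambda>\<omega>. 2 * (?N \<omega>)\<^sup>2 + 2 * (?L \<omega>)\<^sup>2)"
    by (intro Bochner_Integration.integrable_add integrable_mult_right N(1) L(2))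
  have [measurable]: "D J z \<in> borel_measurable M" using J by (rule measurable_D)
  show "integrable M (\<lambda>\<omega>. (D J z \<omega>)\<^sup>2)"
    by (rule Bochner_Integration.integrable_bound[OF int]) (use le in \<open>auto intro!: AE_I2\<close>)
  have "expectation (\<lambda>\<omega>. (D J z \<omega>)\<^sup>2) \<le> expectation (\<lambda>\<omega>. 2 * (?N \<omega>)\<^sup>2 + 2 * (?L \<omega>)\<^sup>2)"
    by (rule integral_mono'[OF int le]) simp
  also have "\<dots> = 2 * expectation (\<lambda>\<omega>. (?N \<omega>)\<^sup>2) + 2 * V J"
    by (simp only: Bochner_Integration.integral_add integrable_mult_right N(1) L(2) integral_mult_right_zero L(3))
  also have "\<dots> \<le> 2 * (card J + 5 * (B + 1)\<^sup>2 * K3 * E2) + 2 * V J" using N(2) by simp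
  finally show "expectation (\<lambda>\<omega>. (D J z \<omega>)\<^sup>2) \<le> 2 * (card J + 5 * (B + 1)\<^sup>2 * K3 * E2) + 2 * V J" .
qed

text \<open>The linear part enters with the increment of the density as coefficient, so the bound
  tends to 0 with \<open>w\<close> tending to \<open>z\<close> except for the term
  \<open>E2\<close>, which is negligible.\<close>

lemma D_increment_second_moment:
  assumes J: "J \<subseteq> I" and z: "\<bar>z\<bar> \<le> B" and w: "\<bar>w\<bar> \<le> B"
  defines "e \<equiv> std_normal_density z - std_normal_density w"
  shows "integrable M (\<lambda>\<omega>. (D J z \<omega> - D J w \<omega>)\<^sup>2)"
    and "expectation (\<lambda>\<omega>. (D J z \<omega> - D J w \<omega>)\<^sup>2)
      \<le> 2 * (card J * (2 * \<bar>Phi z - Phi w\<bar> + 2 * e\<^sup>2) + 20 * (B + 1)\<^sup>2 * K3 * E2) + 2 * e\<^sup>2 * V J"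
proof -
  let ?K = "5 * (B + 1)\<^sup>2 * K3" and ?v = "2 * \<bar>Phi z - Phi w\<bar> + 2 * e\<^sup>2"
  define X where "X i \<omega> = resid z (Y i \<omega>) - resid w (Y i \<omega>)" for i \<omega>
  let ?N = "\<lambda>\<omega>. \<Sum>i\<in>J. X i \<omega>" and ?L = "\<lambda>\<omega>. \<Sum>i\<in>J. Y i \<omega>"
  note [measurable] = measurable_Y
  have fin: "finite J" using J finite_I by (rule finite_subset)
  have JI: "i \<in> I" if "i \<in> J" for i using that J by auto
  have m: "X i \<in> borel_measurable M" if "i \<in> J" for i unfolding X_def using JI[OF that] by measurable
  have ip: "integrable M (\<lambda>\<omega>. resid x (Y i \<omega>) * resid y (Y j \<omega>))" if "i \<in> J" "j \<in> J" for x y i j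
    by (rule integrable_mult_L2) (use that JI resid_integrable(2)[OF gaussian_Yi] in auto)
  have XX: "X i \<omega> * X j \<omega> = resid z (Y i \<omega>) * resid z (Y j \<omega>) - resid z (Y i \<omega>) * resid w (Y j \<omega>)
      - resid w (Y i \<omega>) * resid z (Y j \<omega>) + resid w (Y i \<omega>) * resid w (Y j \<omega>)" for i j \<omega>
    by (simp add: X_def algebra_simps)
  have i2: "integrable M (\<lambda>\<omega>. (X i \<omega>)\<^sup>2)" if "i \<in> J" for i
    unfolding power2_eq_square XX using ip that by auto
  have d: "expectation (\<lambda>\<omega>. (X i \<omega>)\<^sup>2) \<le> ?v" if "i \<in> J" for i
    unfolding X_def e_def by (rule resid_difference_second_moment[OF gaussian_Yi[OF JI[OF that]]])
  have o: "expectation (\<lambda>\<omega>. X i \<omega> * X j \<omega>) \<le> 4 * ?K * (\<Gamma> i j)\<^sup>2" if "i \<in> J" "j \<in> J" "i \<noteq> j" for i j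
  proof -
    have b: "\<bar>expectation (\<lambda>\<omega>. resid x (Y i \<omega>) * resid y (Y j \<omega>))\<bar> \<le> ?K * (\<Gamma> i j)\<^sup>2" if "\<bar>y\<bar> \<le> B" for x y
      by (rule resid_covariance_bound[OF std_pair_Y[OF JI JI] that]) fact+
    have "expectation (\<lambda>\<omega>. X i \<omega> * X j \<omega>) = expectation (\<lambda>\<omega>. resid z (Y i \<omega>) * resid z (Y j \<omega>))
        - expectation (\<lambda>\<omega>. resid z (Y i \<omega>) * resid w (Y j \<omega>)) - expectation (\<lambda>\<omega>. resid w (Y i \<omega>) * resid z (Y j \<omega>))
        + expectation (\<lambda>\<omega>. resid w (Y i \<omega>) * resid w (Y j \<omega>))"
      unfolding XX using ip[OF that(1,2)] by simp
    then show ?thesis using b[OF z, of z] b[OF z, of w] b[OF w, of z] b[OF w, of w] by linarith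
  qed
  have N1: "integrable M (\<lambda>\<omega>. (?N \<omega>)\<^sup>2)"
    by (rule second_moment_sum_bound(1)[OF fin m i2 d o])
  have "expectation (\<lambda>\<omega>. (?N \<omega>)\<^sup>2) \<le> (\<Sum>i\<in>J. ?v) + (\<Sum>i\<in>J. \<Sum>j\<in>J - {i}. 4 * ?K * (\<Gamma> i j)\<^sup>2)"
    by (rule second_moment_sum_bound(2)[OF fin m i2 d o])
  also have "\<dots> = card J * ?v + 4 * ?K * (\<Sum>i\<in>J. \<Sum>j\<in>J - {i}. (\<Gamma> i j)\<^sup>2)" by (simp add: sum_distrib_left)
  also have "\<dots> \<le> card J * ?v + 4 * ?K * E2"
    using E2_subset[OF J] K3_ge_1 by (intro add_left_mono mult_left_mono) auto
  finally have N2: "expectation (\<lambda>\<omega>. (?N \<omega>)\<^sup>2) \<le> card J * ?v + 20 * (B + 1)\<^sup>2 * K3 * E2" by simp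
  note L = gaussian_rv_moments[OF gaussian_sum[OF J]]
  have eq: "D J z \<omega> - D J w \<omega> = ?N \<omega> + e * ?L \<omega>" for \<omega>
    by (simp add: D_eq X_def e_def sum_subtractf algebra_simps)
  have le: "(D J z \<omega> - D J w \<omega>)\<^sup>2 \<le> 2 * (?N \<omega>)\<^sup>2 + 2 * e\<^sup>2 * (?L \<omega>)\<^sup>2" for \<omega>
    unfolding eq using power2_sum_le[of "?N \<omega>" "e * ?L \<omega>"] by (simp only: power_mult_distrib mult.assoc)
  have int: "integrable M (\<lambda>\<omega>. 2 * (?N \<omega>)\<^sup>2 + 2 * e\<^sup>2 * (?L \<omega>)\<^sup>2)"
    by (intro Bochner_Integration.integrable_add integrable_mult_right N1 L(2))
  have [measurable]: "D J z \<in> borel_measurable M" "D J w \<in> borel_measurable M" using J by (auto intro: measurable_D)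
  show "integrable M (\<lambda>\<omega>. (D J z \<omega> - D J w \<omega>)\<^sup>2)"
    by (rule Bochner_Integration.integrable_bound[OF int]) (use le in \<open>auto intro!: AE_I2\<close>)
  have "expectation (\<lambda>\<omega>. (D J z \<omega> - D J w \<omega>)\<^sup>2) \<le> expectation (\<lambda>\<omega>. 2 * (?N \<omega>)\<^sup>2 + 2 * e\<^sup>2 * (?L \<omega>)\<^sup>2)"
    by (rule integral_mono'[OF int le]) simp
  also have "\<dots> = 2 * expectation (\<lambda>\<omega>. (?N \<omega>)\<^sup>2) + 2 * e\<^sup>2 * V J"
    by (simp only: Bochner_Integration.integral_add integrable_mult_right N1 L(2) integral_mult_right_zero L(3))
  also have "\<dots> \<le> 2 * (card J * ?v + 20 * (B + 1)\<^sup>2 * K3 * E2) + 2 * e\<^sup>2 * V J" using N2 by simp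
  finally show "expectation (\<lambda>\<omega>. (D J z \<omega> - D J w \<omega>)\<^sup>2) \<le> 2 * (card J * ?v + 20 * (B + 1)\<^sup>2 * K3 * E2) + 2 * e\<^sup>2 * V J" .
qed

end

section \<open>Gaussian approximation of the null counting process\<close>

lemma norm_iexp_diff_le: "norm (iexp x - iexp y) \<le> \<bar>x - y\<bar>"
proof -
  have "iexp x - iexp y = iexp y * (iexp (x - y) - 1)"
    by (simp add: right_diff_distrib exp_add[symmetric])
  then have "norm (iexp x - iexp y) = norm (iexp (x - y) - 1)" by (simp add: norm_mult)
  also have "\<dots> \<le> \<bar>x - y\<bar>" using iexp_approx1[of "x - y" 0] by simp
  finally show ?thesis .
qed

lemma (in prob_space) norm_expectation_iexp_diff_le:
  assumes [measurable]: "X \<in> borel_measurable M" "X' \<in> borel_measurable M"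
    and int: "integrable M (\<lambda>\<omega>. (X \<omega> - X' \<omega>)\<^sup>2)"
  shows "norm ((CLINT \<omega>|M. iexp (\<theta> * X \<omega>)) - (CLINT \<omega>|M. iexp (\<theta> * X' \<omega>))) \<le> \<bar>\<theta>\<bar> * sqrt (expectation (\<lambda>\<omega>. (X \<omega> - X' \<omega>)\<^sup>2))"
proof -
  have i: "complex_integrable M (\<lambda>\<omega>. iexp (\<theta> * X \<omega>))" "complex_integrable M (\<lambda>\<omega>. iexp (\<theta> * X' \<omega>))"
    by (rule integrable_bounded[where B=1]; simp)+
  note L = expectation_abs_le_sqrt[of "\<lambda>\<omega>. X \<omega> - X' \<omega>", OF _ int]
  have "(CLINT \<omega>|M. iexp (\<theta> * X \<omega>)) - (CLINT \<omega>|M. iexp (\<theta> * X' \<omega>)) = (CLINT \<omega>|M. iexp (\<theta> * X \<omega>) - iexp (\<theta> * X' \<omega>))"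
    by (rule Bochner_Integration.integral_diff[symmetric]; fact)
  moreover have "norm (CLINT \<omega>|M. iexp (\<theta> * X \<omega>) - iexp (\<theta> * X' \<omega>)) \<le> expectation (\<lambda>\<omega>. \<bar>\<theta>\<bar> * \<bar>X \<omega> - X' \<omega>\<bar>)"
  proof (rule order_trans[OF integral_norm_bound integral_mono])
    show "integrable M (\<lambda>\<omega>. norm (iexp (\<theta> * X \<omega>) - iexp (\<theta> * X' \<omega>)))"
      using i by (intro integrable_norm Bochner_Integration.integrable_diff)
    show "integrable M (\<lambda>\<omega>. \<bar>\<theta>\<bar> * \<bar>X \<omega> - X' \<omega>\<bar>)" using L(1) by simp
    show "norm (iexp (\<theta> * X \<omega>) - iexp (\<theta> * X' \<omega>)) \<le> \<bar>\<theta>\<bar> * \<bar>X \<omega> - X' \<omega>\<bar>" for \<omega>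
      using norm_iexp_diff_le[of "\<theta> * X \<omega>" "\<theta> * X' \<omega>"] by (simp only: right_diff_distrib[symmetric] abs_mult)
  qed
  moreover have "expectation (\<lambda>\<omega>. \<bar>\<theta>\<bar> * \<bar>X \<omega> - X' \<omega>\<bar>) \<le> \<bar>\<theta>\<bar> * sqrt (expectation (\<lambda>\<omega>. (X \<omega> - X' \<omega>)\<^sup>2))"
    using L(2) by (simp add: mult_left_mono)
  ultimately show ?thesis by simp
qed

context gaussian_family
begin

text \<open>The central limit theorem for the counts, with an explicit error. In \<open>D J
  z\<close> the residuals are replaced by those of the coupled independent variables
  \<open>Z i\<close>, at the cost of the first error term. The sum of the \<open>Y
  i\<close>, \<open>i \<in> J\<close>, is its orthogonal projection onto the span of the
  \<open>Z k\<close> plus a remainder \<open>T\<close> that is independent of all the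
  \<open>Z k\<close>. The characteristic function is then a product over \<open>k\<close>,
  in which the factors with \<open>k \<notin> J\<close> are exactly Gaussian.\<close>

lemma D_char_bound:
  fixes z B \<eta> \<theta> :: real
  assumes J: "J \<subseteq> I" and z: "\<bar>z\<bar> \<le> B" and \<eta>: "\<eta> > 0" and \<theta>: "\<bar>\<theta>\<bar> \<le> 1"
  shows "norm ((CLINT \<omega>|M. iexp (\<theta> * D J z \<omega>))
      - of_real (exp (- (\<theta>\<^sup>2 * (card J * rvar z + (std_normal_density z)\<^sup>2 * V J)) / 2)))
    \<le> \<bar>\<theta>\<bar> * sqrt (4 * \<eta> * card J + (2 / \<eta>\<^sup>2 + 2 + 15 * (B + 1)\<^sup>2 * K3) * E2)
      + 4 * K3 * \<bar>\<theta>\<bar> ^ 3 * (card J + V J)"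
proof -
  let ?X = "PiM I (\<lambda>_. std_normal_distribution)"
  let ?P = "M \<Otimes>\<^sub>M ?X"
  let ?K = "5 * (B + 1)\<^sup>2 * K3" and ?\<phi> = "std_normal_density z"
  have K0: "?K \<ge> 0" using K3_ge_1 by simp
  have finJ: "finite J" using J finite_I by (rule finite_subset)
  have JI: "i \<in> I" if "i \<in> J" for i using that J by auto
  obtain Z C where Zm: "\<And>i. i \<in> I \<Longrightarrow> Z i \<in> borel_measurable ?P"
    and g: "\<And>a b. gaussian_rv ?P (\<lambda>\<omega>. (\<Sum>i\<in>I. a i * Z i \<omega>) + (\<Sum>i\<in>I. b i * Y i (fst \<omega>)))
       (ip I a a + 2 * ip I b (\<lambda>i. a i + mv I C a i) + ip I b (mv I \<Gamma> b))"
    and C2: "(\<Sum>i\<in>I. \<Sum>j\<in>I. (C i j)\<^sup>2) \<le> E2"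
    and Ctr: "(\<Sum>i\<in>I. - 2 * C i i) \<le> E2"
    and Csym: "\<And>i j. i \<in> I \<Longrightarrow> j \<in> I \<Longrightarrow> C i j = C j i"
    unfolding E2_def
  proof (rule gaussian_coupling[OF prob_space_axioms finite_I measurable_Y \<Gamma>_sym \<Gamma>_diag gaussian_Y], goal_cases)
    case (5 Z C)
    from 5(1)[OF 5(2-6)] show ?case .
  qed
  interpret X: prob_space ?X by (intro prob_space_PiM std_normal_prob_space)
  interpret P: pair_prob_space M ?X ..
  (* The family lives on the product space from here on; step0 transfers the result back. *)
  interpret PY: gaussian_family ?P I "\<lambda>i \<omega>. Y i (fst \<omega>)" \<Gamma>
  proof
    show "gaussian_rv ?P (\<lambda>\<omega>. \<Sum>i\<in>I. b i * Y i (fst \<omega>)) (ip I b (mv I \<Gamma> b))" for b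
      using g[of "\<lambda>_. 0" b] by (simp add: ip_def mv_def)
  qed (use finite_I measurable_Y \<Gamma>_sym \<Gamma>_diag in auto)
  note [measurable] = Zm PY.measurable_Y
  have char: "(CLINT \<omega>|?P. iexp ((\<Sum>i\<in>I. a i * Z i \<omega>) + (\<Sum>i\<in>I. b i * Y i (fst \<omega>)))) =
      of_real (exp (- (ip I a a + 2 * ip I b (\<lambda>i. a i + mv I C a i) + ip I b (mv I \<Gamma> b)) / 2))" for a b
  proof -
    have "(CLINT \<omega>|?P. iexp (1 * ((\<Sum>i\<in>I. a i * Z i \<omega>) + (\<Sum>i\<in>I. b i * Y i (fst \<omega>))))) =
      of_real (exp (- ((ip I a a + 2 * ip I b (\<lambda>i. a i + mv I C a i) + ip I b (mv I \<Gamma> b)) * 1\<^sup>2) / 2))"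
      using g[of a b] unfolding gaussian_rv_def by blast
    then show ?thesis by (simp only: power_one mult_1 mult_1_right)
  qed
  have dl: "(\<Sum>k\<in>I. \<alpha> * delta i k * f k) = \<alpha> * f i" if "i \<in> I" for i \<alpha> and f :: "'i \<Rightarrow> real"
    using ip_delta_mv(1)[OF that, of f] by (simp add: ip_def mult.assoc sum_distrib_left[symmetric])
  have dC: "mv I C (\<lambda>k. \<alpha> * delta i k) j = \<alpha> * C j i" if "i \<in> I" for i j \<alpha>
    using dl[OF that, of \<alpha> "C j"] by (simp add: mv_def mult_ac)
  have dG: "mv I \<Gamma> (\<lambda>k. \<alpha> * delta i k) j = \<alpha> * \<Gamma> j i" if "i \<in> I" for i j \<alpha>
    using dl[OF that, of \<alpha> "\<Gamma> j"] by (simp add: mv_def mult_ac)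
  have pYZ: "std_pair ?P (\<lambda>\<omega>. Y j (fst \<omega>)) (Z i) (delta i j + C j i)" if ij: "i \<in> I" "j \<in> I" for i j
    unfolding std_pair_def
  proof (intro conjI allI)
    fix \<alpha> \<beta>
    have "ip I (\<lambda>k. \<beta> * delta i k) (\<lambda>k. \<beta> * delta i k) = \<beta>\<^sup>2"
      unfolding ip_def dl[OF ij(1)] by (simp add: delta_def power2_eq_square)
    moreover have "ip I (\<lambda>k. \<alpha> * delta j k) (\<lambda>k. \<beta> * delta i k + mv I C (\<lambda>k. \<beta> * delta i k) k) = (delta i j + C j i) * \<alpha> * \<beta>"
      unfolding ip_def dl[OF ij(2)] dC[OF ij(1)] by (simp add: algebra_simps)
    moreover have "ip I (\<lambda>k. \<alpha> * delta j k) (mv I \<Gamma> (\<lambda>k. \<alpha> * delta j k)) = \<alpha>\<^sup>2"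
      unfolding ip_def dl[OF ij(2)] dG[OF ij(2)] using \<Gamma>_diag[OF ij(2)] by (simp add: power2_eq_square)
    moreover have "\<alpha> * Y j (fst \<omega>) + \<beta> * Z i \<omega> = (\<Sum>k\<in>I. \<beta> * delta i k * Z k \<omega>) + (\<Sum>k\<in>I. \<alpha> * delta j k * Y k (fst \<omega>))" for \<omega>
      unfolding dl[OF ij(1)] dl[OF ij(2)] by simp
    ultimately show "(CLINT \<omega>|?P. iexp (\<alpha> * Y j (fst \<omega>) + \<beta> * Z i \<omega>)) =
        of_real (exp (- (\<alpha>\<^sup>2 + 2 * (delta i j + C j i) * \<alpha> * \<beta> + \<beta>\<^sup>2) / 2))"
      using char[of "\<lambda>k. \<beta> * delta i k" "\<lambda>k. \<alpha> * delta j k"] by (simp add: algebra_simps)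
  qed (use ij in auto)
  have pZZ: "std_pair ?P (Z i) (Z j) 0" if ij: "i \<in> I" "j \<in> I" "i \<noteq> j" for i j
    unfolding std_pair_def
  proof (intro conjI allI)
    fix \<alpha> \<beta>
    let ?a = "\<lambda>k. \<alpha> * delta i k + \<beta> * delta j k"
    have s: "(\<Sum>k\<in>I. ?a k * f k) = \<alpha> * f i + \<beta> * f j" for f
      using dl[OF ij(1), of \<alpha> f] dl[OF ij(2), of \<beta> f] by (simp add: distrib_right sum.distrib)
    have "ip I ?a ?a = \<alpha>\<^sup>2 + \<beta>\<^sup>2"
      unfolding ip_def s using ij by (simp add: delta_def power2_eq_square)
    then show "(CLINT \<omega>|?P. iexp (\<alpha> * Z i \<omega> + \<beta> * Z j \<omega>)) = of_real (exp (- (\<alpha>\<^sup>2 + 2 * 0 * \<alpha> * \<beta> + \<beta>\<^sup>2) / 2))"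
      using char[of ?a "\<lambda>_. 0"] unfolding s by (simp add: ip_def[of I "\<lambda>_. 0"])
  qed (use ij in auto)
  have gZ: "gaussian_rv ?P (Z i) 1" if "i \<in> I" for i using std_pair_marginals(2)[OF pYZ[OF that that]] .
  define W where "W i \<omega> = resid z (Y i (fst \<omega>)) - resid z (Z i \<omega>)" for i \<omega>
  define W2 where "W2 = 4 * \<eta> * card J + (2 / \<eta>\<^sup>2 + 2 + 15 * (B + 1)\<^sup>2 * K3) * E2"
  define SW where "SW \<omega> = (\<Sum>i\<in>J. W i \<omega>)" for \<omega>
  have Wm [measurable]: "W i \<in> borel_measurable ?P" if "i \<in> J" for i
    unfolding W_def using JI[OF that] by measurable
  have iYY: "integrable ?P (\<lambda>\<omega>. resid z (Y i (fst \<omega>)) * resid z (Y j (fst \<omega>)))"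
    and iYZ: "integrable ?P (\<lambda>\<omega>. resid z (Y i (fst \<omega>)) * resid z (Z j \<omega>))"
    and iZY: "integrable ?P (\<lambda>\<omega>. resid z (Z i \<omega>) * resid z (Y j (fst \<omega>)))"
    and iZZ: "integrable ?P (\<lambda>\<omega>. resid z (Z i \<omega>) * resid z (Z j \<omega>))" if "i \<in> J" "j \<in> J" for i j
    by (rule integrable_mult_L2; use that JI P.resid_integrable(2)[OF gZ] P.resid_integrable(2)[OF PY.gaussian_Yi] in auto)+
  have WW: "W i \<omega> * W j \<omega> = resid z (Y i (fst \<omega>)) * resid z (Y j (fst \<omega>)) - resid z (Y i (fst \<omega>)) * resid z (Z j \<omega>)
      - resid z (Z i \<omega>) * resid z (Y j (fst \<omega>)) + resid z (Z i \<omega>) * resid z (Z j \<omega>)" for i j \<omega>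
    by (simp add: W_def algebra_simps)
  have Wi2: "integrable ?P (\<lambda>\<omega>. (W i \<omega>)\<^sup>2)" if "i \<in> J" for i
    unfolding power2_eq_square WW
    by (intro Bochner_Integration.integrable_add Bochner_Integration.integrable_diff iYY iYZ iZY iZZ that)
  (* Only the trace of C enters the diagonal terms, and it is of second order. *)
  have Wd: "P.expectation (\<lambda>\<omega>. (W i \<omega>)\<^sup>2) \<le> 4 * \<eta> + (2 / \<eta>\<^sup>2 + 2) * (- 2 * C i i)" if "i \<in> J" for i
    using P.resid_increment_bound[OF pYZ[OF JI JI, OF that that] \<eta>, of z]
    by (simp add: W_def delta_def)
  have Wo: "P.expectation (\<lambda>\<omega>. W i \<omega> * W j \<omega>) \<le> ?K * (\<Gamma> i j)\<^sup>2 + 2 * ?K * (C i j)\<^sup>2" if ij: "i \<in> J" "j \<in> J" "i \<noteq> j" for i j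
  proof -
    have b1: "\<bar>P.expectation (\<lambda>\<omega>. resid z (Y i (fst \<omega>)) * resid z (Y j (fst \<omega>)))\<bar> \<le> ?K * (\<Gamma> i j)\<^sup>2"
      by (rule P.resid_covariance_bound[OF PY.std_pair_Y[OF JI JI] z]) fact+
    have b2: "\<bar>P.expectation (\<lambda>\<omega>. resid z (Y i (fst \<omega>)) * resid z (Z j \<omega>))\<bar> \<le> ?K * (C i j)\<^sup>2"
      using P.resid_covariance_bound[OF pYZ[OF JI JI, OF ij(2,1)] z, of z] ij by (simp add: delta_def)
    have b3: "\<bar>P.expectation (\<lambda>\<omega>. resid z (Z i \<omega>) * resid z (Y j (fst \<omega>)))\<bar> \<le> ?K * (C i j)\<^sup>2"
      using P.resid_covariance_bound[OF pYZ[OF JI JI, OF ij(1,2)] z, of z] ij Csym[OF JI JI, OF ij(1,2)]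
      by (simp add: delta_def mult.commute[of "resid z (Z i _)"])
    have b4: "\<bar>P.expectation (\<lambda>\<omega>. resid z (Z i \<omega>) * resid z (Z j \<omega>))\<bar> \<le> ?K * 0\<^sup>2"
      by (rule P.resid_covariance_bound[OF pZZ[OF JI JI] z]) fact+
    have "P.expectation (\<lambda>\<omega>. W i \<omega> * W j \<omega>) = P.expectation (\<lambda>\<omega>. resid z (Y i (fst \<omega>)) * resid z (Y j (fst \<omega>)))
        - P.expectation (\<lambda>\<omega>. resid z (Y i (fst \<omega>)) * resid z (Z j \<omega>)) - P.expectation (\<lambda>\<omega>. resid z (Z i \<omega>) * resid z (Y j (fst \<omega>)))
        + P.expectation (\<lambda>\<omega>. resid z (Z i \<omega>) * resid z (Z j \<omega>))"
      unfolding WW using iYY[OF ij(1,2)] iYZ[OF ij(1,2)] iZY[OF ij(1,2)] iZZ[OF ij(1,2)]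
      by (simp only: Bochner_Integration.integral_add Bochner_Integration.integral_diff Bochner_Integration.integrable_diff)
    then show ?thesis using b1 b2 b3 b4 by simp
  qed
  have iSW: "integrable ?P (\<lambda>\<omega>. (SW \<omega>)\<^sup>2)"
    unfolding SW_def by (rule P.second_moment_sum_bound(1)[OF finJ Wm Wi2 Wd Wo])
  have SW2: "P.expectation (\<lambda>\<omega>. (SW \<omega>)\<^sup>2) \<le> W2"
  proof -
    have Cnn: "0 \<le> - 2 * C i i" if "i \<in> I" for i
      using P.gaussian_rv_moments(1)[OF std_pair_diff[OF pYZ[OF that that]]] by (simp add: delta_def)
    have "P.expectation (\<lambda>\<omega>. (SW \<omega>)\<^sup>2) \<le> (\<Sum>i\<in>J. 4 * \<eta> + (2 / \<eta>\<^sup>2 + 2) * (- 2 * C i i))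
        + (\<Sum>i\<in>J. \<Sum>j\<in>J - {i}. ?K * (\<Gamma> i j)\<^sup>2 + 2 * ?K * (C i j)\<^sup>2)"
      unfolding SW_def by (rule P.second_moment_sum_bound(2)[OF finJ Wm Wi2 Wd Wo])
    also have "(\<Sum>i\<in>J. 4 * \<eta> + (2 / \<eta>\<^sup>2 + 2) * (- 2 * C i i)) = 4 * \<eta> * card J + (2 / \<eta>\<^sup>2 + 2) * (\<Sum>i\<in>J. - 2 * C i i)"
      by (simp only: sum.distrib sum_distrib_left[symmetric]) simp
    also have "(\<Sum>i\<in>J. \<Sum>j\<in>J - {i}. ?K * (\<Gamma> i j)\<^sup>2 + 2 * ?K * (C i j)\<^sup>2) =
        ?K * (\<Sum>i\<in>J. \<Sum>j\<in>J - {i}. (\<Gamma> i j)\<^sup>2) + 2 * ?K * (\<Sum>i\<in>J. \<Sum>j\<in>J - {i}. (C i j)\<^sup>2)"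
      by (simp only: sum.distrib sum_distrib_left[symmetric])
    also have "4 * \<eta> * card J + (2 / \<eta>\<^sup>2 + 2) * (\<Sum>i\<in>J. - 2 * C i i) +
        (?K * (\<Sum>i\<in>J. \<Sum>j\<in>J - {i}. (\<Gamma> i j)\<^sup>2) + 2 * ?K * (\<Sum>i\<in>J. \<Sum>j\<in>J - {i}. (C i j)\<^sup>2))
        \<le> 4 * \<eta> * card J + (2 / \<eta>\<^sup>2 + 2) * E2 + (?K * E2 + 2 * ?K * E2)"
    proof (intro add_mono mult_left_mono order_refl)
      have "(\<Sum>i\<in>J. - 2 * C i i) \<le> (\<Sum>i\<in>I. - 2 * C i i)"
        using Cnn J finite_I by (intro sum_mono2) auto
      then show "(\<Sum>i\<in>J. - 2 * C i i) \<le> E2" using Ctr by simp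
      show "(\<Sum>i\<in>J. \<Sum>j\<in>J - {i}. (\<Gamma> i j)\<^sup>2) \<le> E2" by (rule E2_subset[OF J])
      have "(\<Sum>i\<in>J. \<Sum>j\<in>J - {i}. (C i j)\<^sup>2) \<le> (\<Sum>i\<in>J. \<Sum>j\<in>I. (C i j)\<^sup>2)"
        using J finite_I by (intro sum_mono sum_mono2) auto
      also have "\<dots> \<le> (\<Sum>i\<in>I. \<Sum>j\<in>I. (C i j)\<^sup>2)"
        using J finite_I by (intro sum_mono2) (auto intro: sum_nonneg)
      finally show "(\<Sum>i\<in>J. \<Sum>j\<in>J - {i}. (C i j)\<^sup>2) \<le> E2" using C2 by simp
    qed (use K0 \<eta> in auto)
    also have "\<dots> = W2" by (simp add: W2_def algebra_simps)
    finally show ?thesis .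
  qed
  define D' where "D' \<omega> = (\<Sum>i\<in>J. resid z (Z i \<omega>)) + ?\<phi> * (\<Sum>i\<in>J. Y i (fst \<omega>))" for \<omega>
  have D'm [measurable]: "D' \<in> borel_measurable ?P"
    unfolding D'_def using JI by measurable
  have PDm: "PY.D J z \<in> borel_measurable ?P" using J by (rule PY.measurable_D)
  have DD': "PY.D J z \<omega> - D' \<omega> = SW \<omega>" for \<omega>
    by (simp add: PY.D_eq D'_def SW_def W_def sum_subtractf)
  have step1: "norm ((CLINT \<omega>|?P. iexp (\<theta> * PY.D J z \<omega>)) - (CLINT \<omega>|?P. iexp (\<theta> * D' \<omega>))) \<le> \<bar>\<theta>\<bar> * sqrt W2"
  proof -
    have "norm ((CLINT \<omega>|?P. iexp (\<theta> * PY.D J z \<omega>)) - (CLINT \<omega>|?P. iexp (\<theta> * D' \<omega>)))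
        \<le> \<bar>\<theta>\<bar> * sqrt (P.expectation (\<lambda>\<omega>. (PY.D J z \<omega> - D' \<omega>)\<^sup>2))"
      by (rule P.norm_expectation_iexp_diff_le[OF PDm D'm]) (simp add: DD' iSW)
    also have "\<dots> \<le> \<bar>\<theta>\<bar> * sqrt W2" using SW2 unfolding DD' by (intro mult_left_mono real_sqrt_le_mono) auto
    finally show ?thesis .
  qed
  have step0: "(CLINT \<omega>|?P. iexp (\<theta> * PY.D J z \<omega>)) = (CLINT \<omega>|M. iexp (\<theta> * D J z \<omega>))"
  proof -
    have [measurable]: "D J z \<in> borel_measurable M" using J by (rule measurable_D)
    have int: "complex_integrable ?P (\<lambda>\<omega>. iexp (\<theta> * D J z (fst \<omega>)))"
      by (rule P.integrable_bounded[where B=1]) auto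
    have "PY.D J z \<omega> = D J z (fst \<omega>)" for \<omega> by (simp add: PY.D_def D_def)
    then have "(CLINT \<omega>|?P. iexp (\<theta> * PY.D J z \<omega>)) = (CLINT \<omega>|?P. iexp (\<theta> * D J z (fst \<omega>)))" by simp
    also have "\<dots> = (CLINT \<omega>|M. CLINT \<xi>|?X. iexp (\<theta> * D J z \<omega>))"
      using P.integral_fst'[OF int] by simp
    finally show ?thesis by (simp add: X.prob_space)
  qed
  define w where "w i = (of_bool (i \<in> J) :: real)" for i
  have sub: "(\<Sum>i\<in>I. w i * f i) = (\<Sum>i\<in>J. f i)" "(\<Sum>i\<in>I. f i * w i) = (\<Sum>i\<in>J. f i)" for f :: "'i \<Rightarrow> real"
    unfolding w_def using J finite_I by (auto simp: of_bool_def if_distrib[of "\<lambda>y. y * _"] if_distrib[of "\<lambda>y. _ * y"] sum.If_cases Int_absorb1 cong: if_cong)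
  have wV: "ip I w (mv I \<Gamma> w) = V J" unfolding ip_def mv_def V_def sub ..
  (* The covariance of the sum over J with Z i, that is, the coefficients of the
     projection; q is the variance of the remainder. *)
  define b where "b i = w i + mv I C w i" for i
  define q where "q = V J - ip I b b"
  define T where "T \<omega> = (\<Sum>i\<in>J. Y i (fst \<omega>)) - (\<Sum>k\<in>I. b k * Z k \<omega>)" for \<omega>
  have Tm [measurable]: "T \<in> borel_measurable ?P" unfolding T_def using JI by measurable
  have charT: "(CLINT \<omega>|?P. iexp ((\<Sum>k\<in>I. c k * Z k \<omega>) + s * T \<omega>)) = of_real (exp (- ((\<Sum>k\<in>I. (c k)\<^sup>2) + s\<^sup>2 * q) / 2))" for c s
  proof -
    let ?a = "\<lambda>k. c k - s * b k" and ?\<beta> = "\<lambda>k. s * w k"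
    have e: "(\<Sum>k\<in>I. c k * Z k \<omega>) + s * T \<omega> = (\<Sum>k\<in>I. ?a k * Z k \<omega>) + (\<Sum>i\<in>I. ?\<beta> i * Y i (fst \<omega>))" for \<omega>
      by (simp add: T_def left_diff_distrib sum_subtractf mult.assoc sum_distrib_left[symmetric] sub right_diff_distrib)
    have q1: "ip I ?\<beta> (\<lambda>i. ?a i + mv I C ?a i) = s * ip I b ?a"
    proof -
      have "ip I w (mv I C ?a) = ip I (mv I C w) ?a" by (rule ip_mv_adjoint) (rule Csym)
      then have "ip I w (\<lambda>i. ?a i + mv I C ?a i) = ip I (\<lambda>i. w i + mv I C w i) ?a"
        by (simp only: ip_add_right ip_add_left)
      then show ?thesis unfolding ip_scale_left b_def[abs_def] by simp
    qed
    have q2: "ip I ?\<beta> (mv I \<Gamma> ?\<beta>) = s\<^sup>2 * V J"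
      unfolding mv_scale ip_scale_left ip_scale_right wV by (simp add: power2_eq_square)
    have "ip I ?a ?a + 2 * ip I ?\<beta> (\<lambda>i. ?a i + mv I C ?a i) + ip I ?\<beta> (mv I \<Gamma> ?\<beta>) = ip I c c + s\<^sup>2 * q"
      unfolding q1 q2 q_def by (simp add: ip_linear ip_commute[of I c b] power2_eq_square algebra_simps)
    also have "ip I c c = (\<Sum>k\<in>I. (c k)\<^sup>2)" by (simp add: ip_def power2_eq_square)
    finally show ?thesis unfolding e char by (simp only:)
  qed
  have q0: "q \<ge> 0"
  proof -
    have "gaussian_rv ?P T q"
      unfolding gaussian_rv_def using charT[of "\<lambda>_. 0"] Tm by (simp add: mult.commute)
    then show ?thesis by (rule P.gaussian_rv_moments(1))
  qed
  define f where "f k x = iexp (\<theta> * ((?\<phi> * b k) * x + w k * resid z x))" for k x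
  have fm: "f k \<in> borel_measurable borel" for k unfolding f_def by measurable
  have f1: "norm (f k x) \<le> 1" for k x unfolding f_def norm_exp_i_times by simp
  define F where "F k = (CLINT x|std_normal_distribution. f k x)" for k
  define H where "H k = complex_of_real (exp (- (\<theta>\<^sup>2 * ((?\<phi> * b k)\<^sup>2 + w k * rvar z)) / 2))" for k
  have "iexp (\<theta> * D' \<omega>) = iexp ((\<Sum>k\<in>I - I. 0 * Z k \<omega>) + (\<theta> * ?\<phi>) * T \<omega>) * (\<Prod>k\<in>I. f k (Z k \<omega>))" for \<omega>
  proof -
    have "(\<Prod>k\<in>I. f k (Z k \<omega>)) = iexp (\<Sum>k\<in>I. \<theta> * ((?\<phi> * b k) * Z k \<omega> + w k * resid z (Z k \<omega>)))"
      using finite_I by (simp add: f_def exp_sum[symmetric] sum_distrib_left)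
    also have "(\<Sum>k\<in>I. \<theta> * ((?\<phi> * b k) * Z k \<omega> + w k * resid z (Z k \<omega>))) =
        \<theta> * (?\<phi> * (\<Sum>k\<in>I. b k * Z k \<omega>) + (\<Sum>i\<in>J. resid z (Z i \<omega>)))"
      unfolding sub(1)[symmetric] by (simp add: distrib_left sum.distrib sum_distrib_left mult.assoc)
    finally show ?thesis
      by (simp add: exp_add[symmetric] D'_def T_def algebra_simps)
  qed
  then have "(CLINT \<omega>|?P. iexp (\<theta> * D' \<omega>)) =
      (CLINT \<omega>|?P. iexp ((\<Sum>k\<in>I - I. 0 * Z k \<omega>) + (\<theta> * ?\<phi>) * T \<omega>) * (\<Prod>k\<in>I. f k (Z k \<omega>)))"
    by (simp only:)
  also have "\<dots> = of_real (exp (- ((\<Sum>k\<in>I - I. 0\<^sup>2) + (\<theta> * ?\<phi>)\<^sup>2 * q) / 2)) * (\<Prod>k\<in>I. F k)"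
    unfolding F_def
    by (rule P.gaussian_independence[where c = "\<lambda>_. 0", OF finite_I Zm Tm charT fm f1 order_refl])
  finally have E1: "(CLINT \<omega>|?P. iexp (\<theta> * D' \<omega>)) = of_real (exp (- ((\<theta> * ?\<phi>)\<^sup>2 * q) / 2)) * (\<Prod>k\<in>I. F k)" by simp
  have E2': "of_real (exp (- (\<theta>\<^sup>2 * (card J * rvar z + ?\<phi>\<^sup>2 * V J)) / 2)) = of_real (exp (- ((\<theta> * ?\<phi>)\<^sup>2 * q) / 2)) * (\<Prod>k\<in>I. H k)"
  proof -
    have "(\<Prod>k\<in>I. H k) = of_real (exp (\<Sum>k\<in>I. - (\<theta>\<^sup>2 * ((?\<phi> * b k)\<^sup>2 + w k * rvar z)) / 2))"
      unfolding H_def using finite_I by (simp add: exp_sum)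
    also have "(\<Sum>k\<in>I. - (\<theta>\<^sup>2 * ((?\<phi> * b k)\<^sup>2 + w k * rvar z)) / 2) = - (\<theta>\<^sup>2 * (\<Sum>k\<in>I. (?\<phi> * b k)\<^sup>2 + w k * rvar z)) / 2"
      by (simp add: sum_distrib_left sum_negf[symmetric] sum_divide_distrib)
    also have "(\<Sum>k\<in>I. (?\<phi> * b k)\<^sup>2 + w k * rvar z) = ?\<phi>\<^sup>2 * ip I b b + card J * rvar z"
      by (simp add: sum.distrib sub power_mult_distrib ip_def sum_distrib_left power2_eq_square mult_ac)
    finally have HI: "(\<Prod>k\<in>I. H k) = of_real (exp (- (\<theta>\<^sup>2 * (?\<phi>\<^sup>2 * ip I b b + card J * rvar z)) / 2))" .
    have "- (\<theta>\<^sup>2 * (card J * rvar z + ?\<phi>\<^sup>2 * V J)) / 2 =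
        - ((\<theta> * ?\<phi>)\<^sup>2 * q) / 2 + - (\<theta>\<^sup>2 * (?\<phi>\<^sup>2 * ip I b b + card J * rvar z)) / 2"
      unfolding q_def power_mult_distrib by (simp add: field_simps)
    then show ?thesis unfolding HI by (simp only: exp_add of_real_mult)
  qed
  have FH: "norm (F k - H k) \<le> w k * (4 * K3 * \<bar>\<theta>\<bar> ^ 3 * (1 + (b k)\<^sup>2))" for k
  proof (cases "k \<in> J")
    case True
    then have wk: "w k = 1" by (simp add: w_def)
    have "norm (F k - H k) \<le> 4 * K3 * \<bar>\<theta>\<bar> ^ 3 * (1 + (?\<phi> * b k)\<^sup>2)"
      using residual_factor_bound[OF \<theta>, of "?\<phi> * b k" z] unfolding F_def H_def f_def wk by (simp only: mult_1)
    also have "\<dots> \<le> 4 * K3 * \<bar>\<theta>\<bar> ^ 3 * (1 + (b k)\<^sup>2)"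
    proof (intro mult_left_mono add_left_mono)
      show "(?\<phi> * b k)\<^sup>2 \<le> (b k)\<^sup>2"
        unfolding power_mult_distrib using std_normal_density_le_1[of z] std_normal_density_nonneg[of z]
        by (intro mult_left_le_one_le) (auto intro: power_le_one)
    qed (use K3_ge_1 in auto)
    finally show ?thesis by (simp add: wk)
  next
    case False
    then have wk: "w k = 0" by (simp add: w_def)
    have "F k = H k"
      using fun_cong[OF char_std_normal_distribution, of "\<theta> * (?\<phi> * b k)"]
      unfolding F_def H_def f_def wk char_def by (simp add: power_mult_distrib mult.assoc)
    then show ?thesis by (simp add: wk)
  qed
  have F1: "norm (F k) \<le> 1" for k
  proof -
    interpret N: prob_space std_normal_distribution by (rule std_normal_prob_space)
    show ?thesis unfolding F_def f_def by (rule N.norm_expectation_iexp_le_1) measurable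
  qed
  have H1: "norm (H k) \<le> 1" for k
    unfolding H_def norm_of_real using rvar_pos[of z] by (simp add: w_def)
  have step2: "norm ((CLINT \<omega>|?P. iexp (\<theta> * D' \<omega>)) - of_real (exp (- (\<theta>\<^sup>2 * (card J * rvar z + ?\<phi>\<^sup>2 * V J)) / 2)))
      \<le> 4 * K3 * \<bar>\<theta>\<bar> ^ 3 * (card J + V J)"
  proof -
    let ?e = "complex_of_real (exp (- ((\<theta> * ?\<phi>)\<^sup>2 * q) / 2))"
    have e1: "norm ?e \<le> 1" unfolding norm_of_real using q0 by simp
    have "norm (?e * (\<Prod>k\<in>I. F k) - ?e * (\<Prod>k\<in>I. H k)) = norm ?e * norm ((\<Prod>k\<in>I. F k) - (\<Prod>k\<in>I. H k))"
      by (simp only: right_diff_distrib[symmetric] norm_mult)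
    also have "\<dots> \<le> 1 * norm ((\<Prod>k\<in>I. F k) - (\<Prod>k\<in>I. H k))"
      using e1 by (intro mult_right_mono) auto
    also have "\<dots> \<le> (\<Sum>k\<in>I. norm (F k - H k))"
      using norm_prod_diff[of I F H] F1 H1 by simp
    also have "\<dots> \<le> (\<Sum>k\<in>I. w k * (4 * K3 * \<bar>\<theta>\<bar> ^ 3 * (1 + (b k)\<^sup>2)))" by (rule sum_mono) (rule FH)
    also have "\<dots> = 4 * K3 * \<bar>\<theta>\<bar> ^ 3 * (\<Sum>k\<in>J. 1 + (b k)\<^sup>2)" unfolding sub by (simp add: sum_distrib_left)
    also have "\<dots> \<le> 4 * K3 * \<bar>\<theta>\<bar> ^ 3 * (card J + V J)"
    proof (rule mult_left_mono)
      have "(\<Sum>k\<in>J. (b k)\<^sup>2) \<le> (\<Sum>k\<in>I. (b k)\<^sup>2)" using J finite_I by (intro sum_mono2) auto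
      also have "\<dots> = ip I b b" by (simp add: ip_def power2_eq_square)
      finally show "(\<Sum>k\<in>J. 1 + (b k)\<^sup>2) \<le> card J + V J" using q0 by (simp add: sum.distrib q_def)
    qed (use K3_ge_1 in auto)
    finally show ?thesis unfolding E1 E2' .
  qed
  show ?thesis
    unfolding W2_def[symmetric] step0[symmetric]
    using norm_triangle_le[OF add_mono[OF step1 step2]] by simp
qed

end

section \<open>Gaussian vectors as Gaussian families\<close>

lemma (in prob_space) normal_law_gaussian_rv:
  assumes [measurable]: "X \<in> borel_measurable M" and "\<sigma> \<ge> 0" and D: "distr M borel X = normal_law \<mu> \<sigma>"
  shows "gaussian_rv M (\<lambda>\<omega>. X \<omega> - \<mu>) (\<sigma>\<^sup>2)"
proof (cases "\<sigma> = 0")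
  case True
  have "AE x in return borel \<mu>. x = \<mu>" by (subst AE_return) auto
  moreover have "distr M borel X = return borel \<mu>" using D True by (simp add: normal_law_def)
  ultimately have "AE x in distr M borel X. x = \<mu>" by (simp only:)
  then have AE: "AE \<omega> in M. X \<omega> = \<mu>" by (subst (asm) AE_distr_iff) auto
  have "(CLINT \<omega>|M. iexp (u * (X \<omega> - \<mu>))) = (CLINT \<omega>|M. 1)" for u
    by (rule integral_cong_AE) (use AE in auto)
  then show ?thesis using True by (simp add: gaussian_rv_def prob_space)
next
  case False
  then have \<sigma>: "\<sigma> > 0" using assms(2) by simp
  have "distributed M lborel X (normal_density \<mu> \<sigma>)"
    unfolding distributed_def using D False by (auto simp: normal_law_def distr_cong[of M M borel lborel])
  then have "distributed M lborel (\<lambda>x. (X x - \<mu>) / \<sigma>) std_normal_density"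
    using normal_standard_normal_convert[OF \<sigma>] by blast
  then have "distr M borel (\<lambda>x. (X x - \<mu>) / \<sigma>) = std_normal_distribution"
    unfolding distributed_def by (simp add: distr_cong[of M M borel lborel])
  then have "char (distr M borel (\<lambda>x. (X x - \<mu>) / \<sigma>)) = (\<lambda>u. of_real (exp (- (u\<^sup>2) / 2)))"
    using char_std_normal_distribution by simp
  then have "gaussian_rv M (\<lambda>x. (X x - \<mu>) / \<sigma>) 1"
    unfolding gaussian_rv_def fun_eq_iff by (auto simp: char_distr)
  from gaussian_rv_scale[OF this, of \<sigma>] show ?thesis using \<sigma> by simp
qed

text \<open>The law of a linear combination is normal with some parameters; the prescribed means and
  covariances, which exist because normal laws have second moments, identify them.\<close>

lemma gaussian_family_of_vector:
  assumes "prob_space M" and cgv: "centered_gaussian_vector M m Y \<Gamma>"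
    and diag: "\<And>i. i \<in> {1..m} \<Longrightarrow> \<Gamma> i i = 1"
  shows "gaussian_family M {1..m} Y \<Gamma>"
proof -
  interpret prob_space M by fact
  have Ym [measurable]: "Y i \<in> borel_measurable M" if "i \<in> {1..m}" for i
    using cgv that by (auto simp: centered_gaussian_vector_def gaussian_vector_def)
  have EY: "expectation (Y i) = 0" if "i \<in> {1..m}" for i
    using cgv that by (auto simp: centered_gaussian_vector_def)
  have EYY: "expectation (\<lambda>\<omega>. Y i \<omega> * Y j \<omega>) = \<Gamma> i j" if "i \<in> {1..m}" "j \<in> {1..m}" for i j
    using cgv that by (auto simp: centered_gaussian_vector_def)
  have lin: "\<exists>\<mu> \<sigma>. gaussian_rv M (\<lambda>\<omega>. (\<Sum>i=1..m. a i * Y i \<omega>) - \<mu>) (\<sigma>\<^sup>2)" for a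
  proof -
    obtain \<mu> \<sigma> where ms: "\<sigma> \<ge> 0" "distr M borel (\<lambda>\<omega>. \<Sum>i=1..m. a i * Y i \<omega>) = normal_law \<mu> \<sigma>"
      using cgv unfolding centered_gaussian_vector_def gaussian_vector_def by blast
    have "(\<lambda>\<omega>. \<Sum>i=1..m. a i * Y i \<omega>) \<in> borel_measurable M" by measurable
    from normal_law_gaussian_rv[OF this ms] show ?thesis by blast
  qed
  have Yint: "integrable M (Y i)" "integrable M (\<lambda>\<omega>. (Y i \<omega>)\<^sup>2)" if i: "i \<in> {1..m}" for i
  proof -
    obtain \<mu> \<sigma> where "gaussian_rv M (\<lambda>\<omega>. (\<Sum>k=1..m. (if k = i then 1 else 0) * Y k \<omega>) - \<mu>) (\<sigma>\<^sup>2)"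
      using lin[of "\<lambda>k. if k = i then 1 else 0"] by blast
    moreover have "(\<Sum>k=1..m. (if k = i then 1 else 0) * Y k \<omega>) = Y i \<omega>" for \<omega>
      using i by (simp add: if_distrib[of "\<lambda>y. y * _"] cong: if_cong)
    ultimately have g: "gaussian_rv M (\<lambda>\<omega>. Y i \<omega> - \<mu>) (\<sigma>\<^sup>2)" by simp
    have "integrable M (\<lambda>\<omega>. (Y i \<omega> - \<mu>) + \<mu>)"
      using gaussian_rv_moments(4)[OF g] by (rule Bochner_Integration.integrable_add) simp
    then show 1: "integrable M (Y i)" by simp
    have "integrable M (\<lambda>\<omega>. (Y i \<omega> - \<mu>)\<^sup>2 + (2 * \<mu> * Y i \<omega> - \<mu>\<^sup>2))"
      using gaussian_rv_moments(2)[OF g] 1 by auto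
    moreover have "(Y i \<omega> - \<mu>)\<^sup>2 + (2 * \<mu> * Y i \<omega> - \<mu>\<^sup>2) = (Y i \<omega>)\<^sup>2" for \<omega>
      by (simp add: power2_eq_square algebra_simps)
    ultimately show "integrable M (\<lambda>\<omega>. (Y i \<omega>)\<^sup>2)" by simp
  qed
  have YYint: "integrable M (\<lambda>\<omega>. Y i \<omega> * Y j \<omega>)" if "i \<in> {1..m}" "j \<in> {1..m}" for i j
    by (rule integrable_mult_L2) (use Yint that in auto)
  show ?thesis
  proof
    show "\<Gamma> i j = \<Gamma> j i" if "i \<in> {1..m}" "j \<in> {1..m}" for i j
      using EYY[OF that] EYY[OF that(2,1)] by (simp add: mult.commute)
    fix a :: "nat \<Rightarrow> real"
    let ?S = "\<lambda>\<omega>. \<Sum>i=1..m. a i * Y i \<omega>"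
    obtain \<mu> \<sigma> where g: "gaussian_rv M (\<lambda>\<omega>. ?S \<omega> - \<mu>) (\<sigma>\<^sup>2)" using lin by blast
    have "expectation ?S = (\<Sum>i=1..m. a i * expectation (Y i))"
      using Yint by (subst Bochner_Integration.integral_sum) auto
    then have ES: "expectation ?S = 0" using EY by simp
    have intS: "integrable M ?S" using Yint by (intro Bochner_Integration.integrable_sum) auto
    have "expectation (\<lambda>\<omega>. ?S \<omega> - \<mu>) = - \<mu>"
      using intS ES by (subst Bochner_Integration.integral_diff) (auto simp: prob_space)
    then have \<mu>: "\<mu> = 0" using gaussian_rv_moments(5)[OF g] by simp
    have sq: "(?S \<omega>)\<^sup>2 = (\<Sum>i=1..m. \<Sum>j=1..m. a i * a j * (Y i \<omega> * Y j \<omega>))" for \<omega>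
      by (simp add: power2_eq_square sum_product mult_ac)
    have "expectation (\<lambda>\<omega>. (?S \<omega>)\<^sup>2) = (\<Sum>i=1..m. expectation (\<lambda>\<omega>. \<Sum>j=1..m. a i * a j * (Y i \<omega> * Y j \<omega>)))"
      unfolding sq by (rule Bochner_Integration.integral_sum) (intro Bochner_Integration.integrable_sum integrable_mult_right YYint)
    also have "\<dots> = (\<Sum>i=1..m. \<Sum>j=1..m. expectation (\<lambda>\<omega>. a i * a j * (Y i \<omega> * Y j \<omega>)))"
      by (intro sum.cong refl Bochner_Integration.integral_sum integrable_mult_right YYint)
    also have "\<dots> = (\<Sum>i=1..m. \<Sum>j=1..m. a i * a j * \<Gamma> i j)"
      by (intro sum.cong refl) (simp add: EYY)
    also have "\<dots> = ip {1..m} a (mv {1..m} \<Gamma> a)"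
      by (simp add: ip_def mv_def sum_distrib_left mult_ac)
    finally have "\<sigma>\<^sup>2 = ip {1..m} a (mv {1..m} \<Gamma> a)"
      using gaussian_rv_moments(3)[OF g] \<mu> by simp
    then show "gaussian_rv M ?S (ip {1..m} a (mv {1..m} \<Gamma> a))" using g \<mu> by simp
  qed (use Ym diag in auto)
qed

section \<open>The crossing point\<close>

text \<open>The likelihood ratio of the shifted Gaussian law at \<open>z\<close>. With \<open>t =
  Phi z\<close> it is the derivative of \<open>F1 \<delta>\<close> at \<open>t\<close>.\<close>

definition lratio :: "real \<Rightarrow> real \<Rightarrow> real" where
  "lratio \<delta> z = exp (\<delta> * z - \<delta>\<^sup>2 / 2)"

text \<open>The tangent inequality for the concave function \<open>F1 \<delta>\<close>, parametrised
  by \<open>z\<close>: the slope \<open>lratio \<delta>\<close> increases with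
  \<open>z\<close>, hence decreases with \<open>t = Phi z\<close>.\<close>

lemma Phi_shift_tangent:
  assumes "\<delta> > 0"
  shows "Phi (y - \<delta>) - Phi (z - \<delta>) \<le> lratio \<delta> z * (Phi y - Phi z)"
proof -
  let ?D = "\<lambda>x. Phi (x - \<delta>) - lratio \<delta> z * Phi x"
  have d: "(?D has_real_derivative (lratio \<delta> z - lratio \<delta> x) * std_normal_density x) (at x)" for x
    unfolding lratio_def
    by (auto intro!: derivative_eq_intros Phi_deriv Phi_shift_deriv simp: std_normal_shift algebra_simps)
  have "?D y \<le> ?D z"
  proof (cases "y \<le> z")
    case True
    then show ?thesis
    proof (rule DERIV_nonneg_imp_nondecreasing)
      fix x assume "y \<le> x" "x \<le> z"
      then have "lratio \<delta> x \<le> lratio \<delta> z" using assms by (simp add: lratio_def)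
      then show "\<exists>v. (?D has_real_derivative v) (at x) \<and> v \<ge> 0"
        using d[of x] std_normal_density_nonneg[of x] by (intro exI conjI) auto
    qed
  next
    case False
    then have "z \<le> y" by simp
    then show ?thesis
    proof (rule DERIV_nonpos_imp_nonincreasing)
      fix x assume "z \<le> x" "x \<le> y"
      then have "lratio \<delta> z \<le> lratio \<delta> x" using assms by (simp add: lratio_def)
      then show "\<exists>v. (?D has_real_derivative v) (at x) \<and> v \<le> 0"
        using d[of x] std_normal_density_nonneg[of x]
        by (intro exI conjI) (auto intro: mult_nonpos_nonneg)
    qed
  qed
  then show ?thesis by (simp add: algebra_simps)
qed

lemma Phi_inv_less: "0 < s \<Longrightarrow> s < t \<Longrightarrow> t < 1 \<Longrightarrow> Phi_inv t < Phi_inv s"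
  by (metis Phi_Phi_inv Phi_strict_antimono less_trans linorder_neqE order_less_asym)

lemma Phi_inv_le: "0 < s \<Longrightarrow> s \<le> t \<Longrightarrow> t < 1 \<Longrightarrow> Phi_inv t \<le> Phi_inv s"
  using Phi_inv_less[of s t] by (cases "s = t") auto

lemma Phi_le_iff: "0 < t \<Longrightarrow> t < 1 \<Longrightarrow> Phi x \<le> t \<longleftrightarrow> Phi_inv t \<le> x"
  by (metis Phi_Phi_inv Phi_strict_antimono linorder_not_le order_less_asym order_le_less)

lemma isCont_Phi_inv: "0 < t \<Longrightarrow> t < 1 \<Longrightarrow> isCont Phi_inv t"
  using isCont_inverse_function[of 1 "Phi_inv t" Phi_inv Phi] isCont_Phi
  by (simp add: Phi_Phi_inv)

lemma t_star_props:
  assumes "\<delta> > 0" "0 < \<pi>0" "\<pi>0 < 1" "0 < \<alpha>" "\<alpha> < 1"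
  defines "t \<equiv> t_star \<delta> \<pi>0 \<alpha>"
  shows "0 < t" "t < \<alpha>" "G \<delta> \<pi>0 t = t / \<alpha>"
proof -
  have t: "0 < t \<and> t < 1 \<and> G \<delta> \<pi>0 t = t / \<alpha>"
    unfolding t_def t_star_def by (rule theI'[OF t_star_ex1[OF assms(1-5)]])
  then show "0 < t" "G \<delta> \<pi>0 t = t / \<alpha>" by auto
  have "F1 \<delta> t < 1" using t Phi_lt_1 by (auto simp: F1_def)
  then have "\<pi>0 * t + (1 - \<pi>0) * F1 \<delta> t < \<pi>0 * 1 + (1 - \<pi>0) * 1"
    using t assms by (intro add_strict_mono mult_strict_left_mono) auto
  then have "t / \<alpha> < 1" using t by (simp add: G_def F0_def)
  then show "t < \<alpha>" using assms by simp
qed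

lemma F1_bounds: "0 \<le> F1 \<delta> t" "F1 \<delta> t \<le> 1"
  using Phi_gt_0 Phi_lt_1 by (auto simp: F1_def less_imp_le)

text \<open>At the crossing point the chord of \<open>F1 \<delta>\<close> from 0 is steeper than the
  tangent (\<open>Phi_shift_gt\<close>), which makes \<open>t / \<alpha> - G \<delta>
  \<pi>0 t\<close> increase strictly there. Beyond the crossing point the tangent
  inequality at that point gives a linear lower bound on the whole interval; before it,
  the tangents at nearby points give an upper bound in a neighbourhood.\<close>

lemma crossing_slope:
  assumes \<delta>: "\<delta> > 0" and \<pi>: "0 < \<pi>0" "\<pi>0 < 1" and \<alpha>: "0 < \<alpha>" "\<alpha> < 1"
  defines "ts \<equiv> t_star \<delta> \<pi>0 \<alpha>"
  obtains c a where "c > 0" "a > 0" "a < ts"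
    "\<And>t. 0 < t \<Longrightarrow> t < 1 \<Longrightarrow> ts \<le> t \<Longrightarrow> c * (t - ts) \<le> t / \<alpha> - G \<delta> \<pi>0 t"
    "\<And>t. ts - a \<le> t \<Longrightarrow> t \<le> ts \<Longrightarrow> t / \<alpha> - G \<delta> \<pi>0 t \<le> - c * (ts - t)"
proof -
  note ts = t_star_props[OF \<delta> \<pi> \<alpha>, folded ts_def]
  have ts1: "ts < 1" using ts \<alpha> by simp
  define zs where "zs = Phi_inv ts"
  have Pz: "Phi zs = ts" unfolding zs_def using ts ts1 by (intro Phi_Phi_inv)
  define c where "c = 1 / \<alpha> - \<pi>0 - (1 - \<pi>0) * lratio \<delta> zs"
  have F1s: "F1 \<delta> ts = Phi (zs - \<delta>)" using ts ts1 by (simp add: F1_def zs_def)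
  have "(1 - \<pi>0) * (lratio \<delta> zs * ts) < (1 - \<pi>0) * F1 \<delta> ts"
    using Phi_shift_gt[OF \<delta>, of zs] \<pi> unfolding lratio_def F1s Pz by (intro mult_strict_left_mono) auto
  also have "(1 - \<pi>0) * F1 \<delta> ts = ts / \<alpha> - \<pi>0 * ts" using ts(3) by (simp add: G_def F0_def)
  finally have "0 < c * ts" by (simp add: c_def algebra_simps)
  then have c: "c > 0" using ts(1) by (simp add: zero_less_mult_iff)
  have diff: "t / \<alpha> - G \<delta> \<pi>0 t = (1 / \<alpha> - \<pi>0) * (t - ts) - (1 - \<pi>0) * (F1 \<delta> t - F1 \<delta> ts)" for t
    using ts(3) by (simp add: G_def F0_def algebra_simps diff_divide_distrib)
  have tangent: "F1 \<delta> t - F1 \<delta> s \<le> lratio \<delta> (Phi_inv s) * (t - s)" if "0 < t" "t < 1" "0 < s" "s < 1" for t s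
    using Phi_shift_tangent[OF \<delta>, of "Phi_inv t" "Phi_inv s"] that by (simp add: F1_def Phi_Phi_inv)
  have lower: "(c / 2) * (t - ts) \<le> t / \<alpha> - G \<delta> \<pi>0 t" if t: "0 < t" "t < 1" "ts \<le> t" for t
  proof -
    have "(1 - \<pi>0) * (F1 \<delta> t - F1 \<delta> ts) \<le> (1 - \<pi>0) * (lratio \<delta> zs * (t - ts))"
      using tangent[OF t(1,2) ts(1) ts1] \<pi> unfolding zs_def[symmetric] by (intro mult_left_mono) auto
    then have "c * (t - ts) \<le> t / \<alpha> - G \<delta> \<pi>0 t" unfolding diff c_def by (simp add: algebra_simps)
    moreover have "(c / 2) * (t - ts) \<le> c * (t - ts)" using c t(3) by (intro mult_right_mono) auto
    ultimately show ?thesis by (rule order_trans[rotated])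
  qed
  have "isCont (\<lambda>t. 1 / \<alpha> - \<pi>0 - (1 - \<pi>0) * lratio \<delta> (Phi_inv t)) ts"
    unfolding lratio_def by (intro continuous_intros isCont_Phi_inv ts(1) ts1)
  then have "((\<lambda>t. 1 / \<alpha> - \<pi>0 - (1 - \<pi>0) * lratio \<delta> (Phi_inv t)) \<longlongrightarrow> c) (at ts)"
    unfolding isCont_def c_def zs_def .
  then have "\<forall>\<^sub>F t in at ts. c / 2 < 1 / \<alpha> - \<pi>0 - (1 - \<pi>0) * lratio \<delta> (Phi_inv t)"
    using c by (intro order_tendstoD) auto
  then obtain d where d: "d > 0"
    "\<And>t. t \<noteq> ts \<Longrightarrow> dist t ts < d \<Longrightarrow> c / 2 < 1 / \<alpha> - \<pi>0 - (1 - \<pi>0) * lratio \<delta> (Phi_inv t)"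
    unfolding eventually_at by blast
  define a where "a = min (d / 2) (ts / 2)"
  have a: "a > 0" "a < ts" using d ts(1) by (auto simp: a_def)
  have upper: "t / \<alpha> - G \<delta> \<pi>0 t \<le> - (c / 2) * (ts - t)" if t: "ts - a \<le> t" "t \<le> ts" for t
  proof (cases "t = ts")
    case False
    have t0: "0 < t" "t < 1" using t a ts1 by auto
    have "dist t ts < d" using t d(1) by (auto simp: dist_real_def a_def)
    then have cc: "c / 2 < 1 / \<alpha> - \<pi>0 - (1 - \<pi>0) * lratio \<delta> (Phi_inv t)" using d(2) False by blast
    have "(1 - \<pi>0) * (F1 \<delta> ts - F1 \<delta> t) \<le> (1 - \<pi>0) * (lratio \<delta> (Phi_inv t) * (ts - t))"
      using tangent[OF ts(1) ts1 t0] \<pi> by (intro mult_left_mono) auto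
    then have "t / \<alpha> - G \<delta> \<pi>0 t \<le> - (1 / \<alpha> - \<pi>0 - (1 - \<pi>0) * lratio \<delta> (Phi_inv t)) * (ts - t)"
      unfolding diff by (simp add: algebra_simps diff_divide_distrib)
    also have "\<dots> \<le> - (c / 2) * (ts - t)" using cc t by (intro mult_right_mono) auto
    finally show ?thesis .
  qed (use diff in simp)
  show thesis by (rule that[OF _ a lower upper]) (use c in auto)
qed

section \<open>The Benjamini-Hochberg threshold of a fixed realisation\<close>

lemma emp_cdf_mono: "s \<le> t \<Longrightarrow> emp_cdf m x s \<le> emp_cdf m x t"
  unfolding emp_cdf_def by (intro divide_right_mono sum_mono) auto

lemma emp_cdf_bounds: "0 \<le> emp_cdf m x t" "emp_cdf m x t \<le> 1"
proof -
  show "0 \<le> emp_cdf m x t" unfolding emp_cdf_def by (intro divide_nonneg_nonneg sum_nonneg) auto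
  have "(\<Sum>i=1..m. of_bool (Phi (x i) \<le> t) :: real) \<le> (\<Sum>i=1..m. 1)" by (intro sum_mono) auto
  then show "emp_cdf m x t \<le> 1" unfolding emp_cdf_def by (cases "m = 0") (auto simp: divide_le_eq_1)
qed

text \<open>The supremum is attained since the empirical distribution function is increasing. There
  is equality at \<open>T\<close> because \<open>\<alpha> * emp_cdf m x T\<close> would
  otherwise be a larger admissible point.\<close>

lemma BH_threshold_props:
  fixes m :: nat and x :: "nat \<Rightarrow> real"
  assumes \<alpha>: "0 < \<alpha>" "\<alpha> < 1"
  defines "T \<equiv> BH_threshold \<alpha> m x"
  shows "0 \<le> T" "T \<le> \<alpha>" "emp_cdf m x T = T / \<alpha>"
    and "\<And>t. 0 \<le> t \<Longrightarrow> t \<le> 1 \<Longrightarrow> t / \<alpha> \<le> emp_cdf m x t \<Longrightarrow> t \<le> T"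
proof -
  let ?S = "{t. 0 \<le> t \<and> t \<le> 1 \<and> emp_cdf m x t \<ge> t / \<alpha>}"
  have T: "T = Sup ?S" by (simp add: T_def BH_threshold_def)
  have bdd: "bdd_above ?S" by (rule bdd_aboveI[of _ 1]) auto
  have "0 \<in> ?S" using emp_cdf_bounds by auto
  then have ne: "?S \<noteq> {}" by blast
  have S\<alpha>: "t \<le> \<alpha>" if "t \<in> ?S" for t
  proof -
    have "t / \<alpha> \<le> 1" using that emp_cdf_bounds(2)[of m x t] by simp
    then show ?thesis using \<alpha> by simp
  qed
  show up: "t \<le> T" if "0 \<le> t" "t \<le> 1" "t / \<alpha> \<le> emp_cdf m x t" for t
    unfolding T using that by (intro cSup_upper bdd) auto
  show T0: "0 \<le> T" using up[of 0] emp_cdf_bounds by simp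
  show T1: "T \<le> \<alpha>" unfolding T using ne S\<alpha> by (intro cSup_least) auto
  have "T / \<alpha> \<le> emp_cdf m x T"
  proof (rule ccontr)
    assume "\<not> T / \<alpha> \<le> emp_cdf m x T"
    then have "\<alpha> * emp_cdf m x T < T" using \<alpha> by (simp add: pos_le_divide_eq pos_divide_le_eq not_le mult.commute)
    then obtain t where t: "t \<in> ?S" "\<alpha> * emp_cdf m x T < t"
      unfolding T using less_cSupD[of ?S] ne by blast
    have "t \<le> T" using t up by auto
    then have "t / \<alpha> \<le> emp_cdf m x T" using t(1) emp_cdf_mono[of t T m x] by auto
    then show False using t(2) \<alpha> by (simp add: pos_divide_le_eq mult.commute)
  qed
  moreover have "\<not> T / \<alpha> < emp_cdf m x T"
  proof
    assume "T / \<alpha> < emp_cdf m x T"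
    then have less: "T < \<alpha> * emp_cdf m x T" using \<alpha> by (simp add: pos_divide_less_eq mult.commute)
    define t where "t = \<alpha> * emp_cdf m x T"
    have "t \<le> 1" unfolding t_def using \<alpha> emp_cdf_bounds[of m x T] by (intro mult_le_one) auto
    moreover have "t / \<alpha> \<le> emp_cdf m x t"
      using emp_cdf_mono[of T t m x] less \<alpha> by (simp add: t_def)
    ultimately have "t \<le> T" using T0 less by (intro up) (auto simp: t_def)
    then show False using less by (simp add: t_def)
  qed
  ultimately show "emp_cdf m x T = T / \<alpha>" by simp
qed

lemma FDP_eq:
  fixes m :: nat and x :: "nat \<Rightarrow> real"
  assumes \<alpha>: "0 < \<alpha>" "\<alpha> < 1"
  defines "T \<equiv> BH_threshold \<alpha> m x"
  shows "FDP \<alpha> m H x = \<alpha> * (\<Sum>i=1..m. (1 - H i) * of_bool (Phi (x i) \<le> T)) / (real m * T)"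
proof -
  have e: "emp_cdf m x T = T / \<alpha>" unfolding T_def by (rule BH_threshold_props(3)[OF \<alpha>])
  show ?thesis unfolding FDP_def T_def[symmetric] e using \<alpha> by simp
qed

text \<open>Since the empirical distribution function takes values in the multiples of
  \<open>1 / m\<close>, the threshold is a maximum over finitely many candidates, which makes it
  measurable.\<close>

lemma BH_threshold_eq_Max:
  assumes \<alpha>: "0 < \<alpha>" "\<alpha> < 1"
  shows "BH_threshold \<alpha> m x = Max ((\<lambda>k. if real k / m \<le> emp_cdf m x (\<alpha> * (k / m)) then \<alpha> * (k / m) else 0) ` {0..m})"
    (is "?T = Max (?f ` _)")
proof (rule Max_eqI[symmetric])
  note T = BH_threshold_props[OF \<alpha>, where m=m and x=x]
  show "y \<le> ?T" if y: "y \<in> ?f ` {0..m}" for y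
  proof -
    obtain k where k: "y = ?f k" and "k \<in> {0..m}" using y by (rule imageE)
    then have km: "k \<le> m" by simp
    show ?thesis
    proof (cases "real k / m \<le> emp_cdf m x (\<alpha> * (k / m))")
      case True
      have "real k / m \<le> 1" using km by (cases "m = 0") auto
      then have "\<alpha> * (k / m) \<le> 1" using \<alpha> by (intro mult_le_one) auto
      then have "\<alpha> * (k / m) \<le> ?T" using True \<alpha> by (intro T(4)) auto
      then show ?thesis using True k by simp
    qed (use k T(1) in simp)
  qed
  define k where "k = (\<Sum>i=1..m. of_bool (Phi (x i) \<le> ?T) :: nat)"
  have k: "real k / m = emp_cdf m x ?T" by (simp add: k_def emp_cdf_def)
  have "k \<le> (\<Sum>i=1..m. 1)" unfolding k_def by (intro sum_mono) auto
  then have km: "k \<in> {0..m}" by simp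
  have "\<alpha> * (k / m) = ?T" using k T(3) \<alpha> by simp
  then have "?T = ?f k" using k by (simp only: order_refl if_True)
  then show "?T \<in> ?f ` {0..m}" using km by (rule image_eqI)
qed simp

lemma measurable_FDP:
  assumes \<alpha>: "0 < \<alpha>" "\<alpha> < 1"
    and x: "\<And>i. i \<in> {1..m} \<Longrightarrow> (\<lambda>\<omega>. x \<omega> i) \<in> borel_measurable M"
  shows "(\<lambda>\<omega>. FDP \<alpha> m H (x \<omega>)) \<in> borel_measurable M"
proof -
  have [measurable]: "Phi \<in> borel_measurable borel"
    by (intro borel_measurable_continuous_onI continuous_at_imp_continuous_on) (use isCont_Phi in auto)
  have p [measurable]: "(\<lambda>\<omega>. Phi (x \<omega> i)) \<in> borel_measurable M" if "i \<in> {1..m}" for i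
    using x[OF that] by measurable
  have ob: "(\<lambda>\<omega>. of_bool (Phi (x \<omega> i) \<le> f \<omega>) :: real) \<in> borel_measurable M"
    if "i \<in> {1..m}" and [measurable]: "f \<in> borel_measurable M" for i f
    using p[OF that(1)] unfolding of_bool_def by measurable
  have emp: "(\<lambda>\<omega>. emp_cdf m (x \<omega>) (f \<omega>)) \<in> borel_measurable M" if "f \<in> borel_measurable M" for f
    unfolding emp_cdf_def by (intro borel_measurable_divide borel_measurable_sum ob that) auto
  have "(\<lambda>\<omega>. if real k / m \<le> emp_cdf m (x \<omega>) (\<alpha> * (k / m)) then \<alpha> * (k / m) else 0) \<in> borel_measurable M" for k :: nat
    using emp[of "\<lambda>_. \<alpha> * (k / m)"] by measurable
  then have T: "(\<lambda>\<omega>. BH_threshold \<alpha> m (x \<omega>)) \<in> borel_measurable M"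
    unfolding BH_threshold_eq_Max[OF \<alpha>] by (intro borel_measurable_Max) auto
  show ?thesis
    unfolding FDP_def
    by (intro borel_measurable_divide borel_measurable_sum borel_measurable_times emp T ob borel_measurable_const) auto
qed

section \<open>Localisation of the threshold\<close>

lemma (in prob_space) chebyshev_second_moment:
  assumes [measurable]: "X \<in> borel_measurable M" and "integrable M (\<lambda>\<omega>. (X \<omega>)\<^sup>2)" and "b > 0"
    and "expectation (\<lambda>\<omega>. (X \<omega>)\<^sup>2) \<le> v"
  shows "prob {\<omega> \<in> space M. b \<le> \<bar>X \<omega>\<bar>} \<le> v / b\<^sup>2"
proof -
  have "prob {\<omega> \<in> space M. b \<le> \<bar>X \<omega>\<bar>} \<le> expectation (\<lambda>\<omega>. (X \<omega>)\<^sup>2) / b\<^sup>2"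
    by (rule second_moment_method) (use assms in auto)
  also have "\<dots> \<le> v / b\<^sup>2" using assms by (intro divide_right_mono) auto
  finally show ?thesis .
qed

text \<open>Telescoping with \<open>1 / (j - 1) - 1 / j\<close>.\<close>

lemma sum_inverse_squares_le: "(\<Sum>j=2..n. 1 / (real j)\<^sup>2) \<le> 1"
proof -
  have "(\<Sum>j=2..n. 1 / (real j)\<^sup>2) \<le> 1 - 1 / real n" if "n \<ge> 1" for n
    using that
  proof (induction n rule: dec_induct)
    case (step n)
    have "1 / (real (Suc n))\<^sup>2 \<le> 1 / real n - 1 / real (Suc n)"
    proof -
      have "1 / (real (Suc n))\<^sup>2 \<le> 1 / (real n * real (Suc n))"
        unfolding power2_eq_square using step.hyps by (intro divide_left_mono mult_right_mono) auto
      also have "\<dots> = 1 / real n - 1 / real (Suc n)" using step.hyps by (simp add: field_simps)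
      finally show ?thesis .
    qed
    moreover have "(\<Sum>j=2..Suc n. 1 / (real j)\<^sup>2) = (\<Sum>j=2..n. 1 / (real j)\<^sup>2) + 1 / (real (Suc n))\<^sup>2"
      using step.hyps by (simp add: sum.nat_ivl_Suc')
    ultimately show ?case using step.IH by linarith
  qed simp
  from this[of n] show ?thesis
    by (cases "n = 0") (auto elim: order_trans)
qed

text \<open>One instance of the model, for fixed \<open>m\<close>. Probabilistic input is kept apart
  from the deterministic analysis of a single realisation \<open>\<omega>\<close>.\<close>

locale two_group = gaussian_family M "{1..m}" Y \<Gamma>
  for M :: "'a measure" and m :: nat and Y :: "nat \<Rightarrow> 'a \<Rightarrow> real" and \<Gamma> :: "nat \<Rightarrow> nat \<Rightarrow> real" +
  fixes H :: "nat \<Rightarrow> real" and \<delta> \<alpha> \<pi>0 :: real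
  assumes m_pos: "m \<ge> 1" and H01: "\<And>i. i \<in> {1..m} \<Longrightarrow> H i \<in> {0, 1}"
    and \<delta>: "\<delta> > 0" and \<pi>0: "0 < \<pi>0" "\<pi>0 < 1" and \<alpha>: "0 < \<alpha>" "\<alpha> < 1"
begin

definition I0 :: "nat set" where "I0 = {i \<in> {1..m}. H i = 0}"
definition I1 :: "nat set" where "I1 = {i \<in> {1..m}. H i = 1}"

lemma H_one: "Suc 0 \<le> i \<Longrightarrow> i \<le> m \<Longrightarrow> H i \<noteq> 0 \<Longrightarrow> H i = 1"
  using H01[of i] by auto

lemma H_zero: "Suc 0 \<le> i \<Longrightarrow> i \<le> m \<Longrightarrow> H i \<noteq> 1 \<Longrightarrow> H i = 0"
  using H01[of i] by auto

lemma I01: "I0 \<subseteq> {1..m}" "I1 \<subseteq> {1..m}" "I0 \<inter> I1 = {}" "I0 \<union> I1 = {1..m}"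
  by (auto simp: I0_def I1_def dest: H_zero)

lemma finite_I01: "finite I0" "finite I1"
  by (rule finite_subset[OF I01(1)], simp) (rule finite_subset[OF I01(2)], simp)

lemma sum_I0: "(\<Sum>i=1..m. (1 - H i) * f i) = (\<Sum>i\<in>I0. f i)"
proof -
  have "(\<Sum>i=1..m. (1 - H i) * f i) = (\<Sum>i\<in>I0. (1 - H i) * f i)"
    by (intro sum.mono_neutral_right) (auto simp: I0_def dest: H_one)
  then show ?thesis by (simp add: I0_def)
qed

lemma sum_I1: "(\<Sum>i=1..m. H i * f i) = (\<Sum>i\<in>I1. f i)"
proof -
  have "(\<Sum>i=1..m. H i * f i) = (\<Sum>i\<in>I1. H i * f i)"
    by (intro sum.mono_neutral_right) (auto simp: I1_def dest: H_one)
  then show ?thesis by (simp add: I1_def)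
qed

lemma card_I0: "real (card I0) = m0 m H"
  using sum_I0[of "\<lambda>_. 1"] by (simp add: m0_def)

lemma card_I1: "real (card I1) = m1 m H"
  using sum_I1[of "\<lambda>_. 1"] by (simp add: m1_def)

lemma card_I01: "real (card I0) + real (card I1) = real m"
  using card_Un_disjoint[OF finite_I01 I01(3)] I01(4) by simp

lemma card_le: "real (card I0) \<le> real m" "real (card I1) \<le> real m"
  using card_I01 by auto

lemma E2_eq: "E2 = off_diag_sum m (\<lambda>i j. (\<Gamma> i j)\<^sup>2)"
  unfolding E2_def off_diag_sum_def ..

lemma V_split: "J \<subseteq> {1..m} \<Longrightarrow> V J = card J + (\<Sum>i\<in>J. \<Sum>j\<in>J - {i}. \<Gamma> i j)"
proof -
  assume J: "J \<subseteq> {1..m}"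
  then have fin: "finite J" using finite_subset by auto
  have "V J = (\<Sum>i\<in>J. 1 + (\<Sum>j\<in>J - {i}. \<Gamma> i j))"
    unfolding V_def
  proof (rule sum.cong[OF refl])
    fix i assume i: "i \<in> J"
    show "(\<Sum>j\<in>J. \<Gamma> i j) = 1 + (\<Sum>j\<in>J - {i}. \<Gamma> i j)"
      using sum.remove[OF fin i, of "\<Gamma> i"] \<Gamma>_diag[of i] i J by auto
  qed
  then show ?thesis by (simp add: sum.distrib)
qed

lemma V_I0: "V I0 = m0 m H + (m0 m H)\<^sup>2 * gam0 m H \<Gamma>"
proof -
  have "off_diag_sum m (\<lambda>i j. (1 - H i) * (1 - H j) * \<Gamma> i j) = (\<Sum>i=1..m. (1 - H i) * (\<Sum>j\<in>{1..m} - {i}. (1 - H j) * \<Gamma> i j))"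
    by (simp add: off_diag_sum_def sum_distrib_left mult.assoc)
  also have "\<dots> = (\<Sum>i\<in>I0. \<Sum>j\<in>{1..m} - {i}. (1 - H j) * \<Gamma> i j)" by (rule sum_I0)
  also have "\<dots> = (\<Sum>i\<in>I0. \<Sum>j\<in>I0 - {i}. \<Gamma> i j)"
  proof (rule sum.cong[OF refl])
    fix i assume "i \<in> I0"
    have "(\<Sum>j\<in>{1..m} - {i}. (1 - H j) * \<Gamma> i j) = (\<Sum>j\<in>I0 - {i}. (1 - H j) * \<Gamma> i j)"
      by (intro sum.mono_neutral_right) (auto simp: I0_def dest: H_one)
    then show "(\<Sum>j\<in>{1..m} - {i}. (1 - H j) * \<Gamma> i j) = (\<Sum>j\<in>I0 - {i}. \<Gamma> i j)" by (simp add: I0_def)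
  qed
  finally have *: "off_diag_sum m (\<lambda>i j. (1 - H i) * (1 - H j) * \<Gamma> i j) = (\<Sum>i\<in>I0. \<Sum>j\<in>I0 - {i}. \<Gamma> i j)" .
  show ?thesis
  proof (cases "m0 m H = 0")
    case True
    then have "card I0 = 0" using card_I0 by simp
    then have "I0 = {}" using finite_I01 by simp
    then show ?thesis using True by (simp add: V_def)
  next
    case False
    then show ?thesis unfolding V_split[OF I01(1)] gam0_def * card_I0 by simp
  qed
qed

lemma V_I1: "V I1 = m1 m H + (m1 m H)\<^sup>2 * gam1 m H \<Gamma>"
proof -
  have "off_diag_sum m (\<lambda>i j. H i * H j * \<Gamma> i j) = (\<Sum>i=1..m. H i * (\<Sum>j\<in>{1..m} - {i}. H j * \<Gamma> i j))"
    by (simp add: off_diag_sum_def sum_distrib_left mult.assoc)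
  also have "\<dots> = (\<Sum>i\<in>I1. \<Sum>j\<in>{1..m} - {i}. H j * \<Gamma> i j)" by (rule sum_I1)
  also have "\<dots> = (\<Sum>i\<in>I1. \<Sum>j\<in>I1 - {i}. \<Gamma> i j)"
  proof (rule sum.cong[OF refl])
    fix i assume "i \<in> I1"
    have "(\<Sum>j\<in>{1..m} - {i}. H j * \<Gamma> i j) = (\<Sum>j\<in>I1 - {i}. H j * \<Gamma> i j)"
      by (intro sum.mono_neutral_right) (auto simp: I1_def dest: H_one)
    then show "(\<Sum>j\<in>{1..m} - {i}. H j * \<Gamma> i j) = (\<Sum>j\<in>I1 - {i}. \<Gamma> i j)" by (simp add: I1_def)
  qed
  finally have *: "off_diag_sum m (\<lambda>i j. H i * H j * \<Gamma> i j) = (\<Sum>i\<in>I1. \<Sum>j\<in>I1 - {i}. \<Gamma> i j)" .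
  show ?thesis
  proof (cases "m1 m H = 0")
    case True
    then have "card I1 = 0" using card_I1 by simp
    then have "I1 = {}" using finite_I01 by simp
    then show ?thesis using True by (simp add: V_def)
  next
    case False
    then show ?thesis unfolding V_split[OF I01(2)] gam1_def * card_I1 by simp
  qed
qed

definition x :: "'a \<Rightarrow> nat \<Rightarrow> real" where "x \<omega> i = \<delta> * H i + Y i \<omega>"

definition null_count :: "real \<Rightarrow> 'a \<Rightarrow> real" where
  "null_count t \<omega> = (\<Sum>i=1..m. (1 - H i) * of_bool (Phi (x \<omega> i) \<le> t))"

lemma null_count_eq: "null_count t \<omega> = (\<Sum>i\<in>I0. of_bool (Phi (x \<omega> i) \<le> t))"
  unfolding null_count_def by (rule sum_I0)

lemma null_count_mono: "s \<le> t \<Longrightarrow> null_count s \<omega> \<le> null_count t \<omega>"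
  unfolding null_count_eq by (intro sum_mono) auto

lemma null_count_D:
  fixes t :: real
  assumes t: "0 < t" "t < 1"
  shows "null_count t \<omega> = D I0 (Phi_inv t) \<omega> + card I0 * t"
proof -
  have "null_count t \<omega> = (\<Sum>i\<in>I0. of_bool (Phi_inv t \<le> Y i \<omega>))"
    unfolding null_count_eq by (intro sum.cong refl) (auto simp: Phi_le_iff[OF t] x_def I0_def)
  then show ?thesis by (simp add: D_def sum_subtractf Phi_Phi_inv t)
qed

lemma emp_cdf_D:
  fixes t :: real
  assumes t: "0 < t" "t < 1"
  shows "real m * emp_cdf m (x \<omega>) t = D I0 (Phi_inv t) \<omega> + card I0 * t + D I1 (Phi_inv t - \<delta>) \<omega> + card I1 * F1 \<delta> t"
proof -
  have "real m * emp_cdf m (x \<omega>) t = (\<Sum>i\<in>I0 \<union> I1. of_bool (Phi (x \<omega> i) \<le> t))"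
    unfolding I01(4) using m_pos by (simp add: emp_cdf_def)
  also have "\<dots> = null_count t \<omega> + (\<Sum>i\<in>I1. of_bool (Phi (x \<omega> i) \<le> t))"
    unfolding null_count_eq by (rule sum.union_disjoint[OF finite_I01 I01(3)])
  also have "(\<Sum>i\<in>I1. of_bool (Phi (x \<omega> i) \<le> t)) = (\<Sum>i\<in>I1. of_bool (Phi_inv t - \<delta> \<le> Y i \<omega>) :: real)"
    by (intro sum.cong refl) (auto simp: Phi_le_iff[OF t] x_def I1_def)
  also have "\<dots> = D I1 (Phi_inv t - \<delta>) \<omega> + card I1 * F1 \<delta> t"
    using t by (simp add: D_def sum_subtractf F1_def)
  finally show ?thesis unfolding null_count_D[OF t] by simp
qed

text \<open>Up to the error of the proportion \<open>p\<close>, this dominates \<open>m\<close> times the deviation of the empirical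
  distribution function from \<open>G\<close> at \<open>t\<close>.\<close>

definition A :: "real \<Rightarrow> 'a \<Rightarrow> real" where
  "A t \<omega> = \<bar>D I0 (Phi_inv t) \<omega>\<bar> + \<bar>D I1 (Phi_inv t - \<delta>) \<omega>\<bar>"

definition p :: real where "p = real (card I0) / real m"

lemma emp_cdf_near_G:
  fixes t :: real
  assumes t: "0 < t" "t < 1"
  shows "\<bar>emp_cdf m (x \<omega>) t - G \<delta> \<pi>0 t\<bar> \<le> A t \<omega> / m + \<bar>p - \<pi>0\<bar>"
proof -
  let ?d = "D I0 (Phi_inv t) \<omega> + D I1 (Phi_inv t - \<delta>) \<omega>"
  have p1: "real (card I1) / m = 1 - p"
    using card_I01 m_pos by (simp add: p_def field_simps)
  have "emp_cdf m (x \<omega>) t = (real m * emp_cdf m (x \<omega>) t) / m" using m_pos by simp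
  also have "\<dots> = ?d / m + (p * t + (1 - p) * F1 \<delta> t)"
    unfolding emp_cdf_D[OF t] p1[symmetric] by (simp add: p_def add_divide_distrib)
  finally have e: "emp_cdf m (x \<omega>) t - G \<delta> \<pi>0 t = ?d / m + (p - \<pi>0) * (t - F1 \<delta> t)"
    by (simp add: G_def F0_def algebra_simps)
  have "\<bar>?d / m\<bar> \<le> A t \<omega> / m" 
    unfolding A_def by (simp add: abs_divide divide_right_mono abs_triangle_ineq)
  moreover have "\<bar>(p - \<pi>0) * (t - F1 \<delta> t)\<bar> \<le> \<bar>p - \<pi>0\<bar> * 1"
    unfolding abs_mult using F1_bounds[of \<delta> t] t by (intro mult_left_mono) auto
  ultimately show ?thesis
    unfolding e mult_1_right by (rule order_trans[OF abs_triangle_ineq add_mono])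
qed

lemma measurable_A [measurable]: "A t \<in> borel_measurable M"
  using measurable_D[OF I01(1)] measurable_D[OF I01(2)] unfolding A_def by measurable

lemma prob_A_ge:
  fixes b t v :: real
  assumes "b > 0" and "expectation (\<lambda>\<omega>. (D I0 (Phi_inv t) \<omega>)\<^sup>2) \<le> v" "expectation (\<lambda>\<omega>. (D I1 (Phi_inv t - \<delta>) \<omega>)\<^sup>2) \<le> v"
  shows "prob {\<omega> \<in> space M. b \<le> A t \<omega>} \<le> 8 * v / b\<^sup>2"
proof -
  note [measurable] = measurable_D[OF I01(1)] measurable_D[OF I01(2)]
  let ?S0 = "{\<omega> \<in> space M. b / 2 \<le> \<bar>D I0 (Phi_inv t) \<omega>\<bar>}" and ?S1 = "{\<omega> \<in> space M. b / 2 \<le> \<bar>D I1 (Phi_inv t - \<delta>) \<omega>\<bar>}"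
  have "prob {\<omega> \<in> space M. b \<le> A t \<omega>} \<le> prob (?S0 \<union> ?S1)"
    by (rule finite_measure_mono) (auto simp: A_def)
  also have "\<dots> \<le> prob ?S0 + prob ?S1" by (rule measure_Un_le) measurable
  also have "\<dots> \<le> v / (b / 2)\<^sup>2 + v / (b / 2)\<^sup>2"
    using assms D_second_moment(1)[OF I01(1) order_refl] D_second_moment(1)[OF I01(2) order_refl]
    by (intro add_mono chebyshev_second_moment) auto
  also have "\<dots> = 8 * v / b\<^sup>2" by (simp add: power_divide)
  finally show ?thesis .
qed

definition ts :: real where "ts = t_star \<delta> \<pi>0 \<alpha>"
definition T :: "'a \<Rightarrow> real" where "T \<omega> = BH_threshold \<alpha> m (x \<omega>)"

lemma ts: "0 < ts" "ts < \<alpha>" "ts < 1"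
  using t_star_props[OF \<delta> \<pi>0 \<alpha>] \<alpha> by (auto simp: ts_def)

text \<open>Below \<open>ts\<close> it suffices that one point is admissible in the definition of
  the threshold. Above it, if \<open>T\<close> lies between two consecutive grid points,
  then the empirical distribution function at the right one is at least \<open>T /
  \<alpha>\<close>, which the slope at the crossing makes impossible unless the count
  deviates by an amount proportional to \<open>j\<close>. The grid may stop at \<open>(1 +
  \<alpha>) / 2\<close> since \<open>T \<le> \<alpha>\<close>; the bound on
  \<open>J0\<close> lets the slope absorb the mesh of the grid.\<close>

lemma threshold_localised:
  fixes c a \<kappa> :: real and J0 :: nat
  assumes c: "c > 0" "a > 0" "a < ts"
    and lower: "\<And>t. 0 < t \<Longrightarrow> t < 1 \<Longrightarrow> ts \<le> t \<Longrightarrow> c * (t - ts) \<le> t / \<alpha> - G \<delta> \<pi>0 t"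
    and upper: "\<And>t. ts - a \<le> t \<Longrightarrow> t \<le> ts \<Longrightarrow> t / \<alpha> - G \<delta> \<pi>0 t \<le> - c * (ts - t)"
    and \<kappa>: "\<kappa> > 0" and d: "\<bar>p - \<pi>0\<bar> \<le> (c / 4) * \<kappa>" and J0: "real J0 \<ge> 2 / (c * \<alpha>)" "J0 \<ge> 1"
    and small: "J0 * \<kappa> \<le> a" "\<kappa> \<le> (1 - \<alpha>) / 2"
    and A1: "A (ts - J0 * \<kappa>) \<omega> < (c / 4) * J0 * \<kappa> * m"
    and A2: "\<And>j. J0 < j \<Longrightarrow> ts + j * \<kappa> \<le> (1 + \<alpha>) / 2 \<Longrightarrow> A (ts + j * \<kappa>) \<omega> < (c / 4) * j * \<kappa> * m"
  shows "\<bar>T \<omega> - ts\<bar> \<le> J0 * \<kappa>"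
proof -
  note T = BH_threshold_props[OF \<alpha>, where m=m and x="x \<omega>", folded T_def]
  have m0: "real m > 0" using m_pos by simp
  have "ts - J0 * \<kappa> \<le> T \<omega>"
  proof (rule T(4))
    let ?t = "ts - J0 * \<kappa>"
    have "0 \<le> J0 * \<kappa>" using \<kappa> by simp
    then have t: "0 < ?t" "?t < 1" using small(1) c(3) ts by linarith+
    then show "0 \<le> ?t" "?t \<le> 1" by auto
    have "A ?t \<omega> / m < c * (J0 * \<kappa>) / 4" using A1 m0 by (simp add: pos_divide_less_eq mult_ac)
    moreover have "?t / \<alpha> - G \<delta> \<pi>0 ?t \<le> - (c * (J0 * \<kappa>))"
      using upper[of ?t] small \<kappa> by simp
    moreover have "\<bar>p - \<pi>0\<bar> \<le> c * (J0 * \<kappa>) / 4"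
    proof -
      have "c * \<kappa> \<le> c * (J0 * \<kappa>)" using J0(2) \<kappa> c by (intro mult_left_mono) auto
      then show ?thesis using d by simp
    qed
    moreover have "0 < c * (J0 * \<kappa>)" using c \<kappa> J0 by simp
    moreover note emp_cdf_near_G[OF t, of \<omega>]
    moreover have "e \<ge> u" if "b < y / 4" "u - g \<le> - y" "q \<le> y / 4" "0 < y" "\<bar>e - g\<bar> \<le> b + q" for b y u g q e :: real
      using that by linarith
    ultimately show "?t / \<alpha> \<le> emp_cdf m (x \<omega>) ?t" by blast
  qed
  moreover have "T \<omega> \<le> ts + J0 * \<kappa>"
  proof (rule ccontr)
    assume "\<not> T \<omega> \<le> ts + J0 * \<kappa>"
    then have gt: "J0 * \<kappa> < T \<omega> - ts" by simp
    define k where "k = nat \<lfloor>(T \<omega> - ts) / \<kappa>\<rfloor>"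
    have q0: "real J0 < (T \<omega> - ts) / \<kappa>" using gt \<kappa> by (simp add: pos_less_divide_eq)
    then have fl: "0 \<le> (T \<omega> - ts) / \<kappa>" by (meson le_less_trans less_imp_le of_nat_0_le_iff)
    have k1: "real k \<le> (T \<omega> - ts) / \<kappa>" unfolding k_def using fl by simp
    have k2: "(T \<omega> - ts) / \<kappa> < real k + 1" unfolding k_def using fl by linarith
    have Jk: "J0 \<le> k" unfolding k_def using q0 by (simp add: le_nat_floor)
    define j where "j = Suc k"
    let ?u = "ts + real j * \<kappa>"
    have u1: "?u - \<kappa> \<le> T \<omega>" using k1 \<kappa> by (simp add: j_def pos_le_divide_eq algebra_simps)
    have u2: "T \<omega> \<le> ?u" using k2 \<kappa> by (simp add: j_def pos_divide_less_eq algebra_simps)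
    have u\<beta>: "?u \<le> (1 + \<alpha>) / 2" using u1 T(2) small(2) by (simp add: field_simps)
    have u: "0 < ?u" "?u < 1" "ts \<le> ?u" using u\<beta> \<alpha> ts \<kappa> by (auto intro: add_pos_nonneg)
    have "A ?u \<omega> < (c / 4) * j * \<kappa> * m" using Jk u\<beta> by (intro A2) (auto simp: j_def)
    then have Am: "A ?u \<omega> / m < c * (j * \<kappa>) / 4" using m0 by (simp add: pos_divide_less_eq mult_ac)
    have "(?u - \<kappa>) / \<alpha> \<le> T \<omega> / \<alpha>" using u1 \<alpha> by (intro divide_right_mono) auto
    also have "\<dots> \<le> emp_cdf m (x \<omega>) ?u" using T(3) emp_cdf_mono[OF u2, of m "x \<omega>"] by simp
    finally have "?u / \<alpha> - \<kappa> / \<alpha> \<le> emp_cdf m (x \<omega>) ?u" by (simp add: diff_divide_distrib)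
    moreover have "c * (?u - ts) \<le> ?u / \<alpha> - G \<delta> \<pi>0 ?u" by (rule lower[OF u])
    moreover have "\<bar>p - \<pi>0\<bar> \<le> c * (j * \<kappa>) / 4"
    proof -
      have "c * \<kappa> \<le> c * (j * \<kappa>)" using \<kappa> c by (intro mult_left_mono) (auto simp: j_def)
      then show ?thesis using d by simp
    qed
    moreover note emp_cdf_near_G[OF u(1,2), of \<omega>] Am
    moreover have "y < k + y / 2" if "v - k \<le> e" "y \<le> v - g" "q \<le> y / 4" "\<bar>e - g\<bar> \<le> b + q" "b < y / 4" for v k e y g q b :: real
      using that by linarith
    ultimately have "c * (j * \<kappa>) < \<kappa> / \<alpha> + c * (j * \<kappa>) / 2" by (simp only: add_diff_cancel_left')
    then have "c * (j * \<kappa>) / 2 < \<kappa> / \<alpha>" by linarith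
    then have "(c / 2 * j) * \<kappa> < (1 / \<alpha>) * \<kappa>" by (simp add: mult_ac)
    then have "c / 2 * j < 1 / \<alpha>" using \<kappa> by (rule mult_right_less_imp_less[OF _ less_imp_le])
    then have "real j < 2 / (c * \<alpha>)" using c \<alpha> by (simp add: field_simps)
    then show False using J0 Jk by (simp add: j_def)
  qed
  ultimately show ?thesis by (simp add: abs_le_iff)
qed

text \<open>Between two neighbouring grid points the count is monotone, so that its deviation from
  the linear function is at most that at the grid points plus the increment \<open>e *
  m\<close> of the linear function.\<close>

lemma null_modulus:
  fixes K e :: real and N :: nat
  assumes K: "\<bar>T \<omega> - ts\<bar> \<le> K" and e: "e > 0" and N: "K / e \<le> real N"
    and small: "0 < ts - (N + 1) * e" "ts + (N + 1) * e < 1"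
    and grid: "\<And>j :: int. - int N \<le> j \<Longrightarrow> j \<le> int N + 1 \<Longrightarrow> \<bar>D I0 (Phi_inv (ts + j * e)) \<omega> - D I0 (Phi_inv ts) \<omega>\<bar> \<le> e * m"
  shows "\<bar>null_count (T \<omega>) \<omega> - card I0 * T \<omega> - D I0 (Phi_inv ts) \<omega>\<bar> \<le> 2 * e * m"
proof -
  define j where "j = \<lfloor>(T \<omega> - ts) / e\<rfloor>"
  have "\<bar>(T \<omega> - ts) / e\<bar> \<le> real N"
    using K N e by (simp add: abs_divide) (meson divide_right_mono less_imp_le order_trans)
  from this[unfolded abs_le_iff] have q: "- real N \<le> (T \<omega> - ts) / e" "(T \<omega> - ts) / e \<le> real N" by linarith+
  have j1: "- int N \<le> j" unfolding j_def using q(1) by (simp add: le_floor_iff)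
  have j2: "j \<le> int N" unfolding j_def using q(2) by (simp add: floor_le_iff)
  have f1: "real_of_int j \<le> (T \<omega> - ts) / e" "(T \<omega> - ts) / e < real_of_int j + 1" unfolding j_def by linarith+
  let ?s = "ts + j * e" and ?t = "ts + real_of_int (j + 1) * e"
  have s: "?s \<le> T \<omega>" using f1(1) e by (simp add: pos_le_divide_eq algebra_simps)
  have t: "T \<omega> \<le> ?t" using f1(2) e by (simp add: pos_divide_less_eq algebra_simps)
  have ts_: "?t = ?s + e" by (simp add: algebra_simps)
  have b1: "real_of_int j * e \<le> (N + 1) * e" "(real_of_int j + 1) * e \<le> (N + 1) * e" using j2 e by (auto intro!: mult_right_mono)
  have "- real (N + 1) * e \<le> real_of_int j * e" using j1 e by (intro mult_right_mono) auto
  then have "- (real (N + 1) * e) \<le> real_of_int j * e" by (simp only: minus_mult_left)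
  then have s01: "0 < ?s" "?s < 1" using small b1 by linarith+
  have t01: "0 < ?t" using s01 e unfolding ts_ by linarith
  have "?t = ts + (real_of_int j + 1) * e" by simp
  then have t01': "?t < 1" using small b1 by linarith
  note t01 = t01 t01'
  have gs: "\<bar>D I0 (Phi_inv ?s) \<omega> - D I0 (Phi_inv ts) \<omega>\<bar> \<le> e * m" using j1 j2 by (intro grid) auto
  have gt: "\<bar>D I0 (Phi_inv ?t) \<omega> - D I0 (Phi_inv ts) \<omega>\<bar> \<le> e * m" using j1 j2 by (intro grid) auto
  have "null_count ?s \<omega> \<le> null_count (T \<omega>) \<omega>" "null_count (T \<omega>) \<omega> \<le> null_count ?t \<omega>"
    using s t by (auto intro: null_count_mono)
  then have nc: "D I0 (Phi_inv ?s) \<omega> + card I0 * ?s \<le> null_count (T \<omega>) \<omega>" "null_count (T \<omega>) \<omega> \<le> D I0 (Phi_inv ?t) \<omega> + card I0 * ?t"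
    unfolding null_count_D[OF s01] null_count_D[OF t01] .
  have "card I0 * (T \<omega> - ?s) \<le> m * e" "card I0 * (?t - T \<omega>) \<le> m * e"
    using s t ts_ card_le(1) by (auto intro!: mult_mono)
  moreover have "\<bar>n - y - d\<bar> \<le> 2 * z"
    if "v + b \<le> n" "n \<le> w + q" "\<bar>v - d\<bar> \<le> z" "\<bar>w - d\<bar> \<le> z" "y - b \<le> z" "q - y \<le> z" for n y d z v b w q :: real
    using that by linarith
  ultimately show ?thesis using nc gs gt unfolding right_diff_distrib mult.assoc mult.commute[of e] by blast
qed

lemma FDP_T: "FDP \<alpha> m H (x \<omega>) = \<alpha> * null_count (T \<omega>) \<omega> / (m * T \<omega>)"
  unfolding FDP_eq[OF \<alpha>] null_count_def T_def ..

text \<open>The three error terms come from the proportion of true nulls, from the variation of the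
  count between \<open>ts\<close> and the threshold, and from the replacement of
  \<open>\<pi>0 * T\<close> by \<open>p * ts\<close> in the denominator.\<close>

lemma FDP_linearisation:
  fixes s cs \<tau> K \<eta> K' :: real
  assumes s: "s \<ge> cs * \<tau>" "cs > 0" "\<tau> > 0" and K: "\<bar>T \<omega> - ts\<bar> \<le> K * \<tau>" "K * \<tau> \<le> ts / 2"
    and mod: "\<bar>null_count (T \<omega>) \<omega> - card I0 * T \<omega> - D I0 (Phi_inv ts) \<omega>\<bar> \<le> 2 * \<eta> * \<tau> * m"
    and D: "\<bar>D I0 (Phi_inv ts) \<omega>\<bar> \<le> K' * \<tau> * m" and p2: "p \<ge> \<pi>0 / 2"
  shows "\<bar>(FDP \<alpha> m H (x \<omega>) - \<pi>0 * \<alpha>) / (\<pi>0 * \<alpha> * s) - D I0 (Phi_inv ts) \<omega> / (card I0 * ts * s)\<bar>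
    \<le> \<bar>p - \<pi>0\<bar> / \<tau> / (\<pi>0 * cs) + 4 * \<eta> / (\<pi>0 * ts * cs) + K' / cs * (4 * (\<bar>p - \<pi>0\<bar> + K * \<tau>) / (\<pi>0\<^sup>2 * ts\<^sup>2))"
proof -
  define d where "d = D I0 (Phi_inv ts) \<omega>"
  define r where "r = null_count (T \<omega>) \<omega> - card I0 * T \<omega> - d"
  define t where "t = T \<omega>"
  have s0: "s > 0" using s by (meson less_le_trans mult_pos_pos)
  have cst: "0 < cs * \<tau>" using s by simp
  have m0: "real m > 0" using m_pos by simp
  have t: "t \<ge> ts / 2" using K unfolding t_def by (auto simp: abs_le_iff)
  then have t0: "t > 0" using ts by simp
  have p0: "p > 0" using p2 \<pi>0 by simp
  have cardI0: "real (card I0) = p * m" using m0 by (simp add: p_def)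
  have t1: "t \<le> 1" using BH_threshold_props(2)[OF \<alpha>, of m "x \<omega>"] \<alpha> by (simp add: t_def T_def)
  have K'0: "0 \<le> K'"
  proof -
    have "0 \<le> K' * (\<tau> * m)" using D by (simp add: mult.assoc) 
    moreover have "0 < \<tau> * m" using s(3) m0 by simp
    ultimately show ?thesis using mult_neg_pos[of K' "\<tau> * m"] by linarith
  qed
  have FDP: "FDP \<alpha> m H (x \<omega>) = \<alpha> * (p * m * t + d + r) / (m * t)"
    unfolding FDP_T r_def t_def cardI0 by simp
  have eq: "(FDP \<alpha> m H (x \<omega>) - \<pi>0 * \<alpha>) / (\<pi>0 * \<alpha> * s) - d / (card I0 * ts * s) =
      (p - \<pi>0) / (\<pi>0 * s) + r / (\<pi>0 * m * t * s) + d / (m * s) * (1 / (\<pi>0 * t) - 1 / (p * ts))"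
    unfolding FDP cardI0 using \<alpha> \<pi>0 s0 m0 t0 p0 ts by (simp add: field_simps)
  have 1: "\<bar>(p - \<pi>0) / (\<pi>0 * s)\<bar> \<le> \<bar>p - \<pi>0\<bar> / \<tau> / (\<pi>0 * cs)"
  proof -
    have "\<bar>(p - \<pi>0) / (\<pi>0 * s)\<bar> = \<bar>p - \<pi>0\<bar> / (\<pi>0 * s)" using \<pi>0 s0 by (simp add: abs_divide abs_mult)
    also have "\<dots> \<le> \<bar>p - \<pi>0\<bar> / (\<pi>0 * (cs * \<tau>))"
      using s cst \<pi>0 s0 by (intro divide_left_mono mult_left_mono mult_pos_pos) auto
    finally show ?thesis by (simp add: mult_ac)
  qed
  have 2: "\<bar>r / (\<pi>0 * m * t * s)\<bar> \<le> 4 * \<eta> / (\<pi>0 * ts * cs)"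
  proof -
    have "\<bar>r / (\<pi>0 * m * t * s)\<bar> = \<bar>r\<bar> / (\<pi>0 * m * t * s)" using \<pi>0 s0 m0 t0 by (simp add: abs_divide abs_mult)
    also have "\<dots> \<le> (2 * \<eta> * \<tau> * m) / (\<pi>0 * m * (ts / 2) * (cs * \<tau>))"
    proof (rule frac_le)
      show "\<bar>r\<bar> \<le> 2 * \<eta> * \<tau> * m" using mod unfolding r_def d_def .
      then show "0 \<le> 2 * \<eta> * \<tau> * m" using abs_ge_zero order_trans by blast
      show "0 < \<pi>0 * m * (ts / 2) * (cs * \<tau>)" using \<pi>0 m0 ts cst by simp
      show "\<pi>0 * m * (ts / 2) * (cs * \<tau>) \<le> \<pi>0 * m * t * s"
        using \<pi>0 m0 ts cst t t0 s by (intro mult_mono) auto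
    qed
    also have "\<dots> = 4 * \<eta> / (\<pi>0 * ts * cs)" using m0 s \<pi>0 ts by (simp add: field_simps)
    finally show ?thesis .
  qed
  have 3: "\<bar>d / (m * s) * (1 / (\<pi>0 * t) - 1 / (p * ts))\<bar> \<le> K' / cs * (4 * (\<bar>p - \<pi>0\<bar> + K * \<tau>) / (\<pi>0\<^sup>2 * ts\<^sup>2))"
    unfolding abs_mult
  proof (rule mult_mono)
    have "\<bar>d / (m * s)\<bar> = \<bar>d\<bar> / (m * s)" using s0 m0 by (simp add: abs_divide abs_mult)
    also have "\<dots> \<le> (K' * \<tau> * m) / (m * (cs * \<tau>))"
      using D s0 m0 cst s K'0 unfolding d_def by (intro frac_le mult_left_mono) auto
    also have "\<dots> = K' / cs" using m0 s by simp
    finally show "\<bar>d / (m * s)\<bar> \<le> K' / cs" .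
    have "1 / (\<pi>0 * t) - 1 / (p * ts) = (p * ts - \<pi>0 * t) / ((\<pi>0 * t) * (p * ts))"
      using \<pi>0 t0 p0 ts by (simp add: field_simps)
    then have "\<bar>1 / (\<pi>0 * t) - 1 / (p * ts)\<bar> = \<bar>p * ts - \<pi>0 * t\<bar> / ((\<pi>0 * t) * (p * ts))"
      using \<pi>0 t0 p0 ts by (simp add: abs_divide abs_mult)
    also have "\<dots> \<le> (\<bar>p - \<pi>0\<bar> + K * \<tau>) / ((\<pi>0 * (ts / 2)) * ((\<pi>0 / 2) * ts))"
    proof (rule frac_le)
      have "p * ts - \<pi>0 * t = (p - \<pi>0) * ts + \<pi>0 * (ts - t)" by (simp add: algebra_simps)
      also have "\<bar>\<dots>\<bar> \<le> \<bar>p - \<pi>0\<bar> * ts + \<pi>0 * \<bar>ts - t\<bar>"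
        using abs_triangle_ineq[of "(p - \<pi>0) * ts" "\<pi>0 * (ts - t)"] \<pi>0 ts by (simp add: abs_mult)
      also have "\<dots> \<le> \<bar>p - \<pi>0\<bar> * 1 + 1 * (K * \<tau>)"
        using \<pi>0 ts K by (intro add_mono mult_mono) (auto simp: t_def abs_minus_commute)
      finally show "\<bar>p * ts - \<pi>0 * t\<bar> \<le> \<bar>p - \<pi>0\<bar> + K * \<tau>" by simp
      then show "0 \<le> \<bar>p - \<pi>0\<bar> + K * \<tau>" using abs_ge_zero order_trans by blast
      show "0 < (\<pi>0 * (ts / 2)) * ((\<pi>0 / 2) * ts)" using \<pi>0 ts by simp
      show "(\<pi>0 * (ts / 2)) * ((\<pi>0 / 2) * ts) \<le> (\<pi>0 * t) * (p * ts)"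
        using \<pi>0 ts t t0 p2 p0 by (intro mult_mono) auto
    qed
    also have "\<dots> = 4 * (\<bar>p - \<pi>0\<bar> + K * \<tau>) / (\<pi>0\<^sup>2 * ts\<^sup>2)" using \<pi>0 ts by (simp add: field_simps power2_eq_square)
    finally show "\<bar>1 / (\<pi>0 * t) - 1 / (p * ts)\<bar> \<le> 4 * (\<bar>p - \<pi>0\<bar> + K * \<tau>) / (\<pi>0\<^sup>2 * ts\<^sup>2)" .
  qed (use K'0 s in auto)
  show ?thesis unfolding d_def[symmetric] eq using 1 2 3 by linarith
qed

text \<open>The exceptional events are: the count deviates at the single point to the left of
  \<open>ts\<close> (\<open>B1\<close>) or at a point of the long grid to the right
  (\<open>B2\<close>), the increment is large at a point of the fine grid
  (\<open>B3\<close>), or the main term itself is large (\<open>B4\<close>). By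
  Chebyshev's inequality the \<open>j\<close>-th event of the long grid has probability of
  order \<open>1 / (\<kappa> j)\<^sup>2\<close>, so that the bound does not depend on the
  length of the grid, which grows with \<open>m\<close>.\<close>

lemma FDP_linearisation_prob:
  fixes c a \<kappa> \<tau> \<eta> cs s K' Cv w :: real and J0 N :: nat
  assumes c: "c > 0" "a > 0" "a < ts"
    and lower: "\<And>t. 0 < t \<Longrightarrow> t < 1 \<Longrightarrow> ts \<le> t \<Longrightarrow> c * (t - ts) \<le> t / \<alpha> - G \<delta> \<pi>0 t"
    and upper: "\<And>t. ts - a \<le> t \<Longrightarrow> t \<le> ts \<Longrightarrow> t / \<alpha> - G \<delta> \<pi>0 t \<le> - c * (ts - t)"
    and pos: "\<kappa> > 0" "\<tau> > 0" "\<eta> > 0" "cs > 0" "K' > 0"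
    and d: "\<bar>p - \<pi>0\<bar> \<le> (c / 4) * (\<kappa> * \<tau>)" and J0: "real J0 \<ge> 2 / (c * \<alpha>)" "J0 \<ge> 1"
    and small: "J0 * (\<kappa> * \<tau>) \<le> a" "\<kappa> * \<tau> \<le> (1 - \<alpha>) / 2" "J0 * \<kappa> * \<tau> \<le> ts / 2"
    and N: "J0 * \<kappa> / \<eta> \<le> real N"
    and grid: "0 < ts - (N + 1) * (\<eta> * \<tau>)" "ts + (N + 1) * (\<eta> * \<tau>) < 1"
    and s: "s \<ge> cs * \<tau>" and p2: "p \<ge> \<pi>0 / 2"
    and v0: "\<And>t. ts - a \<le> t \<Longrightarrow> t \<le> (1 + \<alpha>) / 2 \<Longrightarrow> expectation (\<lambda>\<omega>. (D I0 (Phi_inv t) \<omega>)\<^sup>2) \<le> Cv * (m * \<tau>)\<^sup>2"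
    and v1: "\<And>t. ts - a \<le> t \<Longrightarrow> t \<le> (1 + \<alpha>) / 2 \<Longrightarrow> expectation (\<lambda>\<omega>. (D I1 (Phi_inv t - \<delta>) \<omega>)\<^sup>2) \<le> Cv * (m * \<tau>)\<^sup>2"
    and w: "\<And>j :: int. - int N \<le> j \<Longrightarrow> j \<le> int N + 1 \<Longrightarrow>
      expectation (\<lambda>\<omega>. (D I0 (Phi_inv (ts + j * (\<eta> * \<tau>))) \<omega> - D I0 (Phi_inv ts) \<omega>)\<^sup>2) \<le> w * (m * \<tau>)\<^sup>2"
  shows "prob {\<omega> \<in> space M. \<bar>p - \<pi>0\<bar> / \<tau> / (\<pi>0 * cs) + 4 * \<eta> / (\<pi>0 * ts * cs) + K' / cs * (4 * (\<bar>p - \<pi>0\<bar> + J0 * \<kappa> * \<tau>) / (\<pi>0\<^sup>2 * ts\<^sup>2))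
      < \<bar>(FDP \<alpha> m H (x \<omega>) - \<pi>0 * \<alpha>) / (\<pi>0 * \<alpha> * s) - D I0 (Phi_inv ts) \<omega> / (card I0 * ts * s)\<bar>}
    \<le> 256 * Cv / (c\<^sup>2 * \<kappa>\<^sup>2) + (2 * real N + 2) * (w / \<eta>\<^sup>2) + Cv / K'\<^sup>2"
    (is "prob ?S \<le> _")
proof -
  note [measurable] = measurable_D[OF I01(1)] measurable_D[OF I01(2)]
  have mt: "0 < m * \<tau>" using m_pos pos by simp
  have \<kappa>\<tau>: "0 < \<kappa> * \<tau>" and \<eta>\<tau>: "0 < \<eta> * \<tau>" using pos by auto
  have \<beta>: "ts \<le> (1 + \<alpha>) / 2" using ts \<alpha> by (simp add: field_simps)
  let ?b = "\<lambda>j. (c / 4) * j * (\<kappa> * \<tau>) * m"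
  define J where "J = {j \<in> {2..nat \<lceil>(1 + \<alpha>) / 2 / (\<kappa> * \<tau>)\<rceil>}. ts + real j * (\<kappa> * \<tau>) \<le> (1 + \<alpha>) / 2}"
  define B1 where "B1 = {\<omega> \<in> space M. ?b J0 \<le> A (ts - J0 * (\<kappa> * \<tau>)) \<omega>}"
  define B2 where "B2 j = {\<omega> \<in> space M. ?b j \<le> A (ts + real j * (\<kappa> * \<tau>)) \<omega>}" for j :: nat
  define B3 where "B3 j = {\<omega> \<in> space M. \<eta> * \<tau> * m \<le> \<bar>D I0 (Phi_inv (ts + real_of_int j * (\<eta> * \<tau>))) \<omega> - D I0 (Phi_inv ts) \<omega>\<bar>}" for j :: int
  define B4 where "B4 = {\<omega> \<in> space M. K' * \<tau> * m \<le> \<bar>D I0 (Phi_inv ts) \<omega>\<bar>}"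
  have meas [measurable]: "B1 \<in> sets M" "B2 j \<in> sets M" "B3 k \<in> sets M" "B4 \<in> sets M" for j k
    unfolding B1_def B2_def B3_def B4_def by measurable
  have fin: "finite J" "finite {- int N..int N + 1}" by (auto simp: J_def)
  have sub: "?S \<subseteq> B1 \<union> (\<Union>j\<in>J. B2 j) \<union> (\<Union>j\<in>{- int N..int N + 1}. B3 j) \<union> B4"
  proof
    fix \<omega> assume \<omega>: "\<omega> \<in> ?S"
    then have sp: "\<omega> \<in> space M" by simp
    show "\<omega> \<in> B1 \<union> (\<Union>j\<in>J. B2 j) \<union> (\<Union>j\<in>{- int N..int N + 1}. B3 j) \<union> B4"
    proof (rule ccontr)
      assume "\<omega> \<notin> B1 \<union> (\<Union>j\<in>J. B2 j) \<union> (\<Union>j\<in>{- int N..int N + 1}. B3 j) \<union> B4"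
      then have n1: "\<omega> \<notin> B1" and n2: "\<And>j. j \<in> J \<Longrightarrow> \<omega> \<notin> B2 j"
        and n3: "\<And>j. j \<in> {- int N..int N + 1} \<Longrightarrow> \<omega> \<notin> B3 j" and n4: "\<omega> \<notin> B4" by auto
      have loc: "\<bar>T \<omega> - ts\<bar> \<le> J0 * (\<kappa> * \<tau>)"
      proof (rule threshold_localised[OF c lower upper _ d J0 small(1,2)])
        show "A (ts - J0 * (\<kappa> * \<tau>)) \<omega> < ?b J0" using n1 sp by (simp add: B1_def not_le)
        fix j assume j: "J0 < j" "ts + real j * (\<kappa> * \<tau>) \<le> (1 + \<alpha>) / 2"
        then have "real j * (\<kappa> * \<tau>) \<le> (1 + \<alpha>) / 2" using ts by linarith
        then have "real j \<le> (1 + \<alpha>) / 2 / (\<kappa> * \<tau>)" using pos by (simp add: pos_le_divide_eq)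
        then have "j \<le> nat \<lceil>(1 + \<alpha>) / 2 / (\<kappa> * \<tau>)\<rceil>" by linarith
        then have "j \<in> J" using j J0(2) by (simp add: J_def)
        then show "A (ts + real j * (\<kappa> * \<tau>)) \<omega> < ?b j" using n2 sp by (simp add: B2_def not_le)
      qed (use \<kappa>\<tau> in auto)
      have mod: "\<bar>null_count (T \<omega>) \<omega> - card I0 * T \<omega> - D I0 (Phi_inv ts) \<omega>\<bar> \<le> 2 * (\<eta> * \<tau>) * m"
      proof (rule null_modulus[OF loc _ _ grid])
        show "J0 * (\<kappa> * \<tau>) / (\<eta> * \<tau>) \<le> real N" using N pos by (simp add: mult.assoc[symmetric])
        fix j assume "- int N \<le> j" "j \<le> int N + 1"
        then have "\<omega> \<notin> B3 j" by (intro n3) auto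
        then show "\<bar>D I0 (Phi_inv (ts + real_of_int j * (\<eta> * \<tau>))) \<omega> - D I0 (Phi_inv ts) \<omega>\<bar> \<le> \<eta> * \<tau> * m"
          using sp by (simp add: B3_def)
      qed (rule \<eta>\<tau>)
      have "\<bar>D I0 (Phi_inv ts) \<omega>\<bar> \<le> K' * \<tau> * m" using n4 sp by (simp add: B4_def)
      from FDP_linearisation[OF s pos(4,2) _ small(3) _ this p2, of \<eta>] loc mod
      have "\<omega> \<notin> ?S" by (simp add: mult.assoc not_less)
      then show False using \<omega> by blast
    qed
  qed
  have P1: "prob B1 \<le> 128 * Cv / (c\<^sup>2 * \<kappa>\<^sup>2)"
  proof -
    have J1: "1 \<le> real J0" using J0(2) by simp
    have b: "(c / 4) * \<kappa> * (m * \<tau>) \<le> ?b J0"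
      using mult_right_mono[OF J1, of "(c / 4) * \<kappa> * (m * \<tau>)"] c pos mt by (simp add: mult_ac)
    have b0: "0 < (c / 4) * \<kappa> * (m * \<tau>)" using c pos mt by simp
    have "prob B1 \<le> prob {\<omega> \<in> space M. (c / 4) * \<kappa> * (m * \<tau>) \<le> A (ts - J0 * (\<kappa> * \<tau>)) \<omega>}"
      unfolding B1_def using b by (intro finite_measure_mono) auto
    also have "\<dots> \<le> 8 * (Cv * (m * \<tau>)\<^sup>2) / ((c / 4) * \<kappa> * (m * \<tau>))\<^sup>2"
    proof (rule prob_A_ge[OF b0])
      have r: "ts - a \<le> ts - J0 * (\<kappa> * \<tau>)" "ts - J0 * (\<kappa> * \<tau>) \<le> (1 + \<alpha>) / 2"
        using small(1) \<kappa>\<tau> by (simp, intro order_trans[OF _ \<beta>]) simp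
      show "expectation (\<lambda>\<omega>. (D I0 (Phi_inv (ts - J0 * (\<kappa> * \<tau>))) \<omega>)\<^sup>2) \<le> Cv * (m * \<tau>)\<^sup>2"
        "expectation (\<lambda>\<omega>. (D I1 (Phi_inv (ts - J0 * (\<kappa> * \<tau>)) - \<delta>) \<omega>)\<^sup>2) \<le> Cv * (m * \<tau>)\<^sup>2"
        using v0[OF r] v1[OF r] by auto
    qed
    also have "\<dots> = 128 * Cv / (c\<^sup>2 * \<kappa>\<^sup>2)" using pos m_pos by (simp add: power_mult_distrib power_divide)
    finally show ?thesis .
  qed
  have Cv: "Cv \<ge> 0"
  proof -
    have "0 \<le> expectation (\<lambda>\<omega>. (D I0 (Phi_inv ts) \<omega>)\<^sup>2)" by simp
    also have "\<dots> \<le> Cv * (m * \<tau>)\<^sup>2" using v0[of ts] c \<beta> by simp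
    finally have "0 \<le> Cv * (m * \<tau>)\<^sup>2" .
    moreover have "0 < (m * \<tau>)\<^sup>2" using mt by (rule zero_less_power)
    ultimately show ?thesis using mult_neg_pos[of Cv "(m * \<tau>)\<^sup>2"] by linarith
  qed
  have P2: "prob (\<Union>j\<in>J. B2 j) \<le> 128 * Cv / (c\<^sup>2 * \<kappa>\<^sup>2)"
  proof -
    have "prob (\<Union>j\<in>J. B2 j) \<le> (\<Sum>j\<in>J. prob (B2 j))"
      by (rule measure_UNION_le) (use fin in auto)
    also have "\<dots> \<le> (\<Sum>j\<in>J. 128 * Cv / (c\<^sup>2 * \<kappa>\<^sup>2) * (1 / (real j)\<^sup>2))"
    proof (rule sum_mono)
      fix j assume j: "j \<in> J"
      then have j2: "real j > 0" "ts + real j * (\<kappa> * \<tau>) \<le> (1 + \<alpha>) / 2" by (auto simp: J_def)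
      have b0: "0 < ?b j" using c pos m_pos j2 by simp
      have r: "ts - a \<le> ts + real j * (\<kappa> * \<tau>)" using c pos by (simp add: add_increasing2 less_imp_le)
      have "prob (B2 j) \<le> 8 * (Cv * (m * \<tau>)\<^sup>2) / (?b j)\<^sup>2"
        unfolding B2_def by (rule prob_A_ge[OF b0 v0[OF r j2(2)] v1[OF r j2(2)]])
      also have "\<dots> = 128 * Cv / (c\<^sup>2 * \<kappa>\<^sup>2) * (1 / (real j)\<^sup>2)"
        using mt pos m_pos by (simp add: power_mult_distrib power_divide field_simps)
      finally show "prob (B2 j) \<le> 128 * Cv / (c\<^sup>2 * \<kappa>\<^sup>2) * (1 / (real j)\<^sup>2)" .
    qed
    also have "\<dots> = 128 * Cv / (c\<^sup>2 * \<kappa>\<^sup>2) * (\<Sum>j\<in>J. 1 / (real j)\<^sup>2)" by (simp add: sum_distrib_left)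
    also have "\<dots> \<le> 128 * Cv / (c\<^sup>2 * \<kappa>\<^sup>2) * 1"
    proof (rule mult_left_mono)
      have "(\<Sum>j\<in>J. 1 / (real j)\<^sup>2) \<le> (\<Sum>j=2..nat \<lceil>(1 + \<alpha>) / 2 / (\<kappa> * \<tau>)\<rceil>. 1 / (real j)\<^sup>2)"
        by (rule sum_mono2) (auto simp: J_def)
      also have "\<dots> \<le> 1" by (rule sum_inverse_squares_le)
      finally show "(\<Sum>j\<in>J. 1 / (real j)\<^sup>2) \<le> 1" .
    qed (use Cv in auto)
    finally show ?thesis by simp
  qed
  have P3: "prob (\<Union>j\<in>{- int N..int N + 1}. B3 j) \<le> (2 * real N + 2) * (w / \<eta>\<^sup>2)"
  proof -
    have "prob (\<Union>j\<in>{- int N..int N + 1}. B3 j) \<le> (\<Sum>j\<in>{- int N..int N + 1}. prob (B3 j))"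
      by (rule measure_UNION_le) (use fin in auto)
    also have "\<dots> \<le> (\<Sum>j\<in>{- int N..int N + 1}. w / \<eta>\<^sup>2)"
    proof (rule sum_mono)
      fix j assume j: "j \<in> {- int N..int N + 1}"
      have i: "integrable M (\<lambda>\<omega>. (D I0 (Phi_inv (ts + real_of_int j * (\<eta> * \<tau>))) \<omega> - D I0 (Phi_inv ts) \<omega>)\<^sup>2)"
        by (rule D_increment_second_moment(1)[OF I01(1), where B = "\<bar>Phi_inv (ts + real_of_int j * (\<eta> * \<tau>))\<bar> + \<bar>Phi_inv ts\<bar>"]) auto
      have "prob (B3 j) \<le> w * (m * \<tau>)\<^sup>2 / (\<eta> * \<tau> * m)\<^sup>2"
        unfolding B3_def by (rule chebyshev_second_moment[OF _ i]) (use w j pos m_pos in auto)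
      also have "\<dots> = w / \<eta>\<^sup>2" using mt pos m_pos by (simp add: power_mult_distrib)
      finally show "prob (B3 j) \<le> w / \<eta>\<^sup>2" .
    qed
    also have "\<dots> = (2 * real N + 2) * (w / \<eta>\<^sup>2)" by simp
    finally show ?thesis .
  qed
  have P4: "prob B4 \<le> Cv / K'\<^sup>2"
  proof -
    have "prob B4 \<le> Cv * (m * \<tau>)\<^sup>2 / (K' * \<tau> * m)\<^sup>2"
      unfolding B4_def
      by (rule chebyshev_second_moment[OF _ D_second_moment(1)[OF I01(1) order_refl]]) (use v0[of ts] c \<beta> pos m_pos in auto)
    also have "\<dots> = Cv / K'\<^sup>2" using mt pos m_pos by (simp add: power_mult_distrib)
    finally show ?thesis .
  qed
  have "prob ?S \<le> prob (B1 \<union> (\<Union>j\<in>J. B2 j) \<union> (\<Union>j\<in>{- int N..int N + 1}. B3 j) \<union> B4)"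
    by (rule finite_measure_mono[OF sub]) (use fin in \<open>auto intro!: sets.finite_UN\<close>)
  also have "\<dots> \<le> prob (B1 \<union> (\<Union>j\<in>J. B2 j) \<union> (\<Union>j\<in>{- int N..int N + 1}. B3 j)) + prob B4"
    by (rule measure_Un_le) (use fin in \<open>auto intro!: sets.finite_UN\<close>)
  also have "\<dots> \<le> prob (B1 \<union> (\<Union>j\<in>J. B2 j)) + prob (\<Union>j\<in>{- int N..int N + 1}. B3 j) + prob B4"
    by (intro add_right_mono measure_Un_le) (use fin in \<open>auto intro!: sets.finite_UN\<close>)
  also have "\<dots> \<le> prob B1 + prob (\<Union>j\<in>J. B2 j) + prob (\<Union>j\<in>{- int N..int N + 1}. B3 j) + prob B4"
    by (intro add_right_mono measure_Un_le) (use fin in \<open>auto intro!: sets.finite_UN\<close>)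
  also have "\<dots> \<le> 128 * Cv / (c\<^sup>2 * \<kappa>\<^sup>2) + 128 * Cv / (c\<^sup>2 * \<kappa>\<^sup>2) + (2 * real N + 2) * (w / \<eta>\<^sup>2) + Cv / K'\<^sup>2"
    by (intro add_mono P1 P2 P3 P4)
  also have "128 * Cv / (c\<^sup>2 * \<kappa>\<^sup>2) + 128 * Cv / (c\<^sup>2 * \<kappa>\<^sup>2) = 256 * Cv / (c\<^sup>2 * \<kappa>\<^sup>2)"
    by (simp add: add_divide_distrib[symmetric])
  finally show ?thesis .
qed

end

lemma (in prob_space) norm_char_diff_le:
  assumes [measurable]: "X \<in> borel_measurable M" "X' \<in> borel_measurable M" and R: "R \<ge> 0"
  shows "norm ((CLINT \<omega>|M. iexp (u * X \<omega>)) - (CLINT \<omega>|M. iexp (u * X' \<omega>)))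
    \<le> \<bar>u\<bar> * R + 2 * prob {\<omega> \<in> space M. R < \<bar>X \<omega> - X' \<omega>\<bar>}"
proof -
  have i: "complex_integrable M (\<lambda>\<omega>. iexp (u * X \<omega>))" "complex_integrable M (\<lambda>\<omega>. iexp (u * X' \<omega>))"
    by (rule integrable_bounded[where B=1]; simp)+
  let ?S = "{\<omega> \<in> space M. R < \<bar>X \<omega> - X' \<omega>\<bar>}"
  have "(CLINT \<omega>|M. iexp (u * X \<omega>)) - (CLINT \<omega>|M. iexp (u * X' \<omega>)) = (CLINT \<omega>|M. iexp (u * X \<omega>) - iexp (u * X' \<omega>))"
    by (rule Bochner_Integration.integral_diff[symmetric]; fact)
  moreover have "norm (CLINT \<omega>|M. iexp (u * X \<omega>) - iexp (u * X' \<omega>)) \<le> expectation (\<lambda>\<omega>. \<bar>u\<bar> * R + 2 * indicator ?S \<omega>)"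
  proof (rule order_trans[OF integral_norm_bound integral_mono])
    show "integrable M (\<lambda>\<omega>. norm (iexp (u * X \<omega>) - iexp (u * X' \<omega>)))"
      using i by (intro integrable_norm Bochner_Integration.integrable_diff)
    show "integrable M (\<lambda>\<omega>. \<bar>u\<bar> * R + 2 * indicator ?S \<omega>)"
      by (intro Bochner_Integration.integrable_add integrable_const integrable_mult_right integrable_real_indicator)
         (auto simp: emeasure_eq_measure)
    fix \<omega> assume sp: "\<omega> \<in> space M"
    show "norm (iexp (u * X \<omega>) - iexp (u * X' \<omega>)) \<le> \<bar>u\<bar> * R + 2 * indicator ?S \<omega>"
    proof (cases "R < \<bar>X \<omega> - X' \<omega>\<bar>")
      case True
      have "norm (iexp (u * X \<omega>) - iexp (u * X' \<omega>)) \<le> norm (iexp (u * X \<omega>)) + norm (iexp (u * X' \<omega>))"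
        by (rule norm_triangle_ineq4)
      also have "\<dots> = 2" by (simp only: norm_exp_i_times)
      finally show ?thesis using True sp R by (simp add: add_increasing)
    next
      case False
      have "norm (iexp (u * X \<omega>) - iexp (u * X' \<omega>)) \<le> \<bar>u\<bar> * \<bar>X \<omega> - X' \<omega>\<bar>"
        using norm_iexp_diff_le[of "u * X \<omega>" "u * X' \<omega>"] by (simp only: right_diff_distrib[symmetric] abs_mult)
      also have "\<dots> \<le> \<bar>u\<bar> * R" using False by (intro mult_left_mono) auto
      finally show ?thesis using False by simp
    qed
  qed
  moreover have "expectation (\<lambda>\<omega>. \<bar>u\<bar> * R + 2 * indicator ?S \<omega>) = \<bar>u\<bar> * R + 2 * prob ?S"
  proof -
    have "integrable M (indicator ?S :: _ \<Rightarrow> real)" by (intro integrable_real_indicator) (auto simp: emeasure_eq_measure)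
    then show ?thesis by (subst Bochner_Integration.integral_add) (auto simp: prob_space)
  qed
  ultimately show ?thesis by simp
qed

section \<open>Convergence of the characteristic functions\<close>

lemma (in gaussian_family) D_scaled_second_moment:
  assumes J: "J \<subseteq> I" and z: "\<bar>z\<bar> \<le> B" and n: "real (card J) \<le> n" and E: "E2 \<le> Q * n" "Q \<le> 1" and V: "V J \<le> C * n"
  shows "expectation (\<lambda>\<omega>. (D J z \<omega>)\<^sup>2) \<le> 2 * (1 + 5 * (B + 1)\<^sup>2 * K3 + C) * n"
proof -
  have n0: "0 \<le> n" using n by linarith
  have "E2 \<le> n" using E n0 mult_right_mono[of Q 1 n] by simp
  then have "5 * (B + 1)\<^sup>2 * K3 * E2 \<le> 5 * (B + 1)\<^sup>2 * K3 * n"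
    using K3_ge_1 by (intro mult_left_mono) auto
  then show ?thesis using D_second_moment(2)[OF J z] n V by (simp add: algebra_simps)
qed

lemma (in gaussian_family) D_increment_scaled:
  assumes J: "J \<subseteq> I" and z: "\<bar>z\<bar> \<le> B" "\<bar>w\<bar> \<le> B" and n: "real (card J) \<le> n" and E: "E2 \<le> Q * n" and V: "V J \<le> C * n"
    and \<xi>: "\<bar>Phi z - Phi w\<bar> \<le> \<xi>" and e: "(std_normal_density z - std_normal_density w)\<^sup>2 \<le> e"
  shows "expectation (\<lambda>\<omega>. (D J z \<omega> - D J w \<omega>)\<^sup>2) \<le> (4 * \<xi> + 4 * e + 40 * (B + 1)\<^sup>2 * K3 * Q + 2 * e * C) * n"
proof -
  let ?d = "(std_normal_density z - std_normal_density w)\<^sup>2"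
  have n0: "0 \<le> n" using n by linarith
  have \<xi>0: "0 \<le> \<xi>" using \<xi> by linarith
  have e0: "0 \<le> e" by (rule order_trans[OF zero_le_power2 e])
  have "card J * (2 * \<bar>Phi z - Phi w\<bar> + 2 * ?d) \<le> n * (2 * \<xi> + 2 * e)"
    using \<xi> e n n0 by (intro mult_mono add_mono mult_left_mono) auto
  moreover have "20 * (B + 1)\<^sup>2 * K3 * E2 \<le> 20 * (B + 1)\<^sup>2 * K3 * (Q * n)"
    using K3_ge_1 E by (intro mult_left_mono) auto
  moreover have "2 * ?d * V J \<le> 2 * e * (C * n)"
    using e e0 V V_nonneg[OF J] by (intro mult_mono) auto
  moreover have "2 * (a + b) + c \<le> 2 * (a' + b') + c'" if "a \<le> a'" "b \<le> b'" "c \<le> c'" for a b c a' b' c' :: real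
    using that by (intro add_mono mult_left_mono) auto
  ultimately have "2 * (card J * (2 * \<bar>Phi z - Phi w\<bar> + 2 * ?d) + 20 * (B + 1)\<^sup>2 * K3 * E2) + 2 * ?d * V J
      \<le> 2 * (n * (2 * \<xi> + 2 * e) + 20 * (B + 1)\<^sup>2 * K3 * (Q * n)) + 2 * e * (C * n)"
    by blast
  also have "\<dots> = (4 * \<xi> + 4 * e + 40 * (B + 1)\<^sup>2 * K3 * Q + 2 * e * C) * n" by (simp add: algebra_simps)
  finally show ?thesis using D_increment_second_moment(2)[OF J z] by linarith
qed

text \<open>What remains of the rates is one scale \<open>\<tau>\<close>, for which sums over the
  nulls and over the alternatives have variance \<open>O((m \<tau>)\<^sup>2)\<close>, the
  squared correlations are \<open>o((m \<tau>)\<^sup>2)\<close> in total and the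
  normalisation \<open>s\<close> is not of smaller order than \<open>\<tau>\<close>. The index 0 is left out,
  where there need not be a probability space.\<close>

locale two_group_sequence =
  fixes M :: "nat \<Rightarrow> 'a measure" and Y :: "nat \<Rightarrow> nat \<Rightarrow> 'a \<Rightarrow> real" and \<Gamma> :: "nat \<Rightarrow> nat \<Rightarrow> nat \<Rightarrow> real"
    and H :: "nat \<Rightarrow> nat \<Rightarrow> real" and \<delta> \<alpha> \<pi>0 :: real and \<tau> s :: "nat \<Rightarrow> real" and C cs :: real
  assumes tg: "\<And>m. m \<ge> 1 \<Longrightarrow> two_group (M m) m (Y m) (\<Gamma> m) (H m) \<delta> \<alpha> \<pi>0"
    and \<tau>_pos: "\<And>m. m \<ge> 1 \<Longrightarrow> 0 < \<tau> m" and \<tau>_ge: "\<And>m. m \<ge> 1 \<Longrightarrow> real m \<le> (m * \<tau> m)\<^sup>2"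
    and \<tau>_lim: "\<tau> \<longlonglongrightarrow> 0"
    and d_lim: "(\<lambda>m. \<bar>m0 m (H m) / m - \<pi>0\<bar> / \<tau> m) \<longlonglongrightarrow> 0"
    and Q_lim: "(\<lambda>m. off_diag_sum m (\<lambda>i j. (\<Gamma> m i j)\<^sup>2) / (m * \<tau> m)\<^sup>2) \<longlonglongrightarrow> 0"
    and V0: "\<forall>\<^sub>F m in sequentially. gaussian_family.V (\<Gamma> m) (two_group.I0 m (H m)) \<le> C * (m * \<tau> m)\<^sup>2"
    and V1: "\<forall>\<^sub>F m in sequentially. gaussian_family.V (\<Gamma> m) (two_group.I1 m (H m)) \<le> C * (m * \<tau> m)\<^sup>2"
    and C: "C \<ge> 0" and cs: "cs > 0" and s: "\<forall>\<^sub>F m in sequentially. cs * \<tau> m \<le> s m"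
begin

definition ts where "ts = t_star \<delta> \<pi>0 \<alpha>"
definition d where "d m = \<bar>m0 m (H m) / m - \<pi>0\<bar>"
definition Q where "Q m = off_diag_sum m (\<lambda>i j. (\<Gamma> m i j)\<^sup>2) / (m * \<tau> m)\<^sup>2"
definition D0 where "D0 m z \<omega> = gaussian_family.D (Y m) (two_group.I0 m (H m)) z \<omega>"
text \<open>The standardised sum to which the standardised false discovery proportion \<open>X\<close> is reduced.\<close>

definition S where "S m \<omega> = D0 m (Phi_inv ts) \<omega> / (m0 m (H m) * ts * s m)"
definition X where "X m \<omega> = (FDP \<alpha> m (H m) (\<lambda>i. \<delta> * H m i + Y m i \<omega>) - \<pi>0 * \<alpha>) / (\<pi>0 * \<alpha> * s m)"

lemma params: "\<delta> > 0" "0 < \<pi>0" "\<pi>0 < 1" "0 < \<alpha>" "\<alpha> < 1"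
proof -
  interpret tg: two_group "M 1" 1 "Y 1" "\<Gamma> 1" "H 1" \<delta> \<alpha> \<pi>0 by (rule tg) simp
  show "\<delta> > 0" "0 < \<pi>0" "\<pi>0 < 1" "0 < \<alpha>" "\<alpha> < 1" by (fact tg.\<delta> tg.\<pi>0 tg.\<alpha>)+
qed

lemma ts_bounds: "0 < ts" "ts < \<alpha>" "ts < 1"
  using t_star_props[OF params] params by (auto simp: ts_def)

lemma d_lim': "d \<longlonglongrightarrow> 0"
proof -
  have "(\<lambda>m. \<bar>m0 m (H m) / m - \<pi>0\<bar> / \<tau> m * \<tau> m) \<longlonglongrightarrow> 0 * 0"
    by (intro tendsto_mult d_lim \<tau>_lim)
  moreover have "\<forall>\<^sub>F m in sequentially. \<bar>m0 m (H m) / m - \<pi>0\<bar> / \<tau> m * \<tau> m = d m"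
    using eventually_ge_at_top[of 1]
  proof eventually_elim
    case (elim m) then show ?case using \<tau>_pos[of m] by (simp add: d_def)
  qed
  ultimately show ?thesis by (simp add: filterlim_cong)
qed

lemma measurable_X: "m \<ge> 1 \<Longrightarrow> X m \<in> borel_measurable (M m)"
proof -
  assume "m \<ge> 1"
  then interpret tg: two_group "M m" m "Y m" "\<Gamma> m" "H m" \<delta> \<alpha> \<pi>0 by (rule tg)
  have "(\<lambda>\<omega>. FDP \<alpha> m (H m) (\<lambda>i. \<delta> * H m i + Y m i \<omega>)) \<in> borel_measurable (M m)"
    by (rule measurable_FDP[OF params(4,5)]) (use tg.measurable_Y in auto)
  then show ?thesis unfolding X_def[abs_def] by measurable
qed

lemma eventually_small_multiple:
  assumes "b > 0" shows "\<forall>\<^sub>F m in sequentially. c * \<tau> m < b"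
proof -
  have "(\<lambda>m. c * \<tau> m) \<longlonglongrightarrow> c * 0" by (intro tendsto_intros \<tau>_lim)
  then show ?thesis using assms by (intro order_tendstoD) auto
qed

text \<open>The width \<open>\<kappa>\<close> of the window, the bound \<open>K'\<close> on the main term and the mesh \<open>\<eta>\<close> of the fine grid
  depend on the accuracy \<open>\<epsilon>\<close> (and on \<open>u\<close>) only, the number \<open>N\<close> of points of the fine grid on \<open>\<kappa>\<close>
  and \<open>\<eta>\<close>. With these constants fixed, all the other error terms vanish as \<open>m\<close> grows.\<close>

lemma linearisation_negligible:
  "(\<lambda>m. norm ((CLINT \<omega>|M m. iexp (u * X m \<omega>)) - (CLINT \<omega>|M m. iexp (u * S m \<omega>)))) \<longlonglongrightarrow> 0"
proof -
  obtain c a where c: "c > 0" "a > 0" "a < ts"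
    and lower: "\<And>t. 0 < t \<Longrightarrow> t < 1 \<Longrightarrow> ts \<le> t \<Longrightarrow> c * (t - ts) \<le> t / \<alpha> - G \<delta> \<pi>0 t"
    and upper: "\<And>t. ts - a \<le> t \<Longrightarrow> t \<le> ts \<Longrightarrow> t / \<alpha> - G \<delta> \<pi>0 t \<le> - c * (ts - t)"
    using crossing_slope[OF params] unfolding ts_def by metis
  define \<beta> where "\<beta> = (1 + \<alpha>) / 2"
  have \<beta>: "ts < \<beta>" "\<beta> < 1" using ts_bounds params by (auto simp: \<beta>_def field_simps)
  (* All quantiles that occur are bounded, so that the constants of the moment bounds are
     uniform. *)
  define B where "B = \<bar>Phi_inv (ts - a)\<bar> + \<bar>Phi_inv \<beta>\<bar> + \<delta>"
  have B: "\<bar>Phi_inv t\<bar> \<le> B" "\<bar>Phi_inv t - \<delta>\<bar> \<le> B" if "ts - a \<le> t" "t \<le> \<beta>" for t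
  proof -
    have "Phi_inv t \<le> Phi_inv (ts - a)" "Phi_inv \<beta> \<le> Phi_inv t"
      using that c \<beta> by (auto intro!: Phi_inv_le)
    then show "\<bar>Phi_inv t\<bar> \<le> B" "\<bar>Phi_inv t - \<delta>\<bar> \<le> B" using params unfolding B_def by linarith+
  qed
  define Cv where "Cv = 2 * (1 + 5 * (B + 1)\<^sup>2 * K3 + C)"
  have Cv: "Cv > 0"
  proof -
    have "0 \<le> 5 * (B + 1)\<^sup>2 * K3" using K3_ge_1 by simp
    then show ?thesis using C unfolding Cv_def by (simp add: add_pos_nonneg)
  qed
  define J0 where "J0 = nat \<lceil>2 / (c * \<alpha>)\<rceil> + 1"
  have J0: "real J0 \<ge> 2 / (c * \<alpha>)" "J0 \<ge> 1" unfolding J0_def by linarith+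
  have small: "\<forall>\<^sub>F m in sequentially. norm ((CLINT \<omega>|M m. iexp (u * X m \<omega>)) - (CLINT \<omega>|M m. iexp (u * S m \<omega>))) < \<epsilon>"
    if \<epsilon>: "\<epsilon> > 0" for \<epsilon>
  proof -
    define \<kappa> where "\<kappa> = sqrt (4096 * Cv / (c\<^sup>2 * \<epsilon>))"
    define K' where "K' = sqrt (16 * Cv / \<epsilon>)"
    define \<eta> where "\<eta> = \<epsilon> * \<pi>0 * ts * cs / (32 * (\<bar>u\<bar> + 1))"
    have pos: "\<kappa> > 0" "K' > 0" "\<eta> > 0"
      using Cv c \<epsilon> params ts_bounds cs by (auto simp: \<kappa>_def K'_def \<eta>_def)
    have \<kappa>2: "256 * Cv / (c\<^sup>2 * \<kappa>\<^sup>2) = \<epsilon> / 16" using Cv c \<epsilon> by (simp add: \<kappa>_def)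
    have K'2: "Cv / K'\<^sup>2 = \<epsilon> / 16" using Cv \<epsilon> by (simp add: K'_def)
    have \<eta>2: "\<bar>u\<bar> * (4 * \<eta> / (\<pi>0 * ts * cs)) \<le> \<epsilon> / 8"
    proof -
      have "4 * \<eta> / (\<pi>0 * ts * cs) = \<epsilon> / (8 * (\<bar>u\<bar> + 1))"
      proof -
        have "4 * (\<epsilon> * \<pi>0 * ts * cs / (32 * y)) / (\<pi>0 * ts * cs) = \<epsilon> / (8 * y)" for y
          using params ts_bounds cs by simp
        then show ?thesis unfolding \<eta>_def .
      qed
      moreover have "\<bar>u\<bar> * (\<epsilon> / (8 * (\<bar>u\<bar> + 1))) \<le> \<epsilon> / 8" using \<epsilon> by (simp add: field_simps)
      ultimately show ?thesis by simp
    qed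
    define N where "N = nat \<lceil>J0 * \<kappa> / \<eta>\<rceil>"
    have N: "J0 * \<kappa> / \<eta> \<le> real N" unfolding N_def by linarith
    define R where "R m = d m / \<tau> m / (\<pi>0 * cs) + 4 * \<eta> / (\<pi>0 * ts * cs) + K' / cs * (4 * (d m + J0 * \<kappa> * \<tau> m) / (\<pi>0\<^sup>2 * ts\<^sup>2))" for m
    have "R \<longlonglongrightarrow> 0 / (\<pi>0 * cs) + 4 * \<eta> / (\<pi>0 * ts * cs) + K' / cs * (4 * (0 + J0 * \<kappa> * 0) / (\<pi>0\<^sup>2 * ts\<^sup>2))"
      unfolding R_def using params ts_bounds cs
      by (intro tendsto_intros d_lim[folded d_def] d_lim' \<tau>_lim) auto
    then have "(\<lambda>m. \<bar>u\<bar> * R m) \<longlonglongrightarrow> \<bar>u\<bar> * (4 * \<eta> / (\<pi>0 * ts * cs))" by (intro tendsto_mult tendsto_const) simp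
    then have evR: "\<forall>\<^sub>F m in sequentially. \<bar>u\<bar> * R m < \<epsilon> / 4"
      using \<eta>2 \<epsilon> by (intro order_tendstoD(2)) auto
    (* A common bound for the increments of the density on the fine grid; the sum has a fixed
       number of terms, each of which tends to 0. *)
    define e where "e m = (\<Sum>j\<in>{- int N..int N + 1}. (std_normal_density (Phi_inv (ts + of_int j * (\<eta> * \<tau> m))) - std_normal_density (Phi_inv ts))\<^sup>2)" for m
    have e_lim: "e \<longlonglongrightarrow> 0"
    proof -
      have "(\<lambda>m. std_normal_density (Phi_inv (ts + of_int j * (\<eta> * \<tau> m)))) \<longlonglongrightarrow> std_normal_density (Phi_inv ts)" for j :: int
      proof (rule isCont_tendsto_compose[where g = "\<lambda>t. std_normal_density (Phi_inv t)"])
        show "isCont (\<lambda>t. std_normal_density (Phi_inv t)) ts"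
          using ts_bounds by (intro isCont_o2[OF isCont_Phi_inv] DERIV_isCont[OF std_normal_density_deriv]) auto
        have "(\<lambda>m. ts + of_int j * (\<eta> * \<tau> m)) \<longlonglongrightarrow> ts + of_int j * (\<eta> * 0)" by (intro tendsto_intros \<tau>_lim)
        then show "(\<lambda>m. ts + of_int j * (\<eta> * \<tau> m)) \<longlonglongrightarrow> ts" by simp
      qed
      then have "e \<longlonglongrightarrow> (\<Sum>j\<in>{- int N..int N + 1}. (std_normal_density (Phi_inv ts) - std_normal_density (Phi_inv ts))\<^sup>2)"
        unfolding e_def by (intro tendsto_intros)
      then show ?thesis by simp
    qed
    define w where "w m = 4 * ((N + 1) * (\<eta> * \<tau> m)) + 4 * e m + 40 * (B + 1)\<^sup>2 * K3 * Q m + 2 * e m * C" for m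
    have "w \<longlonglongrightarrow> 4 * ((N + 1) * (\<eta> * 0)) + 4 * 0 + 40 * (B + 1)\<^sup>2 * K3 * 0 + 2 * 0 * C"
      unfolding w_def Q_def by (intro tendsto_intros \<tau>_lim e_lim Q_lim)
    then have "(\<lambda>m. (2 * real N + 2) * (w m / \<eta>\<^sup>2)) \<longlonglongrightarrow> (2 * real N + 2) * (0 / \<eta>\<^sup>2)"
      using pos by (intro tendsto_intros) auto
    then have evw: "\<forall>\<^sub>F m in sequentially. (2 * real N + 2) * (w m / \<eta>\<^sup>2) < \<epsilon> / 16"
      using \<epsilon> by (intro order_tendstoD(2)) auto
    have evd: "\<forall>\<^sub>F m in sequentially. d m / \<tau> m < (c / 4) * \<kappa>"
      using c pos by (intro order_tendstoD(2)[OF d_lim[folded d_def]]) auto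
    have evp: "\<forall>\<^sub>F m in sequentially. d m < \<pi>0 / 2"
      using params by (intro order_tendstoD(2)[OF d_lim']) auto
    have evQ: "\<forall>\<^sub>F m in sequentially. Q m < 1"
      unfolding Q_def by (intro order_tendstoD(2)[OF Q_lim]) auto
    have ev1: "\<forall>\<^sub>F m in sequentially. (J0 * \<kappa>) * \<tau> m < a" by (rule eventually_small_multiple[OF c(2)])
    have ev2: "\<forall>\<^sub>F m in sequentially. \<kappa> * \<tau> m < (1 - \<alpha>) / 2" using params by (intro eventually_small_multiple) auto
    have ev3: "\<forall>\<^sub>F m in sequentially. (J0 * \<kappa>) * \<tau> m < ts / 2" using ts_bounds by (intro eventually_small_multiple) auto
    have ev4: "\<forall>\<^sub>F m in sequentially. (real (N + 1) * \<eta>) * \<tau> m < a" by (rule eventually_small_multiple[OF c(2)])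
    have ev5: "\<forall>\<^sub>F m in sequentially. (real (N + 1) * \<eta>) * \<tau> m < \<beta> - ts" using \<beta> by (intro eventually_small_multiple) auto
    show ?thesis
      using eventually_ge_at_top[of 1] evR evw evd evp evQ ev1 ev2 ev3 ev4 ev5 V0 V1 s
    proof eventually_elim
      case (elim m)
      interpret tg: two_group "M m" m "Y m" "\<Gamma> m" "H m" \<delta> \<alpha> \<pi>0 by (rule tg[OF elim(1)])
      note \<tau>m = \<tau>_pos[OF elim(1)] and mn = \<tau>_ge[OF elim(1)]
      have ts_eq: "tg.ts = ts" by (simp add: tg.ts_def ts_def)
      have dp: "\<bar>tg.p - \<pi>0\<bar> = d m" by (simp add: tg.p_def d_def tg.card_I0)
      have mt: "0 < real m * \<tau> m" using elim(1) \<tau>m by simp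
      have E2: "tg.E2 \<le> Q m * (m * \<tau> m)\<^sup>2" using elim(1) \<tau>m unfolding tg.E2_eq Q_def by simp
      have card: "real (card tg.I0) \<le> (m * \<tau> m)\<^sup>2" "real (card tg.I1) \<le> (m * \<tau> m)\<^sup>2" using tg.card_le mn by auto
      have v0: "tg.expectation (\<lambda>\<omega>. (tg.D tg.I0 (Phi_inv t) \<omega>)\<^sup>2) \<le> Cv * (m * \<tau> m)\<^sup>2"
        and v1: "tg.expectation (\<lambda>\<omega>. (tg.D tg.I1 (Phi_inv t - \<delta>) \<omega>)\<^sup>2) \<le> Cv * (m * \<tau> m)\<^sup>2"
        if t: "ts - a \<le> t" "t \<le> (1 + \<alpha>) / 2" for t
        unfolding Cv_def
        using tg.D_scaled_second_moment[OF tg.I01(1) B(1)[OF t[folded \<beta>_def]] card(1) E2 less_imp_le[OF elim(6)] elim(12)]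
          tg.D_scaled_second_moment[OF tg.I01(2) B(2)[OF t[folded \<beta>_def]] card(2) E2 less_imp_le[OF elim(6)] elim(13)]
        by auto
      have grid: "(N + 1) * (\<eta> * \<tau> m) < a" "(N + 1) * (\<eta> * \<tau> m) < \<beta> - ts" using elim(10,11) by (auto simp: mult.assoc)
      have w: "tg.expectation (\<lambda>\<omega>. (tg.D tg.I0 (Phi_inv (ts + of_int j * (\<eta> * \<tau> m))) \<omega> - tg.D tg.I0 (Phi_inv ts) \<omega>)\<^sup>2) \<le> w m * (m * \<tau> m)\<^sup>2"
        if j: "- int N \<le> j" "j \<le> int N + 1" for j :: int
      proof -
        let ?x = "of_int j * (\<eta> * \<tau> m)"
        have jr: "\<bar>real_of_int j\<bar> \<le> real (N + 1)" using j by linarith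
        have xN: "\<bar>?x\<bar> \<le> (N + 1) * (\<eta> * \<tau> m)"
          unfolding abs_mult using pos \<tau>m by (intro mult_mono jr) auto
        then have t: "ts - a \<le> ts + ?x" "ts + ?x \<le> \<beta>" using grid by linarith+
        then have t01: "0 < ts + ?x" "ts + ?x < 1" using c \<beta> by linarith+
        show ?thesis
          unfolding w_def
        proof (rule tg.D_increment_scaled[OF tg.I01(1) B(1)[OF t] B(1) card(1) E2 elim(12)])
          show "ts - a \<le> ts" "ts \<le> \<beta>" using c \<beta> by auto
          show "\<bar>Phi (Phi_inv (ts + ?x)) - Phi (Phi_inv ts)\<bar> \<le> (N + 1) * (\<eta> * \<tau> m)"
            using xN ts_bounds by (simp add: Phi_Phi_inv[OF t01] Phi_Phi_inv)
          show "(std_normal_density (Phi_inv (ts + ?x)) - std_normal_density (Phi_inv ts))\<^sup>2 \<le> e m"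
            unfolding e_def
            by (rule member_le_sum[where f = "\<lambda>j. (std_normal_density (Phi_inv (ts + of_int j * (\<eta> * \<tau> m))) - std_normal_density (Phi_inv ts))\<^sup>2"])
               (use j in auto)
        qed
      qed
      have dk: "d m \<le> c / 4 * (\<kappa> * \<tau> m)" using elim(4) \<tau>m by (simp add: pos_divide_less_eq mult.assoc)
      have p2: "\<pi>0 / 2 \<le> tg.p" using elim(5) unfolding dp[symmetric] by linarith
      have Xx: "X m \<omega> = (FDP \<alpha> m (H m) (tg.x \<omega>) - \<pi>0 * \<alpha>) / (\<pi>0 * \<alpha> * s m)" for \<omega>
      proof -
        have "tg.x \<omega> = (\<lambda>i. \<delta> * H m i + Y m i \<omega>)" by (simp add: fun_eq_iff tg.x_def)
        then show ?thesis by (simp add: X_def)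
      qed
      have SS: "S m \<omega> = tg.D tg.I0 (Phi_inv ts) \<omega> / (card tg.I0 * ts * s m)" for \<omega>
        by (simp add: S_def D0_def tg.card_I0)
      have P: "tg.prob {\<omega> \<in> space (M m). R m < \<bar>X m \<omega> - S m \<omega>\<bar>} \<le> 256 * Cv / (c\<^sup>2 * \<kappa>\<^sup>2) + (2 * real N + 2) * (w m / \<eta>\<^sup>2) + Cv / K'\<^sup>2"
        unfolding R_def Xx SS dp[symmetric]
      proof (rule tg.FDP_linearisation_prob[unfolded ts_eq, OF c lower upper pos(1) \<tau>m pos(3) cs pos(2) _ J0])
        show "\<bar>tg.p - \<pi>0\<bar> \<le> c / 4 * (\<kappa> * \<tau> m)" unfolding dp by (rule dk)
        show "J0 * (\<kappa> * \<tau> m) \<le> a" "\<kappa> * \<tau> m \<le> (1 - \<alpha>) / 2" "J0 * \<kappa> * \<tau> m \<le> ts / 2" using elim(7-9) by (auto simp: mult.assoc)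
        show "0 < ts - (N + 1) * (\<eta> * \<tau> m)" "ts + (N + 1) * (\<eta> * \<tau> m) < 1" using grid c \<beta> by linarith+
      qed (use N elim(14) p2 v0 v1 w in auto)
      note mX = measurable_X[OF elim(1)]
      have mS: "S m \<in> borel_measurable (M m)"
        using tg.measurable_D[OF tg.I01(1)] unfolding SS[abs_def] by measurable
      have R0: "0 \<le> R m"
        unfolding R_def d_def using pos \<tau>m params ts_bounds cs by (intro add_nonneg_nonneg mult_nonneg_nonneg divide_nonneg_nonneg) auto
      have "norm ((CLINT \<omega>|M m. iexp (u * X m \<omega>)) - (CLINT \<omega>|M m. iexp (u * S m \<omega>)))
          \<le> \<bar>u\<bar> * R m + 2 * tg.prob {\<omega> \<in> space (M m). R m < \<bar>X m \<omega> - S m \<omega>\<bar>}"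
        by (rule tg.norm_char_diff_le[OF mX mS R0])
      also have "\<dots> < \<epsilon>" using P elim(2,3) \<epsilon> unfolding \<kappa>2 K'2 by linarith
      finally show ?case .
    qed
  qed
  show ?thesis
    by (rule tendstoI) (use small in \<open>simp add: dist_real_def\<close>)
qed

text \<open>The scaled frequency is \<open>O(1 / (m \<tau>))\<close>. Hence the third order error in
  \<open>D_char_bound\<close> vanishes, and the first error term has the limit \<open>L *
  sqrt (4 * \<eta>)\<close>, which is made small by the choice of \<open>\<eta>\<close>.\<close>

lemma linear_part_char:
  assumes var: "\<forall>\<^sub>F m in sequentially. m0 m (H m) * rvar (Phi_inv ts)
      + (std_normal_density (Phi_inv ts))\<^sup>2 * gaussian_family.V (\<Gamma> m) (two_group.I0 m (H m)) = (m0 m (H m) * ts * s m)\<^sup>2"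
  shows "(\<lambda>m. CLINT \<omega>|M m. iexp (u * S m \<omega>)) \<longlonglongrightarrow> of_real (exp (- u\<^sup>2 / 2))"
proof (rule tendstoI)
  fix \<epsilon> :: real assume \<epsilon>: "\<epsilon> > 0"
  define L where "L = \<bar>u\<bar> * (2 / (\<pi>0 * ts * cs))"
  have L: "L \<ge> 0" using params ts_bounds cs by (simp add: L_def)
  define \<eta> where "\<eta> = (\<epsilon> / (4 * (L + 1)))\<^sup>2"
  have \<eta>: "\<eta> > 0" using \<epsilon> L by (simp add: \<eta>_def add_nonneg_eq_0_iff)
  have "sqrt (4 * \<eta>) = 2 * (\<epsilon> / (4 * (L + 1)))"
    using \<epsilon> L by (simp add: \<eta>_def real_sqrt_mult)
  then have "L * sqrt (4 * \<eta>) = L * (2 * (\<epsilon> / (4 * (L + 1))))" by (simp only:)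
  also have "\<dots> = \<epsilon> / 2 * (L / (L + 1))"
    using L by (simp add: divide_simps)
  also have "\<dots> \<le> \<epsilon> / 2 * 1" using \<epsilon> L by (intro mult_left_mono) auto
  finally have L\<eta>: "L * sqrt (4 * \<eta>) < \<epsilon>" using \<epsilon> by linarith
  define B where "B = \<bar>Phi_inv ts\<bar>"
  define C\<eta> where "C\<eta> = 2 / \<eta>\<^sup>2 + 2 + 15 * (B + 1)\<^sup>2 * K3"
  have C\<eta>: "C\<eta> \<ge> 0" unfolding C\<eta>_def using K3_ge_1 by (intro add_nonneg_nonneg mult_nonneg_nonneg) auto
  define b where "b m = L * sqrt (4 * \<eta> + C\<eta> * Q m) + 4 * K3 * (L ^ 3 * (1 + C)) * (1 / sqrt (real m))" for m
  have inv_sqrt: "(\<lambda>m. 1 / sqrt (real m)) \<longlonglongrightarrow> 0"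
    by (intro tendsto_divide_0[OF tendsto_const] filterlim_at_top_imp_at_infinity
        filterlim_compose[OF sqrt_at_top filterlim_real_sequentially])
  have "b \<longlonglongrightarrow> L * sqrt (4 * \<eta> + C\<eta> * 0) + 4 * K3 * (L ^ 3 * (1 + C)) * 0"
    unfolding b_def Q_def by (intro tendsto_intros Q_lim inv_sqrt)
  then have evb: "\<forall>\<^sub>F m in sequentially. b m < \<epsilon>" using L\<eta> by (intro order_tendstoD(2)) auto
  have "(\<lambda>m. L * (1 / sqrt (real m))) \<longlonglongrightarrow> L * 0" by (intro tendsto_intros inv_sqrt)
  then have evL: "\<forall>\<^sub>F m in sequentially. L * (1 / sqrt (real m)) < 1" by (intro order_tendstoD(2)) auto
  have evp: "\<forall>\<^sub>F m in sequentially. d m < \<pi>0 / 2"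
    using params by (intro order_tendstoD(2)[OF d_lim']) auto
  show "\<forall>\<^sub>F m in sequentially. dist (CLINT \<omega>|M m. iexp (u * S m \<omega>)) (of_real (exp (- u\<^sup>2 / 2))) < \<epsilon>"
    using eventually_ge_at_top[of 1] evb evL evp V0 s var
  proof eventually_elim
    case (elim m)
    interpret tg: two_group "M m" m "Y m" "\<Gamma> m" "H m" \<delta> \<alpha> \<pi>0 by (rule tg[OF elim(1)])
    note \<tau>m = \<tau>_pos[OF elim(1)] and mn = \<tau>_ge[OF elim(1)]
    let ?n = "m * \<tau> m" and ?k = "m0 m (H m) * ts * s m"
    have mt: "0 < ?n" using elim(1) \<tau>m by simp
    have sm: "sqrt (real m) \<le> ?n" using mn mt by (intro real_le_lsqrt) auto
    have s0: "0 < s m" using mult_pos_pos[OF cs \<tau>m] elim(6) by linarith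
    have m0: "\<pi>0 / 2 * m \<le> m0 m (H m)"
    proof -
      have "\<pi>0 / 2 \<le> m0 m (H m) / m" using elim(4) unfolding d_def by linarith
      then show ?thesis using elim(1) by (simp add: field_simps)
    qed
    have m00: "0 \<le> m0 m (H m)" unfolding tg.card_I0[symmetric] by simp
    have k: "\<pi>0 * ts * cs / 2 * ?n \<le> ?k"
    proof -
      have "(\<pi>0 / 2 * m) * ts * (cs * \<tau> m) \<le> m0 m (H m) * ts * s m"
        using m0 m00 elim(6) ts_bounds params cs \<tau>m s0 by (intro mult_mono mult_nonneg_nonneg) auto
      then show ?thesis by (simp add: mult_ac)
    qed
    have k0: "0 < ?k" using k mt params ts_bounds cs by (intro less_le_trans[OF _ k]) simp
    define \<theta> where "\<theta> = u / ?k"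
    have \<theta>n: "\<bar>\<theta>\<bar> * ?n \<le> L"
    proof -
      have "\<bar>\<theta>\<bar> * ?n = \<bar>u\<bar> * (?n / ?k)" using k0 by (simp add: \<theta>_def)
      also have "?n / ?k \<le> 2 / (\<pi>0 * ts * cs)"
      proof -
        have "x / y \<le> 2 / q" if "q / 2 * x \<le> y" "0 < y" "0 < q" for x y q :: real
          using that by (simp add: field_simps)
        from this[OF k k0] show ?thesis using params ts_bounds cs by simp
      qed
      finally show ?thesis unfolding L_def by (simp add: mult_left_mono)
    qed
    have inv_n: "1 / ?n \<le> 1 / sqrt (real m)" using sm elim(1) by (intro divide_left_mono mult_pos_pos[OF mt]) auto
    have \<theta>: "\<bar>\<theta>\<bar> \<le> L * (1 / ?n)" using \<theta>n mt by (simp add: field_simps)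
    have \<theta>1: "\<bar>\<theta>\<bar> \<le> 1" using \<theta> mult_left_mono[OF inv_n L] elim(3) by linarith
    have E2: "tg.E2 \<le> Q m * ?n\<^sup>2" using elim(1) \<tau>m unfolding tg.E2_eq Q_def by simp
    have card: "real (card tg.I0) \<le> ?n\<^sup>2" using tg.card_le mn by auto
    have Q0: "Q m \<ge> 0"
      using tg.E2_nonneg tg.E2_eq by (simp add: Q_def)
    have SS: "u * S m \<omega> = \<theta> * tg.D tg.I0 (Phi_inv ts) \<omega>" for \<omega>
      by (simp add: S_def D0_def \<theta>_def)
    have ex: "\<theta>\<^sup>2 * (card tg.I0 * rvar (Phi_inv ts) + (std_normal_density (Phi_inv ts))\<^sup>2 * tg.V tg.I0) = u\<^sup>2"
      unfolding tg.card_I0 elim(7) power_mult_distrib[symmetric] using less_imp_neq[OF k0] by (simp add: \<theta>_def)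
    have "norm ((CLINT \<omega>|M m. iexp (u * S m \<omega>)) - of_real (exp (- u\<^sup>2 / 2)))
      \<le> \<bar>\<theta>\<bar> * sqrt (4 * \<eta> * card tg.I0 + C\<eta> * tg.E2) + 4 * K3 * \<bar>\<theta>\<bar> ^ 3 * (card tg.I0 + tg.V tg.I0)"
      using tg.D_char_bound[OF tg.I01(1) _ \<eta> \<theta>1, of "Phi_inv ts" B] unfolding SS ex C\<eta>_def by (simp add: B_def)
    also have "\<dots> \<le> b m"
      unfolding b_def
    proof (rule add_mono)
      have "4 * \<eta> * card tg.I0 + C\<eta> * tg.E2 \<le> 4 * \<eta> * ?n\<^sup>2 + C\<eta> * (Q m * ?n\<^sup>2)"
        using card E2 \<eta> C\<eta> by (intro add_mono mult_left_mono) auto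
      also have "\<dots> = (4 * \<eta> + C\<eta> * Q m) * ?n\<^sup>2" by (simp add: algebra_simps)
      finally have "sqrt (4 * \<eta> * card tg.I0 + C\<eta> * tg.E2) \<le> sqrt ((4 * \<eta> + C\<eta> * Q m) * ?n\<^sup>2)" by (rule real_sqrt_le_mono)
      also have "\<dots> = sqrt (4 * \<eta> + C\<eta> * Q m) * ?n" using mt by (simp only: real_sqrt_mult real_sqrt_abs abs_of_pos)
      finally have "\<bar>\<theta>\<bar> * sqrt (4 * \<eta> * card tg.I0 + C\<eta> * tg.E2) \<le> \<bar>\<theta>\<bar> * (sqrt (4 * \<eta> + C\<eta> * Q m) * ?n)"
        by (rule mult_left_mono) simp
      also have "\<dots> = (\<bar>\<theta>\<bar> * ?n) * sqrt (4 * \<eta> + C\<eta> * Q m)" by (simp only: mult_ac)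
      also have "\<dots> \<le> L * sqrt (4 * \<eta> + C\<eta> * Q m)" using \<theta>n \<eta> C\<eta> Q0 by (intro mult_right_mono) auto
      finally show "\<bar>\<theta>\<bar> * sqrt (4 * \<eta> * card tg.I0 + C\<eta> * tg.E2) \<le> L * sqrt (4 * \<eta> + C\<eta> * Q m)" .
      have "\<bar>\<theta>\<bar> ^ 3 * (card tg.I0 + tg.V tg.I0) \<le> (L * (1 / ?n)) ^ 3 * (?n\<^sup>2 + C * ?n\<^sup>2)"
        using \<theta> card elim(5) tg.V_nonneg[OF tg.I01(1)] L mt
        by (intro mult_mono power_mono add_mono) auto
      also have "\<dots> = L ^ 3 * (1 + C) * (1 / ?n)" using elim(1) \<tau>m by (simp add: field_simps power2_eq_square power3_eq_cube)
      also have "\<dots> \<le> L ^ 3 * (1 + C) * (1 / sqrt (real m))" using L C by (intro mult_left_mono[OF inv_n]) auto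
      finally show "4 * K3 * \<bar>\<theta>\<bar> ^ 3 * (card tg.I0 + tg.V tg.I0) \<le> 4 * K3 * (L ^ 3 * (1 + C)) * (1 / sqrt (real m))"
        using mult_left_mono[of _ _ "4 * K3"] K3_ge_1 by (simp only: mult.assoc)
    qed
    also note elim(2)
    finally show ?case by (simp add: dist_norm)
  qed
qed

lemma FDP_char:
  assumes var: "\<forall>\<^sub>F m in sequentially. m0 m (H m) * rvar (Phi_inv ts)
      + (std_normal_density (Phi_inv ts))\<^sup>2 * gaussian_family.V (\<Gamma> m) (two_group.I0 m (H m)) = (m0 m (H m) * ts * s m)\<^sup>2"
  shows "(\<lambda>m. CLINT \<omega>|M m. iexp (u * X m \<omega>)) \<longlonglongrightarrow> of_real (exp (- u\<^sup>2 / 2))"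
proof -
  have "(\<lambda>m. (CLINT \<omega>|M m. iexp (u * X m \<omega>)) - (CLINT \<omega>|M m. iexp (u * S m \<omega>))) \<longlonglongrightarrow> 0"
    by (rule tendsto_norm_zero_cancel[OF linearisation_negligible])
  from tendsto_add[OF this linear_part_char[OF var, of u]] show ?thesis by simp
qed

end

section \<open>Rates and the limit theorem\<close>

lemma powr_minus_half:
  fixes q :: real
  assumes "0 < q" shows "q powr (- 1 / 2) = 1 / sqrt q"
proof -
  have "q powr - (1 / 2) = inverse (q powr (1 / 2))" by (rule powr_minus)
  also have "q powr (1 / 2) = sqrt q" using assms by (intro powr_half_sqrt) simp
  finally have "q powr - (1 / 2) = 1 / sqrt q" by (simp only: inverse_eq_divide)
  then show ?thesis by (simp only: minus_divide_left)
qed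

lemma variance_le_rate:
  fixes k g n \<tau> c :: real
  assumes k: "0 \<le> k" "k \<le> n" and c: "c > 0" "c \<le> (1 / k + \<bar>g\<bar>) powr (- 1 / 2) * \<tau>"
  shows "k + k\<^sup>2 * g \<le> (1 / c)\<^sup>2 * (n * \<tau>)\<^sup>2"
proof (cases "k = 0")
  case False
  define q where "q = 1 / k + \<bar>g\<bar>"
  have k0: "k > 0" using k False by simp
  then have q: "q > 0" by (simp add: q_def add_pos_nonneg)
  have "c \<le> \<tau> / sqrt q" using c(2) powr_minus_half[OF q] by (simp add: q_def)
  then have "sqrt q \<le> 1 / c * \<tau>" using q c(1) by (simp add: field_simps)
  then have "(sqrt q)\<^sup>2 \<le> (1 / c * \<tau>)\<^sup>2" using q by (intro power_mono) auto
  then have q2: "q \<le> (1 / c * \<tau>)\<^sup>2" using q by simp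
  have "k + k\<^sup>2 * g \<le> k + k\<^sup>2 * \<bar>g\<bar>" by (intro add_left_mono mult_left_mono) auto
  also have "\<dots> = k\<^sup>2 * q" using k0 by (simp add: q_def power2_eq_square field_simps)
  also have "\<dots> \<le> n\<^sup>2 * (1 / c * \<tau>)\<^sup>2" using k q q2 by (intro mult_mono power_mono) auto
  finally show ?thesis by (simp only: power_mult_distrib mult_ac)
qed simp

text \<open>Only a negative \<open>g\<close> can make the right side small, but \<open>g\<close>
  cannot be below \<open>- 1 / k\<close>, and the term \<open>\<rho> / k\<close> survives
  a cancellation in the rest.\<close>

lemma rate_le_variance:
  fixes k g \<rho> b :: real
  assumes k: "k > 0" and v: "0 \<le> k + k\<^sup>2 * g" and "\<rho> > 0" "b > 0"
  shows "min (\<rho> / 2) b * (1 / k + \<bar>g\<bar>) \<le> (\<rho> + b) / k + b * g"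
proof (cases "g \<ge> 0")
  case True
  have "min (\<rho> / 2) b * (1 / k + \<bar>g\<bar>) \<le> b * (1 / k + g)"
    using assms True by (intro mult_mono) auto
  also have "\<dots> \<le> (\<rho> + b) / k + b * g" using assms by (simp add: distrib_left add_divide_distrib)
  finally show ?thesis .
next
  case False
  have "0 \<le> k\<^sup>2 * (1 / k + g)" using k v by (simp add: power2_eq_square distrib_left)
  then have g: "0 \<le> 1 / k + g" using k by (simp add: zero_le_mult_iff)
  have "min (\<rho> / 2) b * (1 / k + \<bar>g\<bar>) \<le> \<rho> / 2 * (1 / k + 1 / k)"
    using assms g False by (intro mult_mono add_left_mono) auto
  also have "\<dots> = \<rho> / k" by simp
  also have "\<dots> \<le> \<rho> / k + b * (1 / k + g)" using assms g by simp
  also have "\<dots> = (\<rho> + b) / k + b * g" by (simp add: distrib_left add_divide_distrib)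
  finally show ?thesis .
qed

text \<open>The contributions of \<open>(std_normal_density (Phi_inv ts))\<^sup>2\<close> to
  \<open>rvar\<close> and to the diagonal part of \<open>V I0\<close> cancel, leaving the
  Bernoulli variance \<open>ts * (1 - ts)\<close> and the off-diagonal covariances.\<close>

lemma (in two_group) null_variance:
  assumes "m0 m H > 0"
  shows "m0 m H * rvar (Phi_inv ts) + (std_normal_density (Phi_inv ts))\<^sup>2 * V I0
    = (m0 m H * ts)\<^sup>2 * ((1 / ts - 1) / m0 m H + h ts * gam0 m H \<Gamma>)"
proof -
  have "rvar (Phi_inv ts) = ts * (1 - ts) - (std_normal_density (Phi_inv ts))\<^sup>2"
    using ts by (simp add: rvar_def Phi_Phi_inv)
  moreover have "h ts * ts\<^sup>2 = (std_normal_density (Phi_inv ts))\<^sup>2"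
    using ts by (simp add: h_def power_divide)
  then have "(m0 m H * ts)\<^sup>2 * (h ts * gam0 m H \<Gamma>) = (m0 m H)\<^sup>2 * (std_normal_density (Phi_inv ts))\<^sup>2 * gam0 m H \<Gamma>"
    unfolding power_mult_distrib by (simp only: mult_ac)
  moreover have "(m0 m H * ts)\<^sup>2 * ((1 / ts - 1) / m0 m H) = m0 m H * (ts * (1 - ts))"
    using ts assms by (simp add: power2_eq_square field_simps)
  ultimately show ?thesis
    unfolding V_I0 distrib_left[of "(m0 m H * ts)\<^sup>2"] by (simp only:) (simp add: algebra_simps)
qed

theorem corollary4p1:
  fixes M :: "nat \<Rightarrow> 'a measure"
    and Y :: "nat \<Rightarrow> nat \<Rightarrow> 'a \<Rightarrow> real"
    and \<Gamma> :: "nat \<Rightarrow> nat \<Rightarrow> nat \<Rightarrow> real"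
    and H :: "nat \<Rightarrow> nat \<Rightarrow> real"
    and \<delta> \<pi>0 \<alpha> :: real
  assumes "\<And>m. m \<ge> 1 \<Longrightarrow> prob_space (M m)"
    and "\<And>m. m \<ge> 1 \<Longrightarrow> centered_gaussian_vector (M m) m (Y m) (\<Gamma> m)"
    and "\<And>m i. i \<in> {1..m} \<Longrightarrow> \<Gamma> m i i = 1"
    and "\<And>m i. i \<in> {1..m} \<Longrightarrow> H m i \<in> {0, 1}"
    and "\<delta> > 0"
    and "0 < \<pi>0" and "\<pi>0 < 1"
    and "(\<lambda>m. sqrt (real m) * (m0 m (H m) / real m - \<pi>0)) \<longlonglongrightarrow> 0"
    and "((\<lambda>m. (rate m (\<Gamma> m))\<^sup>2 / (real m)\<^sup>2 * off_diag_sum m (\<lambda>i j. (\<Gamma> m i j)^2)) \<longlonglongrightarrow> 0 \<and>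
          (\<exists>\<epsilon>>0. (\<lambda>m. rate m (\<Gamma> m) powr (4 + \<epsilon>) / (real m)\<^sup>2
                    * off_diag_sum m (\<lambda>i j. (\<Gamma> m i j)^4)) \<longlonglongrightarrow> 0))
       \<or>
         ((\<exists>\<epsilon>>0. (\<lambda>m. rate m (\<Gamma> m) powr (2 + \<epsilon>) / (real m)\<^sup>2
                    * off_diag_sum m (\<lambda>i j. (\<Gamma> m i j)^2)) \<longlonglongrightarrow> 0) \<and>
          (\<forall>\<^sub>F m in sequentially. gam m (\<Gamma> m) > 0) \<and>
          (\<exists>\<epsilon>>0. filterlim (\<lambda>m. real m * gam m (\<Gamma> m) powr (1 + \<epsilon>)) at_top sequentially))"
    and "filterlim (\<lambda>m. rate m (\<Gamma> m)) at_top sequentially"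
    and "filterlim (\<lambda>m. rate0 m (H m) (\<Gamma> m)) at_top sequentially"
    and "filterlim (\<lambda>m. rate1 m (H m) (\<Gamma> m)) at_top sequentially"
    and "\<exists>c>0. (\<lambda>m. rate0 m (H m) (\<Gamma> m) / rate m (\<Gamma> m)) \<longlonglongrightarrow> c"
    and "\<exists>c>0. (\<lambda>m. rate1 m (H m) (\<Gamma> m) / rate m (\<Gamma> m)) \<longlonglongrightarrow> c"
    and "0 < \<alpha>" and "\<alpha> < 1"
  shows "weak_conv_m
     (\<lambda>m. distr (M m) borel (\<lambda>\<omega>.
        (FDP \<alpha> m (H m) (\<lambda>i. \<delta> * H m i + Y m i \<omega>) - \<pi>0 * \<alpha>) /
        (\<pi>0 * \<alpha> * sqrt ((1 / t_star \<delta> \<pi>0 \<alpha> - 1) / m0 m (H m)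
                            + h (t_star \<delta> \<pi>0 \<alpha>) * gam0 m (H m) (\<Gamma> m)))))
     std_normal_distribution"
proof -
  define t where "t = t_star \<delta> \<pi>0 \<alpha>"
  define \<tau> where "\<tau> m = 1 / rate m (\<Gamma> m)" for m
  define s where "s m = sqrt ((1 / t - 1) / m0 m (H m) + h t * gam0 m (H m) (\<Gamma> m))" for m
  define Q where "Q m = off_diag_sum m (\<lambda>i j. (\<Gamma> m i j)^2)" for m
  have t: "0 < t" "t < 1" using t_star_props[OF assms(5,6,7,15,16)] assms(16) by (auto simp: t_def)
  have tg: "two_group (M m) m (Y m) (\<Gamma> m) (H m) \<delta> \<alpha> \<pi>0" if "m \<ge> 1" for m
  proof -
    interpret gaussian_family "M m" "{1..m}" "Y m" "\<Gamma> m"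
      by (rule gaussian_family_of_vector[OF assms(1,2,3)]) (use that in auto)
    show ?thesis by unfold_locales (use that assms in auto)
  qed
  have q: "1 / real m + \<bar>gam m (\<Gamma> m)\<bar> > 0" if "m \<ge> 1" for m
    using that by (simp add: add_pos_nonneg)
  have \<tau>: "\<tau> m = sqrt (1 / real m + \<bar>gam m (\<Gamma> m)\<bar>)" if "m \<ge> 1" for m
    unfolding \<tau>_def rate_def powr_minus_half[OF q[OF that]] by simp
  have \<tau>_pos: "0 < \<tau> m" if "m \<ge> 1" for m
    unfolding \<tau>[OF that] using q[OF that] by simp
  have \<tau>2: "1 / real m \<le> (\<tau> m)\<^sup>2" if "m \<ge> 1" for m
    unfolding \<tau>[OF that] using q[OF that] by simp
  have m1: "\<forall>\<^sub>F m in sequentially. m \<ge> (1::nat)" by (rule eventually_ge_at_top)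
  have Q0: "0 \<le> Q m" for m unfolding Q_def off_diag_sum_def by (intro sum_nonneg) auto
  have Q_eq: "Q m / (m * \<tau> m)\<^sup>2 = (rate m (\<Gamma> m))\<^sup>2 / (real m)\<^sup>2 * Q m" for m
    unfolding \<tau>_def by (simp add: power_divide power_mult_distrib)
  (* In the second regime the exponent 2 + epsilon dominates the exponent 2 since the rate
     is eventually at least 1. *)
  have Q_lim: "(\<lambda>m. Q m / (m * \<tau> m)\<^sup>2) \<longlonglongrightarrow> 0"
    using assms(9)
  proof (elim disjE conjE exE)
    assume "(\<lambda>m. (rate m (\<Gamma> m))\<^sup>2 / (real m)\<^sup>2 * off_diag_sum m (\<lambda>i j. (\<Gamma> m i j)^2)) \<longlonglongrightarrow> 0"
    then show ?thesis unfolding Q_eq unfolding Q_def .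
  next
    fix \<epsilon> :: real assume \<epsilon>: "\<epsilon> > 0"
      and l: "(\<lambda>m. rate m (\<Gamma> m) powr (2 + \<epsilon>) / (real m)\<^sup>2 * off_diag_sum m (\<lambda>i j. (\<Gamma> m i j)^2)) \<longlonglongrightarrow> 0"
    have "\<forall>\<^sub>F m in sequentially. 1 \<le> rate m (\<Gamma> m)"
      using assms(10) by (simp add: filterlim_at_top)
    then have "\<forall>\<^sub>F m in sequentially. norm (Q m / (m * \<tau> m)\<^sup>2) \<le> rate m (\<Gamma> m) powr (2 + \<epsilon>) / (real m)\<^sup>2 * off_diag_sum m (\<lambda>i j. (\<Gamma> m i j)^2)"
    proof eventually_elim
      case (elim m)
      have "(rate m (\<Gamma> m))\<^sup>2 = rate m (\<Gamma> m) powr 2" using elim by simp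
      also have "\<dots> \<le> rate m (\<Gamma> m) powr (2 + \<epsilon>)" using elim \<epsilon> by (intro powr_mono) auto
      finally show ?case
        unfolding Q_eq Q_def[symmetric] using Q0[of m] by (simp add: mult_right_mono divide_right_mono)
    qed
    then show ?thesis by (rule Lim_null_comparison[OF _ l])
  qed
  have \<tau>_lim: "\<tau> \<longlonglongrightarrow> 0"
    unfolding \<tau>_def[abs_def] by (intro tendsto_divide_0[OF tendsto_const] filterlim_at_top_imp_at_infinity assms(10))
  have d_lim: "(\<lambda>m. \<bar>m0 m (H m) / m - \<pi>0\<bar> / \<tau> m) \<longlonglongrightarrow> 0"
  proof (rule Lim_null_comparison)
    show "(\<lambda>m. \<bar>sqrt (real m) * (m0 m (H m) / real m - \<pi>0)\<bar>) \<longlonglongrightarrow> 0"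
      using assms(8) by (rule tendsto_rabs_zero)
    show "\<forall>\<^sub>F m in sequentially. norm (\<bar>m0 m (H m) / m - \<pi>0\<bar> / \<tau> m) \<le> \<bar>sqrt (real m) * (m0 m (H m) / real m - \<pi>0)\<bar>"
      using m1
    proof eventually_elim
      case (elim m)
      have "sqrt (1 / real m) \<le> sqrt ((\<tau> m)\<^sup>2)" using \<tau>2[OF elim] by (rule real_sqrt_le_mono)
      then have "1 / sqrt (real m) \<le> \<tau> m" using \<tau>_pos[OF elim] by (simp add: real_sqrt_divide)
      then have "1 / \<tau> m \<le> sqrt (real m)" using \<tau>_pos[OF elim] elim by (simp add: field_simps)
      then have "1 / \<tau> m * \<bar>m0 m (H m) / m - \<pi>0\<bar> \<le> sqrt (real m) * \<bar>m0 m (H m) / m - \<pi>0\<bar>" by (rule mult_right_mono) simp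
      then show ?case using \<tau>_pos[OF elim] by (simp add: abs_mult)
    qed
  qed
  obtain c0 where c0: "c0 > 0" and lim0: "(\<lambda>m. rate0 m (H m) (\<Gamma> m) / rate m (\<Gamma> m)) \<longlonglongrightarrow> c0" using assms(13) by blast
  obtain c1 where c1: "c1 > 0" and lim1: "(\<lambda>m. rate1 m (H m) (\<Gamma> m) / rate m (\<Gamma> m)) \<longlonglongrightarrow> c1" using assms(14) by blast
  have ev0: "\<forall>\<^sub>F m in sequentially. c0 / 2 < rate0 m (H m) (\<Gamma> m) / rate m (\<Gamma> m)"
    and ev0': "\<forall>\<^sub>F m in sequentially. rate0 m (H m) (\<Gamma> m) / rate m (\<Gamma> m) < 2 * c0"
    and ev1: "\<forall>\<^sub>F m in sequentially. c1 / 2 < rate1 m (H m) (\<Gamma> m) / rate m (\<Gamma> m)"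
    using c0 c1 by (intro order_tendstoD[OF lim0] order_tendstoD[OF lim1]; simp)+
  define C where "C = (1 / (c0 / 2))\<^sup>2 + (1 / (c1 / 2))\<^sup>2"
  have V0: "\<forall>\<^sub>F m in sequentially. gaussian_family.V (\<Gamma> m) (two_group.I0 m (H m)) \<le> C * (m * \<tau> m)\<^sup>2"
    using ev0 m1
  proof eventually_elim
    case (elim m)
    interpret two_group "M m" m "Y m" "\<Gamma> m" "H m" \<delta> \<alpha> \<pi>0 by (rule tg[OF elim(2)])
    have "V I0 \<le> (1 / (c0 / 2))\<^sup>2 * (m * \<tau> m)\<^sup>2"
      unfolding V_I0
    proof (rule variance_le_rate)
      show "0 \<le> m0 m (H m)" "m0 m (H m) \<le> real m" using card_le(1) unfolding card_I0[symmetric] by auto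
      have "c0 / 2 \<le> rate0 m (H m) (\<Gamma> m) * \<tau> m" using elim(1) by (simp add: \<tau>_def)
      then show "c0 / 2 \<le> (1 / m0 m (H m) + \<bar>gam0 m (H m) (\<Gamma> m)\<bar>) powr (- 1 / 2) * \<tau> m"
        unfolding rate0_def .
    qed (use c0 in simp)
    also have "\<dots> \<le> C * (m * \<tau> m)\<^sup>2" unfolding C_def by (intro mult_right_mono) auto
    finally show ?case .
  qed
  have V1: "\<forall>\<^sub>F m in sequentially. gaussian_family.V (\<Gamma> m) (two_group.I1 m (H m)) \<le> C * (m * \<tau> m)\<^sup>2"
    using ev1 m1
  proof eventually_elim
    case (elim m)
    interpret two_group "M m" m "Y m" "\<Gamma> m" "H m" \<delta> \<alpha> \<pi>0 by (rule tg[OF elim(2)])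
    have "V I1 \<le> (1 / (c1 / 2))\<^sup>2 * (m * \<tau> m)\<^sup>2"
      unfolding V_I1
    proof (rule variance_le_rate)
      show "0 \<le> m1 m (H m)" "m1 m (H m) \<le> real m" using card_le(2) unfolding card_I1[symmetric] by auto
      have "c1 / 2 \<le> rate1 m (H m) (\<Gamma> m) * \<tau> m" using elim(1) by (simp add: \<tau>_def)
      then show "c1 / 2 \<le> (1 / m1 m (H m) + \<bar>gam1 m (H m) (\<Gamma> m)\<bar>) powr (- 1 / 2) * \<tau> m"
        unfolding rate1_def .
    qed (use c1 in simp)
    also have "\<dots> \<le> C * (m * \<tau> m)\<^sup>2" unfolding C_def by (intro mult_right_mono) auto
    finally show ?case .
  qed
  define \<rho> where "\<rho> = rvar (Phi_inv t) / t\<^sup>2"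
  have \<rho>: "\<rho> > 0" using rvar_pos t by (simp add: \<rho>_def)
  have ht: "h t > 0" using std_normal_pos[of "Phi_inv t"] t by (simp add: h_def)
  have \<rho>h: "1 / t - 1 = \<rho> + h t"
    using t by (simp add: \<rho>_def h_def rvar_def Phi_Phi_inv power2_eq_square field_simps)
  define cs where "cs = sqrt (min (\<rho> / 2) (h t)) / (2 * c0)"
  have cs: "cs > 0" using \<rho> ht c0 by (simp add: cs_def)
  have m0_pos: "\<forall>\<^sub>F m in sequentially. m0 m (H m) > 0"
  proof -
    have "(\<lambda>m. m0 m (H m) / m - \<pi>0) \<longlonglongrightarrow> 0"
    proof (rule Lim_null_comparison)
      show "(\<lambda>m. \<bar>sqrt (real m) * (m0 m (H m) / real m - \<pi>0)\<bar>) \<longlonglongrightarrow> 0"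
        using assms(8) by (rule tendsto_rabs_zero)
      show "\<forall>\<^sub>F m in sequentially. norm (m0 m (H m) / m - \<pi>0) \<le> \<bar>sqrt (real m) * (m0 m (H m) / real m - \<pi>0)\<bar>"
        using m1
      proof eventually_elim
        case (elim m)
        have "1 * \<bar>m0 m (H m) / m - \<pi>0\<bar> \<le> sqrt (real m) * \<bar>m0 m (H m) / m - \<pi>0\<bar>" using elim by (intro mult_right_mono) auto
        then show ?case by (simp add: abs_mult)
      qed
    qed
    then have "\<forall>\<^sub>F m in sequentially. m0 m (H m) / m - \<pi>0 > - \<pi>0" using assms(6) by (intro order_tendstoD(1)) auto
    then show ?thesis using m1 by eventually_elim (simp add: zero_less_divide_iff)
  qed
  have s_lower: "\<forall>\<^sub>F m in sequentially. min (\<rho> / 2) (h t) * (1 / m0 m (H m) + \<bar>gam0 m (H m) (\<Gamma> m)\<bar>)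
      \<le> (1 / t - 1) / m0 m (H m) + h t * gam0 m (H m) (\<Gamma> m)"
    using m0_pos m1
  proof eventually_elim
    case (elim m)
    interpret two_group "M m" m "Y m" "\<Gamma> m" "H m" \<delta> \<alpha> \<pi>0 by (rule tg[OF elim(2)])
    show ?case unfolding \<rho>h by (rule rate_le_variance[OF elim(1) V_nonneg[OF I01(1), unfolded V_I0] \<rho> ht])
  qed
  have s: "\<forall>\<^sub>F m in sequentially. cs * \<tau> m \<le> s m"
    using s_lower ev0' m0_pos m1
  proof eventually_elim
    case (elim m)
    define q0 where "q0 = 1 / m0 m (H m) + \<bar>gam0 m (H m) (\<Gamma> m)\<bar>"
    have q0: "q0 > 0" using elim(3) by (simp add: q0_def add_pos_nonneg)
    have "rate0 m (H m) (\<Gamma> m) = 1 / sqrt q0"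
      unfolding rate0_def q0_def[symmetric] by (rule powr_minus_half[OF q0])
    then have "\<tau> m / sqrt q0 < 2 * c0" using elim(2) by (simp add: \<tau>_def mult.commute)
    then have "\<tau> m / (2 * c0) \<le> sqrt q0" using q0 c0 by (simp add: field_simps)
    then have "sqrt (min (\<rho> / 2) (h t)) * (\<tau> m / (2 * c0)) \<le> sqrt (min (\<rho> / 2) (h t)) * sqrt q0"
      using \<rho> ht by (intro mult_left_mono) auto
    also have "\<dots> \<le> s m" unfolding s_def real_sqrt_mult[symmetric] q0_def by (rule real_sqrt_le_mono[OF elim(1)])
    finally show ?case by (simp add: cs_def)
  qed
  interpret seq: two_group_sequence M Y \<Gamma> H \<delta> \<alpha> \<pi>0 \<tau> s C cs
  proof (rule two_group_sequence.intro)
    show "real m \<le> (m * \<tau> m)\<^sup>2" if "m \<ge> 1" for m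
    proof -
      have "(real m)\<^sup>2 * (1 / m) \<le> (real m)\<^sup>2 * (\<tau> m)\<^sup>2" by (rule mult_left_mono[OF \<tau>2[OF that]]) simp
      then show ?thesis using that by (simp add: power2_eq_square mult_ac)
    qed
    show "C \<ge> 0" by (simp add: C_def)
  qed (fact tg \<tau>_pos \<tau>_lim d_lim Q_lim[unfolded Q_def] V0 V1 cs s)+
  have var: "\<forall>\<^sub>F m in sequentially. m0 m (H m) * rvar (Phi_inv seq.ts)
      + (std_normal_density (Phi_inv seq.ts))\<^sup>2 * gaussian_family.V (\<Gamma> m) (two_group.I0 m (H m)) = (m0 m (H m) * seq.ts * s m)\<^sup>2"
    using m0_pos s_lower m1
  proof eventually_elim
    case (elim m)
    interpret g: two_group "M m" m "Y m" "\<Gamma> m" "H m" \<delta> \<alpha> \<pi>0 by (rule tg[OF elim(3)])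
    have "0 \<le> min (\<rho> / 2) (h t) * (1 / m0 m (H m) + \<bar>gam0 m (H m) (\<Gamma> m)\<bar>)"
      using \<rho> ht elim(1) by (intro mult_nonneg_nonneg) auto
    then have "(s m)\<^sup>2 = (1 / t - 1) / m0 m (H m) + h t * gam0 m (H m) (\<Gamma> m)"
      unfolding s_def using elim(2) by (intro real_sqrt_pow2) linarith
    moreover have "seq.ts = t" "g.ts = t" by (simp_all add: seq.ts_def g.ts_def t_def)
    ultimately show ?case using g.null_variance[OF elim(1)] by (simp add: power_mult_distrib)
  qed
  (* M 0 need not be a probability space, so the continuity theorem is applied to the
     sequence from 1 on. *)
  define N where "N m = distr (M m) borel (seq.X m)" for m
  have N: "real_distribution (N (Suc n))" and char_N: "char (N (Suc n)) u = (CLINT \<omega>|M (Suc n). iexp (u * seq.X (Suc n) \<omega>))" for n u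
  proof -
    interpret g: two_group "M (Suc n)" "Suc n" "Y (Suc n)" "\<Gamma> (Suc n)" "H (Suc n)" \<delta> \<alpha> \<pi>0 by (rule tg) simp
    have [measurable]: "seq.X (Suc n) \<in> borel_measurable (M (Suc n))" by (rule seq.measurable_X) simp
    show "real_distribution (N (Suc n))" unfolding N_def by (rule g.real_distribution_distr) measurable
    show "char (N (Suc n)) u = (CLINT \<omega>|M (Suc n). iexp (u * seq.X (Suc n) \<omega>))"
      unfolding N_def by (rule char_distr) measurable
  qed
  have "weak_conv_m (\<lambda>n. N (Suc n)) std_normal_distribution"
  proof (rule levy_continuity[OF N real_dist_normal_dist])
    show "(\<lambda>n. char (N (Suc n)) u) \<longlonglongrightarrow> char std_normal_distribution u" for u
      using LIMSEQ_Suc[OF seq.FDP_char[OF var, of u]] by (simp add: char_N char_std_normal_distribution)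
  qed
  then have "weak_conv_m N std_normal_distribution"
    unfolding weak_conv_m_def weak_conv_def by (blast intro: LIMSEQ_imp_Suc)
  then show ?thesis unfolding N_def[abs_def] seq.X_def[abs_def] s_def t_def .
qed

end
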